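(* Let $A$ be an associative ring with identity, of characteristic $0$, with torsion-free additive group, let $F_A(X)$ be a nonabelian free $A$-group with base $X$, and let $F=F(X)$ be the ordinary free group on $X$. Then: (1) the canonical map $F\to F_A(X)$ is injective; (2) $F_A(X)$ is a torsion-free group with conjugately separated maximal abelian subgroups; (3) $F_A(X)$ has no nonabelian solvable subgroups; (4) $F_A(X)$ has no nonabelian Baumslag-Solitar subgroups; (5) $F_A(X)$ has trivial center and is directly indecomposable.
   Context: An $A$-group is a group $G$ with a map $G\times A\to G$, $(g,\alpha)\mapsto g^\alpha$, such that for all $g,h\in G$, $\alpha,\beta\in A$: (1) $g^1=g$, $g^0=1$, $1^\alpha=1$; (2) $g^{\alpha+\beta}=g^\alpha g^\beta$, $g^{\alpha\beta}=(g^\alpha)^\beta$; (3) $(h^{-1}gh)^\alpha=h^{-1}g^\alpha h$; (4) $[g,h]=1$ implies $(gh)^\alpha=g^\alpha h^\alpha$. An $A$-homomorphism is a group homomorphism $f$ with $f(g^\alpha)=f(g)^\alpha$. A free $A$-group with base $X$ is an $A$-group $F_A(X)$ generated as an $A$-group by $X$ such that every map from $X$ to an $A$-group $G$ extends to an $A$-homomorphism $F_A(X)\to G$; it exists and is unique up to $A$-isomorphism, and it is the tensor $A$-completion of $F(X)$. The canonical map $F(X)\to F_A(X)$ is the homomorphism extending the identity on $X$. A subgroup $H\le G$ is conjugately separated if $H\cap H^x=1$ for every $x\in G\setminus H$. Baumslag-Solitar groups are the groups $G_{r,s}=\langle a,b\mid a^{-1}b^ra=b^s\rangle$ with $r,s\in\mathbf{Z}$,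 $r>0$. A group is directly indecomposable if it is not a direct product of two nontrivial subgroups. *)

theory Defs
  imports "HOL-Algebra.Ring" "HOL-Algebra.Solvable_Groups"
begin

section \<open>Groups with exponents in a ring\<close>

record ('a, 'g) exp_group = "'g monoid" +
  expo :: "'g \<Rightarrow> 'a \<Rightarrow> 'g" (infixl \<open>\<up>\<index>\<close> 75)

locale exp_group = R: ring R + G: group G
  for R :: "('a, 'm) ring_scheme" (structure)
  and G :: "('a, 'g, 'k) exp_group_scheme" (structure) +
  assumes expo_closed:
      "\<lbrakk>g \<in> carrier G; \<alpha> \<in> carrier R\<rbrakk> \<Longrightarrow> g \<up>\<^bsub>G\<^esub> \<alpha> \<in> carrier G"
    and expo_ring_one: "g \<in> carrier G \<Longrightarrow> g \<up>\<^bsub>G\<^esub> \<one>\<^bsub>R\<^esub> = g"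
    and expo_ring_zero: "g \<in> carrier G \<Longrightarrow> g \<up>\<^bsub>G\<^esub> \<zero>\<^bsub>R\<^esub> = \<one>\<^bsub>G\<^esub>"
    and one_expo: "\<alpha> \<in> carrier R \<Longrightarrow> \<one>\<^bsub>G\<^esub> \<up>\<^bsub>G\<^esub> \<alpha> = \<one>\<^bsub>G\<^esub>"
    and expo_add: "\<lbrakk>g \<in> carrier G; \<alpha> \<in> carrier R; \<beta> \<in> carrier R\<rbrakk> \<Longrightarrow>
      g \<up>\<^bsub>G\<^esub> (\<alpha> \<oplus>\<^bsub>R\<^esub> \<beta>) = g \<up>\<^bsub>G\<^esub> \<alpha> \<otimes>\<^bsub>G\<^esub> g \<up>\<^bsub>G\<^esub> \<beta>"
    and expo_mult: "\<lbrakk>g \<in> carrier G; \<alpha> \<in> carrier R; \<beta> \<in> carrier R\<rbrakk> \<Longrightarrow>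
      g \<up>\<^bsub>G\<^esub> (\<alpha> \<otimes>\<^bsub>R\<^esub> \<beta>) = (g \<up>\<^bsub>G\<^esub> \<alpha>) \<up>\<^bsub>G\<^esub> \<beta>"
    and expo_conj: "\<lbrakk>g \<in> carrier G; h \<in> carrier G; \<alpha> \<in> carrier R\<rbrakk> \<Longrightarrow>
      (inv\<^bsub>G\<^esub> h \<otimes>\<^bsub>G\<^esub> g \<otimes>\<^bsub>G\<^esub> h) \<up>\<^bsub>G\<^esub> \<alpha> = inv\<^bsub>G\<^esub> h \<otimes>\<^bsub>G\<^esub> g \<up>\<^bsub>G\<^esub> \<alpha> \<otimes>\<^bsub>G\<^esub> h"
    and expo_commute: "\<lbrakk>g \<in> carrier G; h \<in> carrier G; \<alpha> \<in> carrier R;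
        inv\<^bsub>G\<^esub> g \<otimes>\<^bsub>G\<^esub> inv\<^bsub>G\<^esub> h \<otimes>\<^bsub>G\<^esub> g \<otimes>\<^bsub>G\<^esub> h = \<one>\<^bsub>G\<^esub>\<rbrakk> \<Longrightarrow>
      (g \<otimes>\<^bsub>G\<^esub> h) \<up>\<^bsub>G\<^esub> \<alpha> = g \<up>\<^bsub>G\<^esub> \<alpha> \<otimes>\<^bsub>G\<^esub> h \<up>\<^bsub>G\<^esub> \<alpha>"

definition exp_hom ::
  "('a, 'm) ring_scheme \<Rightarrow> ('a, 'g, 'k) exp_group_scheme \<Rightarrow> ('a, 'h, 'l) exp_group_scheme \<Rightarrow> ('g \<Rightarrow> 'h) set"
  where "exp_hom R G H =
    {f \<in> hom G H. \<forall>g\<in>carrier G. \<forall>\<alpha>\<in>carrier R. f (g \<up>\<^bsub>G\<^esub> \<alpha>) = f g \<up>\<^bsub>H\<^esub> \<alpha>}"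

inductive_set exp_generate ::
  "('a, 'm) ring_scheme \<Rightarrow> ('a, 'g, 'k) exp_group_scheme \<Rightarrow> 'g set \<Rightarrow> 'g set"
  for R G X where
    incl: "x \<in> X \<Longrightarrow> x \<in> exp_generate R G X"
  | one: "\<one>\<^bsub>G\<^esub> \<in> exp_generate R G X"
  | mult: "\<lbrakk>g \<in> exp_generate R G X; h \<in> exp_generate R G X\<rbrakk> \<Longrightarrow> g \<otimes>\<^bsub>G\<^esub> h \<in> exp_generate R G X"
  | inv: "g \<in> exp_generate R G X \<Longrightarrow> inv\<^bsub>G\<^esub> g \<in> exp_generate R G X"
  | expo: "\<lbrakk>g \<in> exp_generate R G X; \<alpha> \<in> carrier R\<rbrakk> \<Longrightarrow> g \<up>\<^bsub>G\<^esub> \<alpha> \<in> exp_generate R G X"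

subsection \<open>Free groups with exponents\<close>

text \<open>
  A universal property cannot quantify over groups of all types inside a definition.
  In the definition of a free group it is therefore required only for target groups whose
  elements are formal expressions over the base. This is no restriction: the image of the
  base generates a subgroup all of whose elements are named by such expressions, so the
  property for arbitrary target types follows; see \<open>free_exp_group_universal\<close> below.
\<close>

datatype ('x, 'a) exp_term =
    Gen 'x
  | One
  | Mult "('x, 'a) exp_term" "('x, 'a) exp_term"
  | Inv "('x, 'a) exp_term"
  | Expo "('x, 'a) exp_term" 'a

definition free_exp_group ::
  "('a, 'm) ring_scheme \<Rightarrow> ('a, 'g, 'k) exp_group_scheme \<Rightarrow> 'g set \<Rightarrow> bool"
  where "free_exp_group R G X \<longleftrightarrow>
    exp_group R G \<and> X \<subseteq> carrier G \<and> exp_generate R G X = carrier G \<and>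
    (\<forall>(H :: ('a, ('g, 'a) exp_term) exp_group) f.
       exp_group R H \<longrightarrow> f \<in> X \<rightarrow> carrier H \<longrightarrow>
       (\<exists>\<phi> \<in> exp_hom R G H. \<forall>x\<in>X. \<phi> x = f x))"

primrec exp_term_value ::
  "('a, 'h, 'l) exp_group_scheme \<Rightarrow> ('x \<Rightarrow> 'h) \<Rightarrow> ('x, 'a) exp_term \<Rightarrow> 'h" where
  "exp_term_value H f (Gen x) = f x"
| "exp_term_value H f One = \<one>\<^bsub>H\<^esub>"
| "exp_term_value H f (Mult s t) = exp_term_value H f s \<otimes>\<^bsub>H\<^esub> exp_term_value H f t"
| "exp_term_value H f (Inv t) = inv\<^bsub>H\<^esub> (exp_term_value H f t)"
| "exp_term_value H f (Expo t \<alpha>) = exp_term_value H f t \<up>\<^bsub>H\<^esub> \<alpha>"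

lemma exp_group_transport:
  fixes T :: "('a, 't, 'k) exp_group_scheme" and H :: "('a, 'h, 'l) exp_group_scheme"
  assumes H: "exp_group R H"
    and e: "e \<in> carrier T \<rightarrow> carrier H" "inj_on e (carrier T)"
    and one: "\<one>\<^bsub>T\<^esub> \<in> carrier T" "e \<one>\<^bsub>T\<^esub> = \<one>\<^bsub>H\<^esub>"
    and mult: "\<And>s t. \<lbrakk>s \<in> carrier T; t \<in> carrier T\<rbrakk> \<Longrightarrow>
        s \<otimes>\<^bsub>T\<^esub> t \<in> carrier T \<and> e (s \<otimes>\<^bsub>T\<^esub> t) = e s \<otimes>\<^bsub>H\<^esub> e t"
    and inv: "\<And>t. t \<in> carrier T \<Longrightarrow> inv\<^bsub>H\<^esub> (e t) \<in> e ` carrier T"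
    and expo: "\<And>t \<alpha>. \<lbrakk>t \<in> carrier T; \<alpha> \<in> carrier R\<rbrakk> \<Longrightarrow>
        t \<up>\<^bsub>T\<^esub> \<alpha> \<in> carrier T \<and> e (t \<up>\<^bsub>T\<^esub> \<alpha>) = e t \<up>\<^bsub>H\<^esub> \<alpha>"
  shows "exp_group R T"
proof -
  interpret H: exp_group R H by (rule H)
  have ec: "\<And>t. t \<in> carrier T \<Longrightarrow> e t \<in> carrier H" using e(1) by auto
  have eqI: "s = t" if "s \<in> carrier T" "t \<in> carrier T" "e s = e t" for s t
    using that e(2) by (auto dest: inj_onD)
  interpret T: group T
  proof (rule groupI)
    fix x assume x: "x \<in> carrier T"
    then obtain y where y: "y \<in> carrier T" "inv\<^bsub>H\<^esub> (e x) = e y" using inv by blast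
    have "y \<otimes>\<^bsub>T\<^esub> x = \<one>\<^bsub>T\<^esub>"
      by (rule eqI) (use x y one mult ec H.G.l_inv[of "e x"] in simp_all)
    then show "\<exists>y\<in>carrier T. y \<otimes>\<^bsub>T\<^esub> x = \<one>\<^bsub>T\<^esub>" using y by blast
  qed (use mult one ec in \<open>auto intro!: eqI simp: H.G.m_assoc\<close>)
  have "e \<in> hom T H" using ec mult by (auto simp: hom_def)
  then interpret e: group_hom T H e
    by (simp add: group_hom_def group_hom_axioms_def T.is_group H.G.is_group)
  show ?thesis
  proof (unfold_locales, goal_cases)
    case (8 g h \<alpha>)
    have "e (inv\<^bsub>T\<^esub> g \<otimes>\<^bsub>T\<^esub> inv\<^bsub>T\<^esub> h \<otimes>\<^bsub>T\<^esub> g \<otimes>\<^bsub>T\<^esub> h)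
        = inv\<^bsub>H\<^esub> e g \<otimes>\<^bsub>H\<^esub> inv\<^bsub>H\<^esub> e h \<otimes>\<^bsub>H\<^esub> e g \<otimes>\<^bsub>H\<^esub> e h"
      using 8(1,2) by simp
    then have "inv\<^bsub>H\<^esub> e g \<otimes>\<^bsub>H\<^esub> inv\<^bsub>H\<^esub> e h \<otimes>\<^bsub>H\<^esub> e g \<otimes>\<^bsub>H\<^esub> e h = \<one>\<^bsub>H\<^esub>"
      using 8(4) one(2) by simp
    then show ?case
      using 8 by (intro eqI) (simp_all add: expo ec H.expo_commute)
  qed (auto intro!: eqI simp: expo one ec H.expo_ring_one H.expo_ring_zero
      H.one_expo H.expo_add H.expo_mult H.expo_conj)
qed

theorem free_exp_group_universal:
  fixes G :: "('a, 'g, 'k) exp_group_scheme" and H :: "('a, 'h, 'l) exp_group_scheme"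
  assumes free: "free_exp_group R G X" and H: "exp_group R H" and f: "f \<in> X \<rightarrow> carrier H"
  shows "\<exists>\<phi> \<in> exp_hom R G H. \<forall>x\<in>X. \<phi> x = f x"
proof -
  interpret G: exp_group R G using free by (simp add: free_exp_group_def)
  interpret H: exp_group R H by (rule H)
  define K where "K = exp_generate R H (f ` X)"
  have K_carrier: "k \<in> carrier H" if "k \<in> K" for k
    using that unfolding K_def
    by induction (use f in \<open>auto simp: H.expo_closed\<close>)
  define v :: "('g, 'a) exp_term \<Rightarrow> 'h" where "v = exp_term_value H f"
  have K_range: "k \<in> range v" if "k \<in> K" for k
    using that unfolding K_def
  proof induction
    case (incl k)
    then obtain x where "k = v (Gen x)" by (auto simp: v_def)
    then show ?case by blast
  next
    case one
    have "\<one>\<^bsub>H\<^esub> = v One" by (simp add: v_def)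
    then show ?case by blast
  next
    case (mult g h)
    then obtain s t where "g = v s" "h = v t" by blast
    then have "g \<otimes>\<^bsub>H\<^esub> h = v (Mult s t)" by (simp add: v_def)
    then show ?case by blast
  next
    case (inv g)
    then obtain t where "g = v t" by blast
    then have "inv\<^bsub>H\<^esub> g = v (Inv t)" by (simp add: v_def)
    then show ?case by blast
  next
    case (expo g \<alpha>)
    then obtain t where "g = v t" by blast
    then have "g \<up>\<^bsub>H\<^esub> \<alpha> = v (Expo t \<alpha>)" by (simp add: v_def)
    then show ?case by blast
  qed
  define rep where "rep k = (SOME t. v t = k)" for k
  have v_rep: "v (rep k) = k" if "k \<in> K" for k
    using K_range[OF that] someI[of "\<lambda>t. v t = k"] by (auto simp: rep_def)
  define T :: "('a, ('g, 'a) exp_term) exp_group" where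
    "T = \<lparr>carrier = rep ` K, monoid.mult = \<lambda>s t. rep (v s \<otimes>\<^bsub>H\<^esub> v t),
          one = rep \<one>\<^bsub>H\<^esub>, expo = \<lambda>t \<alpha>. rep (v t \<up>\<^bsub>H\<^esub> \<alpha>)\<rparr>"
  have Kc: "\<one>\<^bsub>H\<^esub> \<in> K" "\<And>g h. \<lbrakk>g \<in> K; h \<in> K\<rbrakk> \<Longrightarrow> g \<otimes>\<^bsub>H\<^esub> h \<in> K"
    "\<And>g. g \<in> K \<Longrightarrow> inv\<^bsub>H\<^esub> g \<in> K" "\<And>g \<alpha>. \<lbrakk>g \<in> K; \<alpha> \<in> carrier R\<rbrakk> \<Longrightarrow> g \<up>\<^bsub>H\<^esub> \<alpha> \<in> K"
    "\<And>x. x \<in> X \<Longrightarrow> f x \<in> K"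
    by (auto simp: K_def intro: exp_generate.intros)
  have T: "exp_group R T"
    by (rule exp_group_transport[OF H, of v])
      (use Kc K_carrier in \<open>auto simp: T_def v_rep inj_on_def image_image\<close>)
  have "(\<lambda>x. rep (f x)) \<in> X \<rightarrow> carrier T" using Kc by (auto simp: T_def)
  then obtain \<psi> where \<psi>: "\<psi> \<in> exp_hom R G T" "\<forall>x\<in>X. \<psi> x = rep (f x)"
    using free T unfolding free_exp_group_def by blast
  have "\<psi> g \<in> rep ` K" if "g \<in> carrier G" for g
    using \<psi>(1) that by (auto simp: exp_hom_def hom_def T_def)
  then have vK: "v (\<psi> g) \<in> K" if "g \<in> carrier G" for g
    using that v_rep by (metis imageE)
  have "(\<lambda>g. v (\<psi> g)) \<in> exp_hom R G H"
    using \<psi>(1) vK Kc K_carrier by (auto simp: exp_hom_def hom_def T_def v_rep)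
  moreover have "\<forall>x\<in>X. v (\<psi> x) = f x" using \<psi>(2) Kc by (simp add: v_rep)
  ultimately show ?thesis by (intro bexI[of _ "\<lambda>g. v (\<psi> g)"])
qed

section \<open>Free groups and presentations\<close>

text \<open>
  A letter \<open>(x, True)\<close> stands for the generator \<open>x\<close>, and \<open>(x, False)\<close> for its inverse.
  The elements of the free group are the reduced words.
\<close>

definition inv_letter :: "'x \<times> bool \<Rightarrow> 'x \<times> bool"
  where "inv_letter l = (fst l, \<not> snd l)"

abbreviation reduced :: "('x \<times> bool) list \<Rightarrow> bool"
  where "reduced \<equiv> successively (\<lambda>l m. m \<noteq> inv_letter l)"

fun push_letter :: "'x \<times> bool \<Rightarrow> ('x \<times> bool) list \<Rightarrow> ('x \<times> bool) list" where
  "push_letter l [] = [l]"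
| "push_letter l (m # w) = (if m = inv_letter l then w else l # m # w)"

definition reduce :: "('x \<times> bool) list \<Rightarrow> ('x \<times> bool) list"
  where "reduce w = foldr push_letter w []"

definition free_group :: "'x set \<Rightarrow> ('x \<times> bool) list monoid"
  where "free_group X =
    \<lparr>carrier = {w. reduced w \<and> fst ` set w \<subseteq> X}, monoid.mult = \<lambda>u v. reduce (u @ v), one = []\<rparr>"

definition free_gen :: "'x \<Rightarrow> ('x \<times> bool) list"
  where "free_gen x = [(x, True)]"

lemma inv_letter_simps [simp]:
  "inv_letter (inv_letter l) = l" "fst (inv_letter l) = fst l" "inv_letter (x, b) = (x, \<not> b)"
  by (auto simp: inv_letter_def)

lemma reduced_push: "reduced w \<Longrightarrow> reduced (push_letter l w)"
  by (induction l w rule: push_letter.induct) (auto simp: successively_Cons)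

lemma set_push: "set (push_letter l w) \<subseteq> insert l (set w)"
  by (induction l w rule: push_letter.induct) auto

lemma push_reduced_Cons: "reduced (l # w) \<Longrightarrow> push_letter l w = l # w"
  by (cases w) auto

lemma push_push_inv: "reduced w \<Longrightarrow> push_letter l (push_letter (inv_letter l) w) = w"
  by (cases w) (auto simp: push_reduced_Cons)

lemma reduced_foldr_push: "reduced w \<Longrightarrow> reduced (foldr push_letter u w)"
  by (induction u) (auto simp: reduced_push)

lemma reduced_reduce: "reduced (reduce w)"
  by (simp add: reduce_def reduced_foldr_push)

lemma set_reduce: "set (reduce w) \<subseteq> set w"
  unfolding reduce_def by (induction w) (use set_push in fastforce)+

lemma reduce_reduced: "reduced w \<Longrightarrow> reduce w = w"
  unfolding reduce_def
  by (induction w) (auto simp: push_reduced_Cons successively_Cons)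

lemma foldr_push_push:
  assumes "reduced w"
  shows "foldr push_letter (push_letter l u) w = push_letter l (foldr push_letter u w)"
proof (cases u)
  case (Cons m u')
  then show ?thesis
    using assms push_push_inv[of "foldr push_letter u' w" l] by (auto simp: reduced_foldr_push)
qed simp

lemma foldr_push_reduce: "reduced w \<Longrightarrow> foldr push_letter (reduce u) w = foldr push_letter u w"
  unfolding reduce_def by (induction u) (auto simp: foldr_push_push)

lemma reduce_append: "reduce (u @ v) = foldr push_letter u (reduce v)"
  by (simp add: reduce_def)

lemma reduce_append_left: "reduce (reduce u @ v) = reduce (u @ v)"
  by (simp add: reduce_append foldr_push_reduce reduced_reduce)

lemma reduce_append_right: "reduce (u @ reduce v) = reduce (u @ v)"
  by (simp add: reduce_append reduce_reduced reduced_reduce)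

lemma reduce_inverse: "reduce (map inv_letter (rev w) @ w) = []"
proof (induction w)
  case (Cons l w)
  have "reduce (map inv_letter (rev (l # w)) @ l # w)
      = foldr push_letter (map inv_letter (rev w)) (push_letter (inv_letter l) (push_letter l (reduce w)))"
    by (simp add: reduce_def)
  also have "\<dots> = reduce (map inv_letter (rev w) @ w)"
    using push_push_inv[OF reduced_reduce, of "inv_letter l" w] by (simp add: reduce_append)
  finally show ?case using Cons by simp
qed (simp add: reduce_def)

lemma group_free_group: "group (free_group X)"
proof (rule groupI)
  fix u v w
  assume "u \<in> carrier (free_group X)" "v \<in> carrier (free_group X)" "w \<in> carrier (free_group X)"
  show "u \<otimes>\<^bsub>free_group X\<^esub> v \<otimes>\<^bsub>free_group X\<^esub> w = u \<otimes>\<^bsub>free_group X\<^esub> (v \<otimes>\<^bsub>free_group X\<^esub> w)"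
    by (simp add: free_group_def reduce_append_left reduce_append_right)
next
  fix u assume u: "u \<in> carrier (free_group X)"
  let ?v = "reduce (map inv_letter (rev u))"
  have "?v \<in> carrier (free_group X)"
    using u set_reduce[of "map inv_letter (rev u)"] by (fastforce simp: free_group_def reduced_reduce)
  moreover have "?v \<otimes>\<^bsub>free_group X\<^esub> u = \<one>\<^bsub>free_group X\<^esub>"
    by (simp add: free_group_def reduce_append_left reduce_inverse)
  ultimately show "\<exists>v\<in>carrier (free_group X). v \<otimes>\<^bsub>free_group X\<^esub> u = \<one>\<^bsub>free_group X\<^esub>" by blast
qed (use set_reduce in \<open>fastforce simp: free_group_def reduced_reduce reduce_reduced\<close>)+

definition letter_value :: "('g, 'k) monoid_scheme \<Rightarrow> ('x \<Rightarrow> 'g) \<Rightarrow> 'x \<times> bool \<Rightarrow> 'g"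
  where "letter_value G f l = (if snd l then f (fst l) else inv\<^bsub>G\<^esub> f (fst l))"

definition word_value :: "('g, 'k) monoid_scheme \<Rightarrow> ('x \<Rightarrow> 'g) \<Rightarrow> ('x \<times> bool) list \<Rightarrow> 'g"
  where "word_value G f w = foldr (\<lambda>l g. letter_value G f l \<otimes>\<^bsub>G\<^esub> g) w \<one>\<^bsub>G\<^esub>"

text \<open>The homomorphism from the free group on a subset of \<open>G\<close> to \<open>G\<close> extending the identity.\<close>

definition canonical_map :: "('g, 'k) monoid_scheme \<Rightarrow> ('g \<times> bool) list \<Rightarrow> 'g"
  where "canonical_map G = word_value G (\<lambda>x. x)"

context group
begin

lemma letter_value_closed:
  "\<lbrakk>f \<in> X \<rightarrow> carrier G; fst l \<in> X\<rbrakk> \<Longrightarrow> letter_value G f l \<in> carrier G"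
  by (auto simp: letter_value_def)

lemma word_value_closed:
  "\<lbrakk>f \<in> X \<rightarrow> carrier G; fst ` set w \<subseteq> X\<rbrakk> \<Longrightarrow> word_value G f w \<in> carrier G"
  by (induction w) (auto simp: word_value_def letter_value_closed)

lemma word_value_append:
  assumes "f \<in> X \<rightarrow> carrier G" "fst ` set u \<subseteq> X" "fst ` set v \<subseteq> X"
  shows "word_value G f (u @ v) = word_value G f u \<otimes> word_value G f v"
  using assms(2)
proof (induction u)
  case Nil
  then show ?case using word_value_closed[OF assms(1,3)] by (simp add: word_value_def)
next
  case (Cons l u)
  then show ?case
    using word_value_closed[OF assms(1)] assms(3) letter_value_closed[OF assms(1), of l]
    by (simp add: word_value_def m_assoc)
qed

lemma word_value_push:
  assumes f: "f \<in> X \<rightarrow> carrier G" and "fst l \<in> X" "fst ` set w \<subseteq> X"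
  shows "word_value G f (push_letter l w) = letter_value G f l \<otimes> word_value G f w"
proof (cases w)
  case (Cons m v)
  have c: "f (fst l) \<in> carrier G" "word_value G f v \<in> carrier G"
    using assms Cons word_value_closed[OF f, of v] by auto
  show ?thesis
  proof (cases "m = inv_letter l")
    case True
    have "letter_value G f l \<otimes> (letter_value G f m \<otimes> word_value G f v) = word_value G f v"
      using c True
      by (auto simp: letter_value_def inv_letter_def inv_solve_left m_assoc[symmetric])
    then show ?thesis using True Cons by (simp add: word_value_def)
  qed (simp add: Cons word_value_def)
qed (simp add: word_value_def)

lemma word_value_reduce:
  assumes f: "f \<in> X \<rightarrow> carrier G" and "fst ` set w \<subseteq> X"
  shows "word_value G f (reduce w) = word_value G f w"
  using assms(2)
proof (induction w)
  case (Cons l w)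
  have "fst ` set (reduce w) \<subseteq> X" using Cons.prems set_reduce[of w] by fastforce
  then have "word_value G f (push_letter l (reduce w)) = letter_value G f l \<otimes> word_value G f (reduce w)"
    using Cons.prems by (intro word_value_push[OF f]) auto
  then show ?case using Cons by (simp add: reduce_def word_value_def)
qed (simp add: reduce_def)

lemma word_value_hom:
  assumes "f \<in> X \<rightarrow> carrier G"
  shows "word_value G f \<in> hom (free_group X) G"
proof (rule homI)
  fix u v assume "u \<in> carrier (free_group X)" "v \<in> carrier (free_group X)"
  then show "word_value G f (u \<otimes>\<^bsub>free_group X\<^esub> v) = word_value G f u \<otimes> word_value G f v"
    using word_value_reduce[OF assms, of "u @ v"] word_value_append[OF assms, of u v]
    by (auto simp: free_group_def)
qed (use word_value_closed[OF assms] in \<open>auto simp: free_group_def\<close>)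

lemma canonical_map_hom: "X \<subseteq> carrier G \<Longrightarrow> canonical_map G \<in> hom (free_group X) G"
  unfolding canonical_map_def by (rule word_value_hom) auto

lemma canonical_map_gen: "x \<in> carrier G \<Longrightarrow> canonical_map G (free_gen x) = x"
  by (simp add: canonical_map_def word_value_def letter_value_def free_gen_def)

end

definition normal_closure :: "('g, 'k) monoid_scheme \<Rightarrow> 'g set \<Rightarrow> 'g set"
  where "normal_closure G S =
    generate G {inv\<^bsub>G\<^esub> g \<otimes>\<^bsub>G\<^esub> s \<otimes>\<^bsub>G\<^esub> g | g s. g \<in> carrier G \<and> s \<in> S}"

definition presented_group :: "'x set \<Rightarrow> ('x \<times> bool) list set \<Rightarrow> ('x \<times> bool) list set monoid"
  where "presented_group X S = free_group X Mod normal_closure (free_group X) S"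

datatype bs_gen = BS_a | BS_b

text \<open>The relation \<open>a\<^sup>-\<^sup>1 b\<^sup>r a = b\<^sup>s\<close> is imposed through the relator \<open>a\<^sup>-\<^sup>1 b\<^sup>r a b\<^sup>-\<^sup>s\<close>.\<close>

definition baumslag_solitar :: "int \<Rightarrow> int \<Rightarrow> (bs_gen \<times> bool) list set monoid"
  where "baumslag_solitar r s =
    (let F = free_group UNIV; a = free_gen BS_a; b = free_gen BS_b
     in presented_group UNIV {inv\<^bsub>F\<^esub> a \<otimes>\<^bsub>F\<^esub> b [^]\<^bsub>F\<^esub> r \<otimes>\<^bsub>F\<^esub> a \<otimes>\<^bsub>F\<^esub> b [^]\<^bsub>F\<^esub> (- s)})"

section \<open>Group-theoretic properties\<close>

definition torsion_free :: "('g, 'k) monoid_scheme \<Rightarrow> bool"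
  where "torsion_free G \<longleftrightarrow>
    (\<forall>g\<in>carrier G. \<forall>n::nat. 0 < n \<longrightarrow> g [^]\<^bsub>G\<^esub> n = \<one>\<^bsub>G\<^esub> \<longrightarrow> g = \<one>\<^bsub>G\<^esub>)"

definition characteristic_zero :: "('a, 'm) ring_scheme \<Rightarrow> bool"
  where "characteristic_zero R \<longleftrightarrow> (\<forall>n::nat. 0 < n \<longrightarrow> [n] \<cdot>\<^bsub>R\<^esub> \<one>\<^bsub>R\<^esub> \<noteq> \<zero>\<^bsub>R\<^esub>)"

definition abelian_subgroup :: "'g set \<Rightarrow> ('g, 'k) monoid_scheme \<Rightarrow> bool"
  where "abelian_subgroup H G \<longleftrightarrow> subgroup H G \<and> comm_group (G\<lparr>carrier := H\<rparr>)"

definition maximal_abelian_subgroup :: "'g set \<Rightarrow> ('g, 'k) monoid_scheme \<Rightarrow> bool"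
  where "maximal_abelian_subgroup M G \<longleftrightarrow>
    abelian_subgroup M G \<and> (\<forall>H. abelian_subgroup H G \<longrightarrow> M \<subseteq> H \<longrightarrow> H = M)"

definition conjugately_separated :: "'g set \<Rightarrow> ('g, 'k) monoid_scheme \<Rightarrow> bool"
  where "conjugately_separated H G \<longleftrightarrow>
    (\<forall>x \<in> carrier G - H. H \<inter> (\<lambda>h. inv\<^bsub>G\<^esub> x \<otimes>\<^bsub>G\<^esub> h \<otimes>\<^bsub>G\<^esub> x) ` H = {\<one>\<^bsub>G\<^esub>})"

definition center :: "('g, 'k) monoid_scheme \<Rightarrow> 'g set"
  where "center G = {z \<in> carrier G. \<forall>g\<in>carrier G. z \<otimes>\<^bsub>G\<^esub> g = g \<otimes>\<^bsub>G\<^esub> z}"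

definition internal_direct_product :: "('g, 'k) monoid_scheme \<Rightarrow> 'g set \<Rightarrow> 'g set \<Rightarrow> bool"
  where "internal_direct_product G H K \<longleftrightarrow>
    H \<lhd> G \<and> K \<lhd> G \<and> H \<inter> K = {\<one>\<^bsub>G\<^esub>} \<and> H <#>\<^bsub>G\<^esub> K = carrier G"

definition directly_indecomposable :: "('g, 'k) monoid_scheme \<Rightarrow> bool"
  where "directly_indecomposable G \<longleftrightarrow>
    \<not> (\<exists>H K. internal_direct_product G H K \<and> H \<noteq> {\<one>\<^bsub>G\<^esub>} \<and> K \<noteq> {\<one>\<^bsub>G\<^esub>})"

end

theory Submission
  imports Defs
begin

text \<open>
  The free group with exponents embeds into an explicit group \<open>H\<close>, the union of a tower of
  groups that starts with the trivial group. Each group of the tower is covered by conjugates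
  of a family of malnormal abelian subgroups (partial lines), each identified with a subgroup of
  the additive group of the ring. The next group is the star amalgam in which all partial lines
  are extended to full copies of the ring. Its Bass--Serre tree, represented by a Lyndon length
  function, shows that every nontrivial element either is conjugate into a full line or is
  conjugate to a hyperbolic element; by the Busemann homomorphism the centralizer of the latter
  is infinite cyclic, and it becomes a new partial line (identified with the multiples of 1, which
  form an infinite cyclic group as the characteristic is 0).

  In \<open>H\<close> all lines are full, so \<open>H\<close> has exponents in the ring. Every group of the tower has a
  compatible homomorphism to the free group, and the composition of the free group's map to \<open>H\<close>
  with this homomorphism fixes the base; hence the map to \<open>H\<close> is injective. Torsion-freeness,
  transitivity of commutation and conjugate separation pass from \<open>H\<close> to its subgroups, and
  imply the other claims.
\<close>

section \<open>Hyperbolic elements of length functions\<close>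

text \<open>Giving exponents to one element creates new elements that have none yet, hence a tower.
  Extending the cyclic centralizer of an element to a copy of the ring is an amalgamation;
  centralizers stay under control because the amalgamated subgroups are malnormal and no nontrivial
  elements of different ones are conjugate, so both properties belong to the inductive invariant.
  The free group needs no separate construction: the trivial group carries one trivial partial line
  per generator, so the first amalgam is the free product of copies of the additive group, in which
  the elements 1 of the copies are free generators. Zero divisors and noncommutativity of the ring
  do no harm, since the tower sees only its additive group; multiplication enters at the end, as
  right multiplication of the coordinate on a line. The union of the tower is not shown to be free:
  a retraction back to the free group suffices. A length function replaces the action on a tree, as
  translation lengths, ends and Busemann functions can all be expressed by it.\<close>

context group
begin

lemma inv_cancel_left [simp]:
  assumes "x \<in> carrier G" "y \<in> carrier G"
  shows "inv x \<otimes> (x \<otimes> y) = y" "x \<otimes> (inv x \<otimes> y) = y"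
  using assms by (simp_all flip: m_assoc)

lemma inv_cancel_right [simp]:
  assumes "x \<in> carrier G" "y \<in> carrier G"
  shows "y \<otimes> inv x \<otimes> x = y" "y \<otimes> x \<otimes> inv x = y"
  using assms by (simp_all add: m_assoc)

text \<open>Conjugacy is mostly stated as \<open>x \<otimes> g = g \<otimes> y\<close> in what
  follows, since such relations compose, invert and take powers without bookkeeping of
  inverses.\<close>

lemma eq_mult_inv_iff:
  assumes "x \<in> carrier G" "y \<in> carrier G" "g \<in> carrier G"
  shows "x = g \<otimes> y \<otimes> inv g \<longleftrightarrow> x \<otimes> g = g \<otimes> y"
  using assms inv_solve_right[of x "g \<otimes> y" g] by auto

lemma intertwine_nat_pow:
  assumes "x \<otimes> g = g \<otimes> y" "x \<in> carrier G" "y \<in> carrier G" "g \<in> carrier G"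
  shows "x [^] (n::nat) \<otimes> g = g \<otimes> y [^] n"
proof (induction n)
  case (Suc n)
  have "x [^] Suc n \<otimes> g = x [^] n \<otimes> (x \<otimes> g)" using assms by (simp add: m_assoc)
  also have "\<dots> = x [^] n \<otimes> g \<otimes> y" using assms by (simp add: m_assoc)
  also have "\<dots> = g \<otimes> y [^] Suc n" using Suc assms by (simp add: m_assoc)
  finally show ?case .
qed (use assms in simp)

lemma intertwine_inv:
  assumes "x \<otimes> g = g \<otimes> y" "x \<in> carrier G" "y \<in> carrier G" "g \<in> carrier G"
  shows "inv x \<otimes> g = g \<otimes> inv y"
proof -
  have "inv x \<otimes> g = inv x \<otimes> (g \<otimes> y) \<otimes> inv y" using assms by (simp add: m_assoc)
  also have "\<dots> = inv x \<otimes> (x \<otimes> g) \<otimes> inv y" using assms(1) by simp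
  also have "\<dots> = g \<otimes> inv y" using assms(2-) by simp
  finally show ?thesis .
qed

lemma intertwine_int_pow:
  assumes "x \<otimes> g = g \<otimes> y" "x \<in> carrier G" "y \<in> carrier G" "g \<in> carrier G"
  shows "x [^] (n::int) \<otimes> g = g \<otimes> y [^] n"
proof (cases n rule: int_cases2)
  case (nonneg k)
  then show ?thesis using intertwine_nat_pow[OF assms] by (simp add: int_pow_int)
next
  case (nonpos k)
  then show ?thesis
    using intertwine_inv[OF intertwine_nat_pow[OF assms]] assms by (simp add: int_pow_neg_int)
qed

lemma intertwine_trans:
  assumes "x \<otimes> g = g \<otimes> y" "y \<otimes> h = h \<otimes> z"
    "x \<in> carrier G" "y \<in> carrier G" "z \<in> carrier G" "g \<in> carrier G" "h \<in> carrier G"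
  shows "x \<otimes> (g \<otimes> h) = (g \<otimes> h) \<otimes> z"
proof -
  have "x \<otimes> (g \<otimes> h) = (x \<otimes> g) \<otimes> h" using assms(3-) by (simp add: m_assoc)
  also have "\<dots> = g \<otimes> (y \<otimes> h)" using assms(3-) by (simp add: assms(1) m_assoc)
  also have "\<dots> = (g \<otimes> h) \<otimes> z" using assms(3-) by (simp add: assms(2) m_assoc)
  finally show ?thesis .
qed

lemma intertwine_sym:
  assumes "x \<otimes> g = g \<otimes> y" "x \<in> carrier G" "y \<in> carrier G" "g \<in> carrier G"
  shows "y \<otimes> inv g = inv g \<otimes> x"
proof -
  have "inv g \<otimes> (x \<otimes> g) \<otimes> inv g = inv g \<otimes> (g \<otimes> y) \<otimes> inv g" using assms(1) by simp
  moreover have "inv g \<otimes> (x \<otimes> g) \<otimes> inv g = inv g \<otimes> x" using assms(2-) by (simp add: m_assoc)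
  ultimately show ?thesis using assms(2-) by simp
qed

definition powers :: "'a \<Rightarrow> 'a set" where
  "powers c = range (\<lambda>n::int. c [^] n)"

text \<open>The subgroup generated by \<open>c\<close> is infinite cyclic and malnormal: if it meets
  its conjugate by \<open>g\<close> nontrivially, then \<open>g\<close> lies in it.\<close>

definition malnormal_root :: "'a \<Rightarrow> bool" where
  "malnormal_root c \<longleftrightarrow> c \<in> carrier G \<and> (\<forall>n::int. c [^] n = \<one> \<longrightarrow> n = 0) \<and>
     (\<forall>(m::int) (n::int). \<forall>g\<in>carrier G. m \<noteq> 0 \<longrightarrow> c [^] m \<otimes> g = g \<otimes> c [^] n \<longrightarrow> g \<in> powers c)"

lemma powersI [intro]: "c [^] (n::int) \<in> powers c"
  by (auto simp: powers_def)

lemma powers_commute: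
  assumes "c \<in> carrier G" "x \<in> powers c" "y \<in> powers c"
  shows "x \<otimes> y = y \<otimes> x"
proof -
  obtain m n :: int where "x = c [^] m" "y = c [^] n" using assms by (auto simp: powers_def)
  then show ?thesis using assms(1) by (metis add.commute int_pow_mult)
qed

text \<open>\<open>f\<close> identifies \<open>H\<close> with a subgroup of the integers, which is
  generated by its least positive element. It will be the Busemann function, whose additivity
  depends on a centralizer.\<close>

lemma cyclic_of_embedding:
  fixes f :: "'a \<Rightarrow> int"
  assumes H: "subgroup H G"
    and hom: "\<And>x y. \<lbrakk>x \<in> H; y \<in> H\<rbrakk> \<Longrightarrow> f (x \<otimes> y) = f x + f y"
    and ker: "\<And>x. \<lbrakk>x \<in> H; f x = 0\<rbrakk> \<Longrightarrow> x = \<one>"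
  shows "\<exists>c\<in>H. H = powers c"
proof (cases "\<exists>x\<in>H. f x \<noteq> 0")
  case False
  then have "H = {\<one>}" using ker subgroup.one_closed[OF H] by blast
  moreover have "powers \<one> = {\<one>}" by (auto simp: powers_def)
  ultimately show ?thesis by auto
next
  case True
  interpret H: subgroup H G by (rule H)
  have f1: "f \<one> = 0" using hom[of \<one> \<one>] by simp
  have finv: "f (inv x) = - f x" if "x \<in> H" for x
    using hom[of x "inv x"] that f1 by simp
  have fpow: "f (x [^] (n::nat)) = int n * f x" if "x \<in> H" for x n
    using that
  proof (induction n)
    case (Suc n)
    have "x [^] n \<in> H" using that by (induction n) auto
    then show ?case using Suc hom[of "x [^] n" x] by (simp add: algebra_simps)
  qed (simp add: f1)
  have powH: "x [^] (n::int) \<in> H" if "x \<in> H" for x n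
    by (metis H H.subgroup_axioms is_group subgroup_int_pow_closed that)
  have fipow: "f (x [^] (n::int)) = n * f x" if "x \<in> H" for x n
  proof (cases n rule: int_cases2)
    case (nonpos k)
    have "x [^] k \<in> H" using powH[OF that, of "int k"] by (simp add: int_pow_int)
    then show ?thesis using nonpos that by (simp add: int_pow_neg_int finv fpow H.mem_carrier)
  qed (use that in \<open>simp add: int_pow_int fpow\<close>)
  define d where "d = (LEAST d::nat. 0 < d \<and> (\<exists>x\<in>H. f x = int d))"
  have "\<exists>d::nat. 0 < d \<and> (\<exists>x\<in>H. f x = int d)"
  proof -
    obtain x where x: "x \<in> H" "f x \<noteq> 0" using True by blast
    show ?thesis
    proof (cases "f x > 0")
      case True
      then show ?thesis using x by (intro exI[of _ "nat (f x)"]) auto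
    next
      case False
      then show ?thesis using x finv[of x]
        by (intro exI[of _ "nat (- f x)"] conjI bexI[of _ "inv x"]) auto
    qed
  qed
  from LeastI_ex[OF this] obtain c where d: "0 < d" and c: "c \<in> H" "f c = int d"
    by (auto simp: d_def)
  have "x \<in> powers c" if x: "x \<in> H" for x
  proof -
    define q where "q = f x div int d"
    define y where "y = x \<otimes> c [^] (- q)"
    have yH: "y \<in> H" using x c powH by (simp add: y_def)
    have fy: "f y = f x mod int d"
      using x c powH by (simp add: y_def hom fipow q_def minus_div_mult_eq_mod [symmetric])
    have "f y = 0"
    proof (rule ccontr)
      assume "f y \<noteq> 0"
      moreover have "0 \<le> f y" using fy d by simp
      ultimately have pos: "0 < f y" by linarith
      have "f y < int d" using fy d by simp
      then have "nat (f y) < d" using pos by linarith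
      moreover have "0 < nat (f y)" "\<exists>x\<in>H. f x = int (nat (f y))" using pos yH by auto
      ultimately show False unfolding d_def by (blast dest: not_less_Least)
    qed
    then have "x \<otimes> c [^] (- q) = \<one>" using ker yH by (simp add: y_def)
    then have "x = c [^] q"
      using x c by (simp add: int_pow_neg H.mem_carrier inv_solve_right')
    then show ?thesis by auto
  qed
  then show ?thesis using c powH by (intro bexI[of _ c]) (auto simp: powers_def)
qed

end

text \<open>
  A length function in the sense of Lyndon; \<open>overlap x y\<close> is twice the length of the common
  initial part of the paths from the base point to the points \<open>x\<close> and \<open>y\<close> of a tree, whose
  distance is \<open>len (x \<otimes> inv y)\<close>.
\<close>

locale lyndon_length = group +
  fixes len :: "'a \<Rightarrow> int"
  assumes len_one: "len \<one> = 0"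
    and len_inv: "x \<in> carrier G \<Longrightarrow> len (inv x) = len x"
    and ultrametric: "\<lbrakk>x \<in> carrier G; y \<in> carrier G; z \<in> carrier G\<rbrakk> \<Longrightarrow>
      min (len x + len y - len (x \<otimes> inv y)) (len y + len z - len (y \<otimes> inv z))
        \<le> len x + len z - len (x \<otimes> inv z)"
begin

definition overlap :: "'a \<Rightarrow> 'a \<Rightarrow> int" where
  "overlap x y = len x + len y - len (x \<otimes> inv y)"

lemma overlap_ultra:
  "\<lbrakk>x \<in> carrier G; y \<in> carrier G; z \<in> carrier G\<rbrakk> \<Longrightarrow>
    overlap x y \<le> overlap x z \<or> overlap y z \<le> overlap x z"
  using ultrametric[of x y z] unfolding overlap_def by linarith

lemma overlap_sym: "\<lbrakk>x \<in> carrier G; y \<in> carrier G\<rbrakk> \<Longrightarrow> overlap x y = overlap y x"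
  using len_inv[of "x \<otimes> inv y"] by (simp add: overlap_def inv_mult_group)

lemma overlap_nonneg: "\<lbrakk>x \<in> carrier G; y \<in> carrier G\<rbrakk> \<Longrightarrow> 0 \<le> overlap x y"
  using overlap_ultra[of x \<one> y] by (auto simp: overlap_def len_one len_inv)

lemma len_nonneg: "x \<in> carrier G \<Longrightarrow> 0 \<le> len x"
  using overlap_nonneg[of x x] by (simp add: overlap_def len_one)

lemma len_mult: "\<lbrakk>x \<in> carrier G; y \<in> carrier G\<rbrakk> \<Longrightarrow> len (x \<otimes> y) \<le> len x + len y"
  using overlap_nonneg[of x "inv y"] by (simp add: overlap_def len_inv)

lemma overlap_le: "\<lbrakk>x \<in> carrier G; y \<in> carrier G\<rbrakk> \<Longrightarrow> overlap x y \<le> 2 * len x"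
  using len_mult[of "y \<otimes> inv x" x] len_inv[of "x \<otimes> inv y"]
  by (simp add: overlap_def inv_mult_group)

text \<open>An isometry of a tree has translation length max(0,
  \<open>len (x \<otimes> x) - len x\<close>). Thus \<open>hyperbolic\<close> means positive
  translation length, which \<open>displacement\<close> then measures.\<close>

definition hyperbolic :: "'a \<Rightarrow> bool" where
  "hyperbolic x \<longleftrightarrow> x \<in> carrier G \<and> len x < len (x \<otimes> x)"

definition displacement :: "'a \<Rightarrow> int" where
  "displacement x = len (x \<otimes> x) - len x"

lemma hyperbolic_closed [dest]: "hyperbolic x \<Longrightarrow> x \<in> carrier G"
  by (simp add: hyperbolic_def)

lemma displacement_pos: "hyperbolic x \<Longrightarrow> 1 \<le> displacement x"
  by (simp add: hyperbolic_def displacement_def)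

text \<open>The paths to a higher power of \<open>x\<close> and to \<open>x\<close> share more than
  those to \<open>x\<close> and \<open>inv x\<close>. By the ultrametric inequality the higher power
  then overlaps with \<open>inv x\<close> exactly as \<open>x\<close> does, which yields the same
  increase of length as for \<open>x \<otimes> x\<close>.\<close>

lemma len_pow_Suc_diff:
  assumes "hyperbolic x"
  shows "len (x [^] Suc (Suc k)) = len (x [^] Suc k) + displacement x"
proof (induction k)
  case 0
  then show ?case using assms by (simp add: displacement_def hyperbolic_closed)
next
  case (Suc k)
  have x: "x \<in> carrier G" using assms by auto
  define y where "y = x [^] Suc (Suc k)"
  have y: "y \<in> carrier G" using x by (simp add: y_def)
  have pos: "displacement x \<ge> 1" using assms by (rule displacement_pos)
  have 1: "overlap y x = len x + displacement x"
    using Suc x by (simp add: overlap_def y_def)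
  have 2: "overlap x (inv x) = len x - displacement x"
    using x by (simp add: overlap_def displacement_def len_inv)
  have "overlap y (inv x) = overlap x (inv x)"
    using overlap_ultra[of y x "inv x"] overlap_ultra[of x y "inv x"] overlap_ultra[of y "inv x" x]
      overlap_sym[of x y] overlap_sym[of "inv x" x] 1 2 x y pos by auto
  then show ?case using 2 x y by (simp add: overlap_def len_inv y_def)
qed

lemma len_pow:
  assumes "hyperbolic x"
  shows "len (x [^] Suc k) = len x + int k * displacement x"
proof (induction k)
  case (Suc k)
  then show ?case using len_pow_Suc_diff[OF assms, of k] by (simp add: algebra_simps)
qed (use assms in auto)

lemma len_int_pow:
  assumes "hyperbolic x" "n \<noteq> 0"
  shows "len (x [^] (n::int)) = len x + (\<bar>n\<bar> - 1) * displacement x"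
proof -
  have pos: "len (x [^] m) = len x + (m - 1) * displacement x" if "m > 0" for m :: int
  proof -
    obtain k where "m = int (Suc k)" using \<open>m > 0\<close> by (metis gr0_implies_Suc zero_less_imp_eq_int)
    then show ?thesis using len_pow[OF assms(1), of k] int_pow_int[of G x "Suc k"]
      by (simp add: algebra_simps)
  qed
  show ?thesis
  proof (cases "n > 0")
    case False
    then have "len (x [^] n) = len (inv (x [^] n))" using assms by (simp add: len_inv hyperbolic_closed)
    also have "inv (x [^] n) = x [^] (- n)" using assms by (simp add: int_pow_neg hyperbolic_closed)
    finally show ?thesis using pos[of "- n"] False assms by simp
  qed (use pos in simp)
qed

lemma len_pow_ge:
  assumes "hyperbolic x" "0 < k"
  shows "len (x [^] k) \<ge> len x + int k - 1"
proof -
  obtain j where j: "k = Suc j" using assms by (cases k) auto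
  have "int j * 1 \<le> int j * displacement x"
    using displacement_pos[OF assms(1)] by (intro mult_left_mono) auto
  then show ?thesis using len_pow[OF assms(1), of j] j by simp
qed

text \<open>The paths to \<open>x\<close> and \<open>inv x\<close> share at least half of their
  length, and the ultrametric inequality passes this on to the powers. The induction carries two
  consecutive powers because the overlap of \<open>x [^] Suc k\<close> with \<open>x\<close>
  involves \<open>len (x [^] k)\<close>.\<close>

lemma bounded_if_not_hyperbolic:
  assumes x: "x \<in> carrier G" "\<not> hyperbolic x"
  shows "len (x [^] (k::nat)) \<le> len x"
proof -
  have "len (x [^] k) \<le> len x \<and> len (x [^] Suc k) \<le> len x"
  proof (induction k)
    case 0
    then show ?case using x len_nonneg by (simp add: len_one)
  next
    case (Suc k)
    define y where "y = x [^] Suc k"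
    have y: "y \<in> carrier G" using x by (simp add: y_def)
    have "overlap y x = len y + len x - len (x [^] k)" using x by (simp add: overlap_def y_def)
    then have "overlap y x \<ge> len y" using Suc by simp
    moreover have "overlap x (inv x) \<ge> len x"
      using x by (simp add: overlap_def hyperbolic_def len_inv)
    ultimately have "overlap y (inv x) \<ge> len y"
      using overlap_ultra[of y x "inv x"] x y Suc by (auto simp: y_def)
    then show ?case using x y Suc by (simp add: overlap_def len_inv y_def)
  qed
  then show ?thesis by simp
qed

lemma hyperbolic_pow_neq_one:
  assumes "hyperbolic x" "n \<noteq> 0"
  shows "x [^] (n::int) \<noteq> \<one>"
proof
  assume 1: "x [^] n = \<one>"
  \<comment> \<open>The exponents \<open>n\<close> and \<open>n * 2\<close> both give length 0,
    although the length formula makes them differ by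
    \<open>\<bar>n\<bar> * displacement x\<close>.\<close>
  have "x [^] (n * 2) = \<one>" using 1 assms by (simp add: int_pow_pow[symmetric] hyperbolic_closed)
  then have "len x + (\<bar>n\<bar> - 1) * displacement x = 0" "len x + (\<bar>n * 2\<bar> - 1) * displacement x = 0"
    using 1 len_int_pow[OF assms(1), of n] len_int_pow[OF assms(1), of "n * 2"] assms by (auto simp: len_one)
  then have "(\<bar>n * 2\<bar> - 1) * displacement x = (\<bar>n\<bar> - 1) * displacement x" by linarith
  then have "displacement x = 0" using assms(2) by (auto simp: abs_mult)
  then show False using displacement_pos[OF assms(1)] assms(2) by simp
qed

text \<open>Translation length is invariant under conjugation: the \<open>k\<close>-th powers of
  both sides have lengths that differ by at most \<open>2 * len g\<close>, whereas they grow like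
  \<open>k\<close> times the exponents.\<close>

lemma conj_pow_eq_imp_abs_eq:
  assumes x: "hyperbolic x" and g: "g \<in> carrier G" and eq: "x [^] (m::int) \<otimes> g = g \<otimes> x [^] (n::int)"
  shows "\<bar>m\<bar> = \<bar>n\<bar>"
proof -
  have le: "\<bar>m\<bar> \<le> \<bar>n\<bar>" if h: "h \<in> carrier G" and eq: "x [^] m \<otimes> h = h \<otimes> x [^] n" for m n :: int and h
  proof (rule ccontr)
    assume lt: "\<not> \<bar>m\<bar> \<le> \<bar>n\<bar>"
    have xc: "x \<in> carrier G" using x by auto
    \<comment> \<open>\<open>k - 1\<close> has to exceed \<open>2 * len h\<close>, the change of
      length that the conjugation can cause.\<close>
    define k where "k = 2 * len h + len x + displacement x + 1"
    have k: "k > 0" using len_nonneg[OF h] len_nonneg[OF xc] displacement_pos[OF x] by (simp add: k_def)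
    have "x [^] (m * k) = h \<otimes> x [^] (n * k) \<otimes> inv h"
      using intertwine_int_pow[OF eq, of k] h xc
      by (simp add: int_pow_pow eq_mult_inv_iff)
    then have "len (x [^] (m * k)) \<le> 2 * len h + len (x [^] (n * k))"
      using len_mult[of "h \<otimes> x [^] (n * k)" "inv h"] len_mult[of h "x [^] (n * k)"] h xc
      by (simp add: len_inv)
    moreover have "len (x [^] (n * k)) \<le> len x + \<bar>n * k\<bar> * displacement x"
      using len_int_pow[OF x, of "n * k"] displacement_pos[OF x] len_nonneg[OF xc]
      by (cases "n * k = 0") (auto simp: len_one algebra_simps)
    moreover have "len (x [^] (m * k)) = len x + (\<bar>m * k\<bar> - 1) * displacement x"
      using lt k by (intro len_int_pow[OF x]) auto
    ultimately have "(\<bar>m * k\<bar> - 1) * displacement x \<le> 2 * len h + \<bar>n * k\<bar> * displacement x" by simp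
    moreover have "\<bar>n * k\<bar> + k \<le> \<bar>m * k\<bar>"
    proof -
      have "(\<bar>n\<bar> + 1) * k \<le> \<bar>m\<bar> * k" using lt k by (intro mult_right_mono) auto
      then show ?thesis using k by (simp add: abs_mult algebra_simps)
    qed
    then have "(\<bar>n * k\<bar> + k - 1) * displacement x \<le> (\<bar>m * k\<bar> - 1) * displacement x"
      using displacement_pos[OF x] by (intro mult_right_mono) auto
    ultimately have "(k - 1) * displacement x \<le> 2 * len h" by (simp add: algebra_simps)
    moreover have "(k - 1) * 1 \<le> (k - 1) * displacement x"
      using displacement_pos[OF x] k by (intro mult_left_mono) auto
    ultimately show False using len_nonneg[OF xc] displacement_pos[OF x] by (simp add: k_def)
  qed
  have "x [^] n \<otimes> inv g = inv g \<otimes> x [^] m"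
    using intertwine_sym[OF eq] g x by auto
  then show ?thesis using le[OF g eq] le[of "inv g" n m] g by simp
qed

text \<open>Conjugation by \<open>g\<close> changes lengths by at most \<open>2 * len g\<close>. The
  result separates hyperbolic elements from conjugates of line elements, whose powers stay
  bounded.\<close>

lemma conj_of_hyperbolic_unbounded:
  assumes x: "hyperbolic x" and g: "g \<in> carrier G" and y: "y \<in> carrier G"
    and eq: "x \<otimes> g = g \<otimes> y"
  shows "\<exists>k::nat. len (y [^] k) > B"
proof (rule ccontr)
  assume "\<nexists>k::nat. len (y [^] k) > B"
  then have B: "len (y [^] k) \<le> B" for k :: nat by (simp add: not_less)
  have xc: "x \<in> carrier G" using x by auto
  define k where "k = nat (B + 2 * len g + 2)"
  have "B \<ge> 0" using B[of 0] by (simp add: len_one)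
  then have k: "0 < k" "int k = B + 2 * len g + 2" using len_nonneg[OF g] by (auto simp: k_def)
  have "x [^] k = g \<otimes> y [^] k \<otimes> inv g"
    using intertwine_nat_pow[OF eq xc y g] xc y g by (simp add: eq_mult_inv_iff)
  then have "len (x [^] k) \<le> 2 * len g + len (y [^] k)"
    using len_mult[of "g \<otimes> y [^] k" "inv g"] len_mult[of g "y [^] k"] g y by (simp add: len_inv)
  then show False using len_pow_ge[OF x k(1)] k(2) B[of k] len_nonneg[OF xc] by simp
qed

text \<open>The Busemann function of the end of the tree to which the powers of \<open>x\<close> converge.\<close>

definition busemann :: "'a \<Rightarrow> 'a \<Rightarrow> int" where
  "busemann x y = len y - overlap y (x [^] nat (len y + 1))"

text \<open>For \<open>k > len y\<close> the consecutive powers \<open>x [^] k\<close> and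
  \<open>x [^] Suc k\<close> have an overlap above \<open>2 * len y\<close>, the most that
  \<open>y\<close> can have with anything. So all these powers look the same from \<open>y\<close>,
  and the limit that defines a Busemann function is attained at
  \<open>nat (len y + 1)\<close>.\<close>

lemma busemann_eq:
  assumes x: "hyperbolic x" and y: "y \<in> carrier G" and k: "nat (len y + 1) \<le> k"
  shows "overlap y (x [^] k) = len y - busemann x y"
  using k
proof (induction k rule: dec_induct)
  case base
  then show ?case by (simp add: busemann_def)
next
  case (step k)
  have xc: "x \<in> carrier G" using x by auto
  have kpos: "0 < k" "int k \<ge> len y + 1" using step len_nonneg[OF y] by linarith+
  have "inv (x [^] Suc k) = inv (x [^] k) \<otimes> inv x"
    using xc by (simp only: nat_pow_Suc2 inv_mult_group nat_pow_closed)
  then have "x [^] k \<otimes> inv (x [^] Suc k) = inv x" using xc by simp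
  then have "overlap (x [^] k) (x [^] Suc k) = len (x [^] k) + len (x [^] Suc k) - len x"
    using xc by (simp add: overlap_def len_inv)
  also have "\<dots> > 2 * len y"
    using len_pow_ge[OF x kpos(1)] len_pow_ge[OF x, of "Suc k"] kpos len_nonneg[OF xc] by simp
  finally have big: "overlap (x [^] k) (x [^] Suc k) > 2 * len y" .
  have "overlap y (x [^] k) = overlap y (x [^] Suc k)"
    using overlap_ultra[of y "x [^] k" "x [^] Suc k"] overlap_ultra[of y "x [^] Suc k" "x [^] k"]
      overlap_sym[of "x [^] k" "x [^] Suc k"] overlap_le[of y] big xc y
    by (smt (verit) nat_pow_closed)
  then show ?case using step by simp
qed

lemma len_busemann:
  assumes "hyperbolic x" "y \<in> carrier G" "nat (len y + 1) \<le> k"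
  shows "len (y \<otimes> inv (x [^] k)) = len (x [^] k) + busemann x y"
  using busemann_eq[OF assms] by (simp add: overlap_def)

text \<open>As \<open>z\<close> commutes with the far power \<open>p\<close> of \<open>x\<close>,
  the point \<open>p \<otimes> inv z\<close> has distance \<open>len z\<close> from
  \<open>p\<close>, so \<open>y\<close> has the same overlap with both points. Replacing one by the
  other turns the Busemann cocycle into a homomorphism.\<close>

lemma busemann_mult:
  assumes x: "hyperbolic x" and y: "y \<in> carrier G" and z: "z \<in> carrier G" "x \<otimes> z = z \<otimes> x"
  shows "busemann x (y \<otimes> z) = busemann x y + busemann x z"
proof -
  have xc: "x \<in> carrier G" using x by auto
  define k where "k = nat (len y + len z + len (y \<otimes> z) + 2)"
  have len: "0 \<le> len y" "0 \<le> len z" "0 \<le> len (y \<otimes> z)" using len_nonneg y z by auto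
  have kpos: "0 < k" and kge: "nat (len y + 1) \<le> k" "nat (len z + 1) \<le> k" "nat (len (y \<otimes> z) + 1) \<le> k"
    using len by (auto simp: k_def)
  define p where "p = x [^] k"
  have p: "p \<in> carrier G" using xc by (simp add: p_def)
  define w where "w = p \<otimes> inv z"
  have w: "w \<in> carrier G" using p z by (simp add: w_def)
  have pz: "p \<otimes> z = z \<otimes> p" using intertwine_nat_pow[OF z(2) xc xc z(1)] by (simp add: p_def)
  have lw: "len w = len p + busemann x z"
    using len_busemann[OF x z(1) kge(2)] len_inv[of "z \<otimes> inv p"] p z
    by (simp add: w_def inv_mult_group flip: p_def)
  have wp: "w \<otimes> inv p = inv z"
  proof -
    have "p \<otimes> inv z = inv z \<otimes> p" using intertwine_sym[OF pz p p z(1)] .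
    then show ?thesis using p z by (simp add: w_def m_assoc)
  qed
  have "overlap w p = len w + len p - len z" using wp z by (simp add: overlap_def len_inv)
  moreover have "len w \<ge> len p - len z"
    using len_mult[of w z] p z by (simp add: w_def m_assoc)
  moreover have "len p \<ge> len y + len z + 1"
    using len_pow_ge[OF x kpos] len_nonneg[OF xc] len by (simp add: p_def k_def)
  ultimately have big: "overlap w p > 2 * len y" by simp
  have "overlap y w = overlap y p"
    using overlap_ultra[of y w p] overlap_ultra[of y p w]
      overlap_sym[of w p] overlap_le[of y] big w p y by (smt (verit))
  then have "overlap y w = len y - busemann x y" using busemann_eq[OF x y kge(1)] by (simp add: p_def)
  moreover have "y \<otimes> inv w = y \<otimes> z \<otimes> inv p" using y z p by (simp add: w_def inv_mult_group m_assoc)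
  ultimately have "len (y \<otimes> z \<otimes> inv p) = len w + busemann x y" by (simp add: overlap_def)
  then show ?thesis using lw len_busemann[OF x _ kge(3)] y z by (simp flip: p_def)
qed

text \<open>Both \<open>y\<close> and \<open>inv y\<close> have Busemann value 0, so each has
  overlap \<open>len y\<close> with a far power of \<open>x\<close>. They then have at least this
  overlap with each other, which means \<open>len (y \<otimes> y) \<le> len y\<close>.\<close>

lemma busemann_zero_imp_not_hyperbolic:
  assumes x: "hyperbolic x" and y: "y \<in> carrier G" "x \<otimes> y = y \<otimes> x" and 0: "busemann x y = 0"
  shows "\<not> hyperbolic y"
proof -
  have xc: "x \<in> carrier G" using x by auto
  have b1: "busemann x \<one> = 0" using busemann_mult[OF x, of \<one> \<one>] xc by simp
  have xy: "x \<otimes> inv y = inv y \<otimes> x" using intertwine_inv[of y x y] xc y by simp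
  have b2: "busemann x (inv y) = 0" using busemann_mult[OF x, of y "inv y"] y xy b1 0 by simp
  define p where "p = x [^] nat (len y + 1)"
  have p: "p \<in> carrier G" using xc by (simp add: p_def)
  have "overlap y p = len y" "overlap (inv y) p = len y"
    using busemann_eq[OF x y(1)] busemann_eq[OF x, of "inv y"] 0 b2 y by (auto simp: p_def len_inv)
  then have "overlap y (inv y) \<ge> len y"
    using overlap_ultra[of y p "inv y"] overlap_sym[of p "inv y"] y p by auto
  then show ?thesis using y by (simp add: hyperbolic_def overlap_def len_inv)
qed

lemma hyperbolic_int_pow:
  assumes "hyperbolic x" "n \<noteq> 0"
  shows "hyperbolic (x [^] (n::int))"
proof -
  have "len (x [^] n \<otimes> x [^] n) = len (x [^] (n + n))"
    using int_pow_mult[of x n n] assms(1) by auto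
  also have "\<dots> = len x + (\<bar>n + n\<bar> - 1) * displacement x" using assms by (intro len_int_pow) auto
  also have "\<dots> = len (x [^] n) + \<bar>n\<bar> * displacement x"
    using len_int_pow[OF assms] by (simp add: algebra_simps abs_mult flip: mult_2)
  also have "\<dots> > len (x [^] n)" using assms displacement_pos[OF assms(1)] by simp
  finally show ?thesis using assms by (auto simp: hyperbolic_def)
qed

end

text \<open>On the centralizer of a hyperbolic element the Busemann homomorphism kills only elements
  that are not hyperbolic; the second assumption makes its kernel there trivial.\<close>

locale lyndon_length_free_centralizers = lyndon_length +
  assumes torsion_free: "\<lbrakk>x \<in> carrier G; x [^] (n::nat) = \<one>; 0 < n\<rbrakk> \<Longrightarrow> x = \<one>"
    and centralizer_hyperbolic:
      "\<lbrakk>hyperbolic x; y \<in> carrier G; x \<otimes> y = y \<otimes> x; \<not> hyperbolic y\<rbrakk> \<Longrightarrow> y = \<one>"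
begin

lemma centralizer_cyclic:
  assumes x: "hyperbolic x"
  shows "\<exists>c\<in>carrier G. {y \<in> carrier G. x \<otimes> y = y \<otimes> x} = powers c"
proof -
  have xc: "x \<in> carrier G" using x by auto
  let ?H = "{y \<in> carrier G. x \<otimes> y = y \<otimes> x}"
  have "subgroup ?H G"
  proof (rule subgroupI)
    fix y assume y: "y \<in> ?H"
    then show "inv y \<in> ?H" using intertwine_inv[of y x y] xc by auto
  next
    fix y z assume "y \<in> ?H" "z \<in> ?H"
    then show "y \<otimes> z \<in> ?H" using intertwine_trans[of x y x z x] xc by auto
  qed (use xc in auto)
  then obtain c where "c \<in> ?H" "?H = powers c"
    using cyclic_of_embedding[of ?H "busemann x"] busemann_mult[OF x]
      busemann_zero_imp_not_hyperbolic[OF x] centralizer_hyperbolic[OF x] by blast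
  then show ?thesis by blast
qed

text \<open>The root is a generator of the centralizer of \<open>x\<close>. An element that
  conjugates \<open>c [^] m\<close> to \<open>c [^] n\<close> also conjugates \<open>x [^] m\<close>
  to \<open>x [^] n\<close>, which forces \<open>n = m\<close> or \<open>n = - m\<close>.\<close>

theorem hyperbolic_has_root:
  assumes x: "hyperbolic x"
  shows "\<exists>c. malnormal_root c \<and> (\<exists>l::int. l \<noteq> 0 \<and> x = c [^] l)"
proof -
  have xc: "x \<in> carrier G" using x by auto
  obtain c where c: "c \<in> carrier G" and C: "{y \<in> carrier G. x \<otimes> y = y \<otimes> x} = powers c"
    using centralizer_cyclic[OF x] by blast
  \<comment> \<open>The centralizer of \<open>x [^] m\<close> is cyclic, too, and contains both
    \<open>x\<close> and \<open>y\<close>, so these commute.\<close>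
  have commC: "y \<in> powers c" if y: "y \<in> carrier G" "x [^] m \<otimes> y = y \<otimes> x [^] m" "m \<noteq> 0" for y and m :: int
  proof -
    obtain d where d: "d \<in> carrier G" "{z \<in> carrier G. x [^] m \<otimes> z = z \<otimes> x [^] m} = powers d"
      using centralizer_cyclic[OF hyperbolic_int_pow[OF x y(3)]] by blast
    have "x [^] m \<otimes> x = x \<otimes> x [^] m" using intertwine_int_pow[of x x x m] xc by simp
    then have "x \<in> powers d" "y \<in> powers d" using y d(2) xc by blast+
    then show ?thesis using powers_commute[OF d(1)] C y(1) by blast
  qed
  obtain l :: int where l: "x = c [^] l" using C xc by (auto simp: powers_def)
  have x1: "x \<noteq> \<one>" using hyperbolic_pow_neq_one[OF x, of 1] xc by simp
  then have l0: "l \<noteq> 0" using l by auto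
  have inf: "n = 0" if "c [^] n = \<one>" for n :: int
  proof (rule ccontr)
    assume "n \<noteq> 0"
    have "x [^] n = \<one>" using that l c by (metis int_pow_one int_pow_pow mult.commute)
    then show False using hyperbolic_pow_neq_one[OF x \<open>n \<noteq> 0\<close>] by simp
  qed
  have mal: "g \<in> powers c" if m: "m \<noteq> 0" and g: "g \<in> carrier G" and eq: "c [^] m \<otimes> g = g \<otimes> c [^] n" for m n :: int and g
  proof -
    have eqx: "x [^] m \<otimes> g = g \<otimes> x [^] n"
      using intertwine_int_pow[OF eq, of l] c g by (simp add: l int_pow_pow mult.commute)
    have "\<bar>m\<bar> = \<bar>n\<bar>" using conj_pow_eq_imp_abs_eq[OF x g eqx] .
    then consider "n = m" | "n = - m" by linarith
    then show ?thesis
    proof cases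
      case 1
      then show ?thesis using commC[OF g _ m] eqx by simp
    next
      case 2
      text \<open>An element inverting \<open>x\<close> would have its square in the centralizer of \<open>x\<close>.\<close>
      have eq1: "x [^] m \<otimes> g = g \<otimes> x [^] (- m)" using eqx 2 by simp
      then have eq2: "x [^] (- m) \<otimes> g = g \<otimes> x [^] m"
        using intertwine_inv[OF eq1] g xc by (simp add: int_pow_neg)
      have "x [^] m \<otimes> (g \<otimes> g) = (g \<otimes> g) \<otimes> x [^] m"
        using intertwine_trans[OF eq1 eq2] g xc by simp
      then have "g \<otimes> g \<in> powers c" using commC[OF _ _ m] g by simp
      then obtain k :: int where k: "g \<otimes> g = c [^] k" by (auto simp: powers_def)
      show ?thesis
      proof (cases "k = 0")
        case True
        then have "g [^] (2::nat) = \<one>" using k g by (simp add: numeral_2_eq_2)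
        then have "g = \<one>" using torsion_free[OF g, of 2] by simp
        then show ?thesis using int_pow_0[of G c] by (metis powersI)
      next
        case False
        have "c [^] k \<otimes> g = g \<otimes> c [^] k" using k g by (metis m_assoc)
        then have "x [^] k \<otimes> g = g \<otimes> x [^] k"
          using intertwine_int_pow[of "c [^] k" g "c [^] k" l] c g by (simp add: l int_pow_pow mult.commute)
        then show ?thesis using commC[OF g _ False] by simp
      qed
    qed
  qed
  show ?thesis using c inf mal l l0 by (auto simp: malnormal_root_def)
qed

end

section \<open>Star amalgams\<close>

context group
begin

text \<open>The choice depends on \<open>g\<close> only through its coset, and the trivial coset is
  represented by \<open>\<one>\<close>, so that normal forms detect membership in \<open>C\<close>
  by comparison with \<open>\<one>\<close>.\<close>

definition coset_rep :: "'a set \<Rightarrow> 'a \<Rightarrow> 'a" where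
  "coset_rep C g = (if g \<in> C then \<one> else SOME h. h \<in> C #> g)"

definition coset_part :: "'a set \<Rightarrow> 'a \<Rightarrow> 'a" where
  "coset_part C g = g \<otimes> inv (coset_rep C g)"

context
  fixes C assumes C: "subgroup C G"
begin

lemma coset_rep_in: "g \<in> carrier G \<Longrightarrow> coset_rep C g \<in> C #> g"
proof -
  assume g: "g \<in> carrier G"
  then have "g \<in> C #> g" using C by (simp add: rcos_self)
  then have "(SOME h. h \<in> C #> g) \<in> C #> g" by (rule someI)
  moreover have "\<one> \<in> C #> g" if "g \<in> C"
    using coset_join2[OF g C that] subgroup.one_closed[OF C] by simp
  ultimately show ?thesis by (simp add: coset_rep_def)
qed

lemma coset_rep_closed [simp]: "g \<in> carrier G \<Longrightarrow> coset_rep C g \<in> carrier G"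
  using coset_rep_in[of g] subgroup.subset[OF C] by (auto simp: r_coset_def)

lemma coset_part_in [simp]: "g \<in> carrier G \<Longrightarrow> coset_part C g \<in> C"
proof -
  assume g: "g \<in> carrier G"
  obtain c where c: "c \<in> C" "coset_rep C g = c \<otimes> g" using coset_rep_in[OF g] by (auto simp: r_coset_def)
  have "c \<in> carrier G" using c subgroup.subset[OF C] by auto
  then have "coset_part C g = inv c" using c g by (simp add: coset_part_def inv_mult_group)
  then show ?thesis using c subgroup.m_inv_closed[OF C] by simp
qed

lemma coset_part_closed [simp]: "g \<in> carrier G \<Longrightarrow> coset_part C g \<in> carrier G"
  by (simp add: coset_part_def)

lemma coset_part_rep [simp]: "g \<in> carrier G \<Longrightarrow> coset_part C g \<otimes> coset_rep C g = g"
  by (simp add: coset_part_def)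

lemma coset_rep_mult [simp]:
  assumes "c \<in> C" "g \<in> carrier G"
  shows "coset_rep C (c \<otimes> g) = coset_rep C g"
proof -
  have c: "c \<in> carrier G" using assms subgroup.subset[OF C] by auto
  have "C #> (c \<otimes> g) = C #> g"
    using assms c C by (metis coset_join2 coset_mult_assoc subgroup.subset)
  moreover have "c \<otimes> g \<in> C \<longleftrightarrow> g \<in> C"
  proof
    assume "c \<otimes> g \<in> C"
    then have "inv c \<otimes> (c \<otimes> g) \<in> C" using assms C by (meson subgroup.m_closed subgroup.m_inv_closed)
    then show "g \<in> C" using c assms by simp
  qed (use assms C in \<open>auto intro: subgroup.m_closed\<close>)
  ultimately show ?thesis by (simp add: coset_rep_def)
qed

lemma coset_part_mult [simp]:
  assumes "c \<in> C" "g \<in> carrier G"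
  shows "coset_part C (c \<otimes> g) = c \<otimes> coset_part C g"
  using assms subgroup.subset[OF C] by (auto simp: coset_part_def m_assoc)

lemma coset_rep_mem: "g \<in> C \<Longrightarrow> coset_rep C g = \<one>"
  by (simp add: coset_rep_def)

lemma coset_rep_eq_one_iff: "g \<in> carrier G \<Longrightarrow> coset_rep C g = \<one> \<longleftrightarrow> g \<in> C"
  using coset_part_in[of g] by (auto simp: coset_rep_mem coset_part_def)

lemma coset_rep_idem [simp]: "g \<in> carrier G \<Longrightarrow> coset_rep C (coset_rep C g) = coset_rep C g"
  using coset_rep_mult[of "coset_part C g" "coset_rep C g"] by simp

end
end

text \<open>The invariant of the tower; \<open>M\<close> will be the additive group of the ring. For
  \<open>i = j\<close> the assumption \<open>malnormal\<close> says that the \<open>i\<close>-th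
  partial line is malnormal, for distinct indices that no nontrivial elements of the two partial
  lines are conjugate.\<close>

locale line_system = S: group S + M: comm_group M
  for S :: "('s, 'k) monoid_scheme" (structure) and M :: "('a, 'm) monoid_scheme" +
  fixes P :: "'i set" and Z :: "'i \<Rightarrow> 'a set" and e :: "'i \<Rightarrow> 'a \<Rightarrow> 's"
  assumes Z_subgroup: "i \<in> P \<Longrightarrow> subgroup (Z i) M"
    and e_closed: "\<lbrakk>i \<in> P; z \<in> Z i\<rbrakk> \<Longrightarrow> e i z \<in> carrier S"
    and e_mult: "\<lbrakk>i \<in> P; z \<in> Z i; w \<in> Z i\<rbrakk> \<Longrightarrow> e i (z \<otimes>\<^bsub>M\<^esub> w) = e i z \<otimes> e i w"
    and e_kernel: "\<lbrakk>i \<in> P; z \<in> Z i; e i z = \<one>\<rbrakk> \<Longrightarrow> z = \<one>\<^bsub>M\<^esub>"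
    and malnormal: "\<lbrakk>i \<in> P; j \<in> P; z \<in> Z i; w \<in> Z j; g \<in> carrier S; z \<noteq> \<one>\<^bsub>M\<^esub>;
      e i z \<otimes> g = g \<otimes> e j w\<rbrakk> \<Longrightarrow> i = j \<and> g \<in> e i ` Z i"
    and cover: "\<lbrakk>h \<in> carrier S; h \<noteq> \<one>\<rbrakk> \<Longrightarrow> \<exists>i\<in>P. \<exists>z\<in>Z i. \<exists>g\<in>carrier S. h \<otimes> g = g \<otimes> e i z"
begin

lemma Z_mem [simp]: "\<lbrakk>i \<in> P; z \<in> Z i\<rbrakk> \<Longrightarrow> z \<in> carrier M"
  using subgroup.subset[OF Z_subgroup] by blast

lemma Z_mult [simp]: "\<lbrakk>i \<in> P; z \<in> Z i; w \<in> Z i\<rbrakk> \<Longrightarrow> z \<otimes>\<^bsub>M\<^esub> w \<in> Z i"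
  by (rule subgroup.m_closed[OF Z_subgroup])

lemma Z_one [simp]: "i \<in> P \<Longrightarrow> \<one>\<^bsub>M\<^esub> \<in> Z i"
  by (rule subgroup.one_closed[OF Z_subgroup])

lemma Z_inv [simp]: "\<lbrakk>i \<in> P; z \<in> Z i\<rbrakk> \<Longrightarrow> inv\<^bsub>M\<^esub> z \<in> Z i"
  by (rule subgroup.m_inv_closed[OF Z_subgroup])

lemma Z_mult_iff [simp]:
  assumes "i \<in> P" "z \<in> Z i" "b \<in> carrier M"
  shows "z \<otimes>\<^bsub>M\<^esub> b \<in> Z i \<longleftrightarrow> b \<in> Z i" "b \<otimes>\<^bsub>M\<^esub> z \<in> Z i \<longleftrightarrow> b \<in> Z i"
proof -
  show *: "z \<otimes>\<^bsub>M\<^esub> b \<in> Z i \<longleftrightarrow> b \<in> Z i"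
    using assms Z_mult[of i "inv\<^bsub>M\<^esub> z" "z \<otimes>\<^bsub>M\<^esub> b"] by auto
  then show "b \<otimes>\<^bsub>M\<^esub> z \<in> Z i \<longleftrightarrow> b \<in> Z i" using assms by (simp add: M.m_comm)
qed

lemma e_one [simp]: "i \<in> P \<Longrightarrow> e i \<one>\<^bsub>M\<^esub> = \<one>"
  using e_mult[of i "\<one>\<^bsub>M\<^esub>" "\<one>\<^bsub>M\<^esub>"] e_closed[of i "\<one>\<^bsub>M\<^esub>"] by simp

lemma e_inj: "\<lbrakk>i \<in> P; z \<in> Z i; w \<in> Z i; e i z = e i w\<rbrakk> \<Longrightarrow> z = w"
proof -
  assume i: "i \<in> P" "z \<in> Z i" "w \<in> Z i" "e i z = e i w"
  have "e i (z \<otimes>\<^bsub>M\<^esub> inv\<^bsub>M\<^esub> w) = e i (w \<otimes>\<^bsub>M\<^esub> inv\<^bsub>M\<^esub> w)"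
    using i by (simp only: e_mult Z_inv)
  then have "z \<otimes>\<^bsub>M\<^esub> inv\<^bsub>M\<^esub> w = \<one>\<^bsub>M\<^esub>" using i e_kernel[of i "z \<otimes>\<^bsub>M\<^esub> inv\<^bsub>M\<^esub> w"] by simp
  then show "z = w" using i by (simp add: M.inv_solve_right')
qed

abbreviation C :: "'i \<Rightarrow> 's set" where "C i \<equiv> e i ` Z i"

lemma C_subgroup: "i \<in> P \<Longrightarrow> subgroup (C i) S"
proof (rule S.subgroupI)
  assume i: "i \<in> P"
  show "inv x \<in> C i" if "x \<in> C i" for x
  proof -
    obtain z where z: "z \<in> Z i" "x = e i z" using \<open>x \<in> C i\<close> by auto
    have "e i (inv\<^bsub>M\<^esub> z) \<otimes> e i z = \<one>" using i z by (simp flip: e_mult)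
    then have "inv x = e i (inv\<^bsub>M\<^esub> z)" using i z by (simp add: S.inv_equality e_closed)
    then show ?thesis using i z by simp
  qed
  show "x \<otimes> y \<in> C i" if "x \<in> C i" "y \<in> C i" for x y
    using that i by (auto simp flip: e_mult)
qed (use e_closed Z_one in blast)+

definition coord :: "'i \<Rightarrow> 's \<Rightarrow> 'a" where "coord i = inv_into (Z i) (e i)"

lemma coord_e [simp]: "\<lbrakk>i \<in> P; z \<in> Z i\<rbrakk> \<Longrightarrow> coord i (e i z) = z"
  unfolding coord_def by (intro inv_into_f_f inj_onI e_inj)

lemma coord_in [simp]: "\<lbrakk>i \<in> P; c \<in> C i\<rbrakk> \<Longrightarrow> coord i c \<in> Z i"
  and e_coord [simp]: "\<lbrakk>i \<in> P; c \<in> C i\<rbrakk> \<Longrightarrow> e i (coord i c) = c"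
  by auto

abbreviation rS :: "'i \<Rightarrow> 's \<Rightarrow> 's" where "rS i \<equiv> S.coset_rep (C i)"
abbreviation cS :: "'i \<Rightarrow> 's \<Rightarrow> 's" where "cS i \<equiv> S.coset_part (C i)"
abbreviation rM :: "'i \<Rightarrow> 'a \<Rightarrow> 'a" where "rM i \<equiv> M.coset_rep (Z i)"
abbreviation cM :: "'i \<Rightarrow> 'a \<Rightarrow> 'a" where "cM i \<equiv> M.coset_part (Z i)"

lemmas rS_simps = S.coset_rep_closed[OF C_subgroup] S.coset_part_in[OF C_subgroup]
  S.coset_part_closed[OF C_subgroup] S.coset_part_rep[OF C_subgroup]
  S.coset_rep_mult[OF C_subgroup] S.coset_part_mult[OF C_subgroup]
  S.coset_rep_eq_one_iff[OF C_subgroup] S.coset_rep_idem[OF C_subgroup]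
lemmas rM_simps = M.coset_rep_closed[OF Z_subgroup] M.coset_part_in[OF Z_subgroup]
  M.coset_part_closed[OF Z_subgroup] M.coset_part_rep[OF Z_subgroup]
  M.coset_rep_mult[OF Z_subgroup] M.coset_part_mult[OF Z_subgroup]
  M.coset_rep_eq_one_iff[OF Z_subgroup] M.coset_rep_idem[OF Z_subgroup]

lemma rM_in_iff: "\<lbrakk>i \<in> P; a \<in> carrier M\<rbrakk> \<Longrightarrow> rM i a \<in> Z i \<longleftrightarrow> a \<in> Z i"
  using Z_mult_iff(1)[of i "cM i a" "rM i a"] by (simp add: rM_simps)

subsection \<open>Normal forms\<close>

text \<open>
  The pair \<open>(g, [(i\<^sub>1, r\<^sub>1, t\<^sub>1), \<dots>])\<close> stands for the product \<open>g r\<^sub>1 t\<^sub>1 r\<^sub>2 t\<^sub>2 \<dots>\<close> in the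
  amalgam of \<open>S\<close> with one copy of \<open>M\<close> for each \<open>i\<close>, glued along \<open>Z i\<close>. As \<open>join i\<close> identifies
  \<open>M \<times> tails i\<close> with the set of normal forms, each copy of \<open>M\<close> acts on the latter, and so does \<open>S\<close>
  through the first component. Since the orbit of \<open>(\<one>, [])\<close> is everything, normal forms can be
  multiplied by letting the first one act on the second.
\<close>

definition starts :: "'i \<Rightarrow> ('i \<times> 'a \<times> 's) list \<Rightarrow> bool" where
  "starts i l \<longleftrightarrow> l \<noteq> [] \<and> fst (hd l) = i"

lemma starts_simps [simp]: "\<not> starts i []" "starts i (u # l) \<longleftrightarrow> fst u = i"
  by (auto simp: starts_def)

fun nf :: "('i \<times> 'a \<times> 's) list \<Rightarrow> bool" where
  "nf [] \<longleftrightarrow> True"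
| "nf ((i, r, t) # l) \<longleftrightarrow> i \<in> P \<and> r \<in> carrier M \<and> r \<notin> Z i \<and> rM i r = r \<and> t \<in> carrier S \<and> rS i t = t
     \<and> \<not> (t = \<one> \<and> starts i l) \<and> nf l"

definition NF :: "('s \<times> ('i \<times> 'a \<times> 's) list) set" where
  "NF = {(g, l). g \<in> carrier S \<and> nf l}"

definition tails :: "'i \<Rightarrow> ('s \<times> ('i \<times> 'a \<times> 's) list) set" where
  "tails i = {(t, l). t \<in> carrier S \<and> rS i t = t \<and> nf l \<and> \<not> (t = \<one> \<and> starts i l)}"

definition join :: "'i \<Rightarrow> 'a \<Rightarrow> 's \<times> ('i \<times> 'a \<times> 's) list \<Rightarrow> 's \<times> ('i \<times> 'a \<times> 's) list" where
  "join i a x = (if a \<in> Z i then (e i a \<otimes> fst x, snd x) else (e i (cM i a), (i, rM i a, fst x) # snd x))"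

text \<open>The inverse of \<open>join i\<close>. In the first case the normal form begins inside
  line \<open>i\<close>, and its head and first exponent combine to one coordinate; otherwise only
  the part of the head in \<open>C i\<close> belongs to the coordinate.\<close>

definition split :: "'i \<Rightarrow> 's \<times> ('i \<times> 'a \<times> 's) list \<Rightarrow> 'a \<times> 's \<times> ('i \<times> 'a \<times> 's) list" where
  "split i x = (if fst x \<in> C i \<and> starts i (snd x)
     then (coord i (fst x) \<otimes>\<^bsub>M\<^esub> fst (snd (hd (snd x))), snd (snd (hd (snd x))), tl (snd x))
     else (coord i (cS i (fst x)), rS i (fst x), snd x))"

lemma tails_NF: "x \<in> tails i \<Longrightarrow> x \<in> NF"
  by (auto simp: tails_def NF_def)

lemma join_closed: "\<lbrakk>i \<in> P; a \<in> carrier M; x \<in> tails i\<rbrakk> \<Longrightarrow> join i a x \<in> NF"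
  by (auto simp: join_def tails_def NF_def e_closed rM_simps rM_in_iff)

lemma split_closed:
  assumes i: "i \<in> P" and x: "x \<in> NF"
  shows "fst (split i x) \<in> carrier M" "snd (split i x) \<in> tails i"
proof -
  obtain g l where gl: "x = (g, l)" "g \<in> carrier S" "nf l" using x by (auto simp: NF_def)
  have "fst (split i x) \<in> carrier M \<and> snd (split i x) \<in> tails i"
  proof (cases "g \<in> C i \<and> starts i l")
    case True
    then obtain r t m where "l = (i, r, t) # m" by (cases l) auto
    then show ?thesis using True gl i by (auto simp: split_def tails_def)
  next
    case False
    then show ?thesis using gl i by (auto simp: split_def tails_def rS_simps)
  qed
  then show "fst (split i x) \<in> carrier M" "snd (split i x) \<in> tails i" by auto
qed

lemma join_split:
  assumes i: "i \<in> P" and x: "x \<in> NF"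
  shows "join i (fst (split i x)) (snd (split i x)) = x"
proof -
  obtain g l where gl: "x = (g, l)" "g \<in> carrier S" "nf l" using x by (auto simp: NF_def)
  show ?thesis
  proof (cases "g \<in> C i \<and> starts i l")
    case True
    then obtain r t m where l: "l = (i, r, t) # m" by (cases l) auto
    obtain z where z: "z \<in> Z i" "g = e i z" using True by auto
    have r: "r \<in> carrier M" "r \<notin> Z i" "rM i r = r" using gl l by auto
    have "cM i r = \<one>\<^bsub>M\<^esub>" using r by (simp add: M.coset_part_def)
    then show ?thesis using gl i z r by (auto simp: split_def join_def l rM_simps)
  next
    case False
    then have "split i x = (coord i (cS i g), rS i g, l)" using gl by (auto simp: split_def)
    moreover have "coord i (cS i g) \<in> Z i" "e i (coord i (cS i g)) = cS i g"
      using coord_in[OF i, of "cS i g"] e_coord[OF i, of "cS i g"] i gl by (auto simp only: rS_simps)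
    ultimately show ?thesis using gl i by (simp add: join_def rS_simps)
  qed
qed

lemma split_join:
  assumes i: "i \<in> P" and a: "a \<in> carrier M" and x: "x \<in> tails i"
  shows "split i (join i a x) = (a, x)"
proof -
  obtain t l where tl: "x = (t, l)" "t \<in> carrier S" "rS i t = t" "nf l" "\<not> (t = \<one> \<and> starts i l)"
    using x by (auto simp: tails_def)
  show ?thesis
  proof (cases "a \<in> Z i")
    case True
    have ea: "e i a \<in> C i" "e i a \<in> carrier S" using True i e_closed by auto
    have "\<not> (e i a \<otimes> t \<in> C i \<and> starts i l)"
    proof
      assume *: "e i a \<otimes> t \<in> C i \<and> starts i l"
      then have "rS i (e i a \<otimes> t) = \<one>" by (simp add: S.coset_rep_def)
      then have "t = \<one>" using ea tl i by (simp add: rS_simps)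
      then show False using * tl by simp
    qed
    moreover have "cS i t = \<one>" using tl by (simp add: S.coset_part_def)
    ultimately show ?thesis using True ea tl i by (auto simp: split_def join_def rS_simps)
  next
    case False
    have "cM i a \<in> Z i" using a i by (simp add: rM_simps)
    then show ?thesis using False a tl i by (auto simp: split_def join_def rM_simps)
  qed
qed

definition actS :: "'s \<Rightarrow> 's \<times> ('i \<times> 'a \<times> 's) list \<Rightarrow> 's \<times> ('i \<times> 'a \<times> 's) list" where
  "actS s x = (s \<otimes> fst x, snd x)"

definition actM :: "'i \<Rightarrow> 'a \<Rightarrow> 's \<times> ('i \<times> 'a \<times> 's) list \<Rightarrow> 's \<times> ('i \<times> 'a \<times> 's) list" where
  "actM i b x = join i (b \<otimes>\<^bsub>M\<^esub> fst (split i x)) (snd (split i x))"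

lemma NF_joinE:
  assumes "i \<in> P" "x \<in> NF"
  obtains a y where "a \<in> carrier M" "y \<in> tails i" "x = join i a y"
  using join_split[OF assms] split_closed[OF assms] by metis

lemma actM_join: "\<lbrakk>i \<in> P; a \<in> carrier M; b \<in> carrier M; x \<in> tails i\<rbrakk> \<Longrightarrow>
    actM i b (join i a x) = join i (b \<otimes>\<^bsub>M\<^esub> a) x"
  by (simp add: actM_def split_join)

lemma actS_closed: "\<lbrakk>s \<in> carrier S; x \<in> NF\<rbrakk> \<Longrightarrow> actS s x \<in> NF"
  by (auto simp: actS_def NF_def)

lemma actM_closed: "\<lbrakk>i \<in> P; b \<in> carrier M; x \<in> NF\<rbrakk> \<Longrightarrow> actM i b x \<in> NF"
  by (simp add: actM_def join_closed split_closed)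

lemma actS_mult: "\<lbrakk>s \<in> carrier S; t \<in> carrier S; x \<in> NF\<rbrakk> \<Longrightarrow> actS (s \<otimes> t) x = actS s (actS t x)"
  by (auto simp: actS_def NF_def S.m_assoc)

lemma actS_one: "x \<in> NF \<Longrightarrow> actS \<one> x = x"
  by (auto simp: actS_def NF_def)

lemma actM_mult:
  assumes "i \<in> P" "a \<in> carrier M" "b \<in> carrier M" "x \<in> NF"
  shows "actM i (a \<otimes>\<^bsub>M\<^esub> b) x = actM i a (actM i b x)"
proof -
  obtain c y where "c \<in> carrier M" "y \<in> tails i" "x = join i c y" using NF_joinE[OF assms(1,4)] .
  then show ?thesis using assms by (simp add: actM_join M.m_assoc)
qed

lemma join_Z:
  "\<lbrakk>i \<in> P; z \<in> Z i; a \<in> carrier M; x \<in> tails i\<rbrakk> \<Longrightarrow> join i (z \<otimes>\<^bsub>M\<^esub> a) x = actS (e i z) (join i a x)"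
  by (auto simp: join_def actS_def tails_def e_mult e_closed S.m_assoc rM_simps)

lemma actM_Z:
  assumes "i \<in> P" "z \<in> Z i" "x \<in> NF"
  shows "actM i z x = actS (e i z) x"
proof -
  obtain c y where "c \<in> carrier M" "y \<in> tails i" "x = join i c y" using NF_joinE[OF assms(1,3)] .
  then show ?thesis using assms by (simp add: actM_join join_Z)
qed

lemma join_one: "\<lbrakk>i \<in> P; x \<in> tails i\<rbrakk> \<Longrightarrow> join i \<one>\<^bsub>M\<^esub> x = x"
  by (auto simp: join_def tails_def)

lemma one_tails: "i \<in> P \<Longrightarrow> (\<one>, []) \<in> tails i"
  using S.coset_rep_mem[OF C_subgroup, of i \<one>] subgroup.one_closed[OF C_subgroup]
  by (auto simp: tails_def)

section \<open>Evaluation of normal forms in an action\<close>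

fun run :: "('s \<Rightarrow> 'y \<Rightarrow> 'y) \<Rightarrow> ('i \<Rightarrow> 'a \<Rightarrow> 'y \<Rightarrow> 'y) \<Rightarrow> ('i \<times> 'a \<times> 's) list \<Rightarrow> 'y \<Rightarrow> 'y" where
  "run F H [] y = y"
| "run F H ((i, r, t) # l) y = H i r (F t (run F H l y))"

text \<open>Generic in the two actions: with \<open>actS\<close> and \<open>actM\<close> it is the
  multiplication of the amalgam, with left multiplications in another group it is the homomorphism
  to that group.\<close>

definition ev :: "('s \<Rightarrow> 'y \<Rightarrow> 'y) \<Rightarrow> ('i \<Rightarrow> 'a \<Rightarrow> 'y \<Rightarrow> 'y) \<Rightarrow> 's \<times> ('i \<times> 'a \<times> 's) list \<Rightarrow> 'y \<Rightarrow> 'y" where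
  "ev F H x y = F (fst x) (run F H (snd x) y)"

end

text \<open>Actions of \<open>S\<close> and of the copies of \<open>M\<close> that agree on each
  \<open>Z i\<close>; by the universal property of the amalgam these amount to an action of the
  latter.\<close>

locale line_action = line_system S M P Z e
  for S :: "('s, 'k) monoid_scheme" (structure) and M :: "('a, 'm) monoid_scheme"
    and P :: "'i set" and Z :: "'i \<Rightarrow> 'a set" and e :: "'i \<Rightarrow> 'a \<Rightarrow> 's" +
  fixes Y :: "'y set" and F :: "'s \<Rightarrow> 'y \<Rightarrow> 'y" and H :: "'i \<Rightarrow> 'a \<Rightarrow> 'y \<Rightarrow> 'y"
  assumes F_closed: "\<lbrakk>s \<in> carrier S; y \<in> Y\<rbrakk> \<Longrightarrow> F s y \<in> Y"
    and H_closed: "\<lbrakk>i \<in> P; b \<in> carrier M; y \<in> Y\<rbrakk> \<Longrightarrow> H i b y \<in> Y"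
    and F_mult: "\<lbrakk>s \<in> carrier S; t \<in> carrier S; y \<in> Y\<rbrakk> \<Longrightarrow> F (s \<otimes> t) y = F s (F t y)"
    and H_mult: "\<lbrakk>i \<in> P; a \<in> carrier M; b \<in> carrier M; y \<in> Y\<rbrakk> \<Longrightarrow> H i (a \<otimes>\<^bsub>M\<^esub> b) y = H i a (H i b y)"
    and H_Z: "\<lbrakk>i \<in> P; z \<in> Z i; y \<in> Y\<rbrakk> \<Longrightarrow> H i z y = F (e i z) y"
begin

lemma run_closed: "\<lbrakk>nf l; y \<in> Y\<rbrakk> \<Longrightarrow> run F H l y \<in> Y"
  by (induction l) (auto simp: F_closed H_closed)

lemma ev_closed: "\<lbrakk>x \<in> NF; y \<in> Y\<rbrakk> \<Longrightarrow> ev F H x y \<in> Y"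
  by (auto simp: ev_def NF_def F_closed run_closed)

lemma ev_actS: "\<lbrakk>s \<in> carrier S; x \<in> NF; y \<in> Y\<rbrakk> \<Longrightarrow> ev F H (actS s x) y = F s (ev F H x y)"
  by (auto simp: ev_def NF_def actS_def F_mult run_closed)

lemma ev_join:
  assumes "i \<in> P" "a \<in> carrier M" "x \<in> tails i" "y \<in> Y"
  shows "ev F H (join i a x) y = H i a (ev F H x y)"
proof -
  obtain t l where x: "x = (t, l)" "t \<in> carrier S" "nf l" using assms by (auto simp: tails_def)
  define u where "u = F t (run F H l y)"
  have u: "u \<in> Y" using x assms by (simp add: u_def F_closed run_closed)
  show ?thesis
  proof (cases "a \<in> Z i")
    case True
    then have "H i a u = F (e i a) u" using assms u by (simp add: H_Z)
    then show ?thesis using True assms x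
      by (simp add: join_def ev_def u_def F_mult e_closed run_closed)
  next
    case False
    have c: "cM i a \<in> Z i" "cM i a \<in> carrier M" "rM i a \<in> carrier M" "cM i a \<otimes>\<^bsub>M\<^esub> rM i a = a"
      using assms by (simp_all add: rM_simps)
    have "ev F H (join i a x) y = F (e i (cM i a)) (H i (rM i a) u)"
      using False x by (simp add: join_def ev_def u_def)
    also have "\<dots> = H i (cM i a \<otimes>\<^bsub>M\<^esub> rM i a) u"
      using H_mult[OF assms(1) c(2,3) u] H_Z[OF assms(1) c(1)] H_closed[OF assms(1) c(3) u] by simp
    finally show ?thesis unfolding c(4) using x by (simp add: ev_def u_def)
  qed
qed

lemma ev_actM:
  assumes "i \<in> P" "b \<in> carrier M" "x \<in> NF" "y \<in> Y"
  shows "ev F H (actM i b x) y = H i b (ev F H x y)"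
proof -
  obtain c w where "c \<in> carrier M" "w \<in> tails i" "x = join i c w" using NF_joinE[OF assms(1,3)] .
  then show ?thesis using assms by (simp add: actM_join ev_join H_mult ev_closed tails_NF)
qed

end

context line_system
begin

sublocale self: line_action S M P Z e NF actS actM
  by unfold_locales (simp_all add: actS_closed actM_closed actS_mult actS_one actM_mult actM_Z)

definition amalgam :: "('s \<times> ('i \<times> 'a \<times> 's) list) monoid" where
  "amalgam = \<lparr>carrier = NF, monoid.mult = ev actS actM, one = (\<one>, [])\<rparr>"

lemma run_base: "nf l \<Longrightarrow> run actS actM l (\<one>, []) = (\<one>, l)"
proof (induction l)
  case (Cons u l)
  obtain i r t where u: "u = (i, r, t)" by (cases u)
  have i: "i \<in> P" "r \<in> carrier M" "r \<notin> Z i" "rM i r = r" "t \<in> carrier S"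
    and t: "(t, l) \<in> tails i" using Cons u by (auto simp: tails_def)
  have "run actS actM (u # l) (\<one>, []) = actM i r (join i \<one>\<^bsub>M\<^esub> (t, l))"
    using Cons u i join_one[OF i(1) t] by (simp add: actS_def[of t])
  also have "\<dots> = join i r (t, l)" using i t by (simp add: actM_join)
  also have "\<dots> = (\<one>, u # l)" using i u by (simp add: join_def M.coset_part_def)
  finally show ?case .
qed simp

lemma one_NF: "(\<one>, []) \<in> NF"
  by (simp add: NF_def)

lemma ev_ev:
  assumes "x \<in> NF" "y \<in> NF" "w \<in> NF"
  shows "ev actS actM (ev actS actM x y) w = ev actS actM x (ev actS actM y w)"
proof -
  have "ev actS actM (run actS actM l y) w = run actS actM l (ev actS actM y w)" if "nf l" for l
    using that
  proof (induction l)
    case (Cons u l)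
    obtain i r t where u: "u = (i, r, t)" by (cases u)
    then show ?case using Cons assms by (simp add: self.ev_actM self.ev_actS actS_closed self.run_closed)
  qed simp
  moreover have "fst x \<in> carrier S" "nf (snd x)" using assms(1) by (auto simp: NF_def)
  ultimately show ?thesis using assms(2,3)
    by (simp add: ev_def[of actS actM x] self.ev_actS self.run_closed)
qed

lemma left_inverse:
  assumes "x \<in> NF"
  shows "\<exists>y\<in>NF. ev actS actM y x = (\<one>, [])"
proof -
  have main: "\<exists>y\<in>NF. \<forall>w\<in>NF. ev actS actM y (run actS actM l w) = w" if "nf l" for l
    using that
  proof (induction l)
    case Nil
    show ?case using one_NF by (intro bexI[of _ "(\<one>, [])"]) (auto simp: ev_def actS_one)
  next
    case (Cons u l)
    obtain i r t where u: "u = (i, r, t)" by (cases u)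
    have i: "i \<in> P" "r \<in> carrier M" "t \<in> carrier S" "nf l" using Cons u by auto
    obtain y where y: "y \<in> NF" "\<And>w. w \<in> NF \<Longrightarrow> ev actS actM y (run actS actM l w) = w"
      using Cons i by auto
    define q where "q = actS (inv t) (actM i (inv\<^bsub>M\<^esub> r) (\<one>, []))"
    have q: "q \<in> NF" using i one_NF by (simp add: q_def actS_closed actM_closed)
    have qw: "ev actS actM q w = actS (inv t) (actM i (inv\<^bsub>M\<^esub> r) w)" if "w \<in> NF" for w
    proof -
      have "ev actS actM (\<one>, []) w = w" using that by (simp add: ev_def actS_one)
      then show ?thesis
        using i one_NF that by (simp add: q_def self.ev_actS self.ev_actM actM_closed)
    qed
    have "ev actS actM (ev actS actM y q) (run actS actM (u # l) w) = w" if w: "w \<in> NF" for w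
    proof -
      have rw: "run actS actM l w \<in> NF" "run actS actM (u # l) w \<in> NF"
        using w i self.run_closed Cons.prems by auto
      have "actM i (inv\<^bsub>M\<^esub> r) (actM i r v) = v" if "v \<in> NF" for v
        using that i by (metis M.inv_closed M.l_inv actM_Z actM_mult actS_one e_one Z_one)
      moreover have "actS (inv t) (actS t v) = v" if "v \<in> NF" for v
        using that i by (metis S.inv_closed S.l_inv actS_mult actS_one)
      ultimately have "ev actS actM q (run actS actM (u # l) w) = run actS actM l w"
        using qw[OF rw(2)] u rw i by (simp add: actS_closed)
      then show ?thesis using ev_ev[OF y(1) q rw(2)] y w by simp
    qed
    then show ?case using self.ev_closed[OF y(1) q] by blast
  qed
  obtain g l where x: "x = (g, l)" "g \<in> carrier S" "nf l" using assms by (auto simp: NF_def)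
  obtain y where y: "y \<in> NF" "\<And>w. w \<in> NF \<Longrightarrow> ev actS actM y (run actS actM l w) = w"
    using main x by blast
  have "x = actS g (run actS actM l (\<one>, []))" using x by (simp add: run_base actS_def)
  moreover have "(inv g, []) \<in> NF" using x by (simp add: NF_def)
  moreover have "actS (inv g) (actS g v) = v" if "v \<in> NF" for v
    using that x by (metis S.inv_closed S.l_inv actS_mult actS_one)
  ultimately have "ev actS actM (inv g, []) x = run actS actM l (\<one>, [])"
    using x one_NF self.run_closed by (simp add: ev_def)
  then have "ev actS actM (ev actS actM y (inv g, [])) x = (\<one>, [])"
    using ev_ev[OF y(1) \<open>(inv g, []) \<in> NF\<close> assms] y one_NF by simp
  then show ?thesis using self.ev_closed[OF y(1) \<open>(inv g, []) \<in> NF\<close>] by blast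
qed

sublocale K: group amalgam
proof (rule groupI)
  fix x assume "x \<in> carrier amalgam"
  then show "\<exists>y\<in>carrier amalgam. y \<otimes>\<^bsub>amalgam\<^esub> x = \<one>\<^bsub>amalgam\<^esub>"
    using left_inverse by (simp add: amalgam_def)
qed (auto simp: amalgam_def self.ev_closed one_NF ev_ev, simp add: ev_def actS_one)

end

subsection \<open>The length function\<close>

text \<open>
  The normal form of \<open>x\<close>, read from the right, describes the path from the vertex \<open>S\<close> to the
  vertex \<open>S x\<close> of the Bass--Serre tree. A syllable \<open>(i, r, t)\<close> contributes two edges,
  determined by \<open>(i, t)\<close> and by \<open>r\<close>; \<open>agree\<close> counts the common edges of two paths.
\<close>

fun agree :: "('i \<times> 'a \<times> 's) list \<Rightarrow> ('i \<times> 'a \<times> 's) list \<Rightarrow> int" where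
  "agree ((i, r, t) # l) ((j, r', t') # m) =
     (if i = j \<and> t = t' then if r = r' then 2 + agree l m else 1 else 0)"
| "agree _ _ = 0"

lemma agree_nonneg: "0 \<le> agree l m"
  by (induction l m rule: agree.induct) auto

lemma agree_sym: "agree l m = agree m l"
  by (induction l m rule: agree.induct) auto

lemma agree_refl [simp]: "agree l l = 2 * int (length l)"
  by (induction l) auto

lemma agree_Nil [simp]: "agree l [] = 0"
  by (cases l) auto

lemma agree_le: "agree l m \<le> 2 * int (length l)"
  by (induction l m rule: agree.induct) auto

lemma agree_ultra: "min (agree l m) (agree m n) \<le> agree l n"
proof (induction l m arbitrary: n rule: agree.induct)
  case (1 i r t l j r' t' m)
  show ?case
  proof (cases n)
    case (Cons u n')
    obtain k r'' t'' where u: "u = (k, r'', t'')" by (cases u)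
    show ?thesis
      using 1[of n'] agree_nonneg[of l n'] agree_nonneg[of l m] agree_nonneg[of m n']
      unfolding Cons u by auto
  qed simp
qed (auto simp: agree_nonneg)

lemma agree_append: "agree (l @ m) (l @ n) = 2 * int (length l) + agree m n"
  by (induction l) auto

text \<open>Half the distance of two vertices of the tree, as each syllable stands for two edges.
  The lists are reversed because paths are read from the right.\<close>

definition list_dist :: "('i \<times> 'a \<times> 's) list \<Rightarrow> ('i \<times> 'a \<times> 's) list \<Rightarrow> int" where
  "list_dist l m = int (length l) + int (length m) - agree (rev l) (rev m)"

lemma list_dist_triangle: "list_dist l n \<le> list_dist l m + list_dist m n"
  using agree_ultra[of "rev l" "rev m" "rev n"] agree_le[of "rev m" "rev n"]
    agree_le[of "rev m" "rev l"] agree_sym[of "rev l" "rev m"]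
  by (simp add: list_dist_def)

lemma list_dist_self [simp]: "list_dist l l = 0"
  and list_dist_Nil [simp]: "list_dist l [] = int (length l)"
  and list_dist_Cons [simp]: "list_dist l (u # l) = 1" "list_dist (u # l) l = 1"
  using agree_append[of "rev l" "[]" "[u]"] agree_append[of "rev l" "[u]" "[]"]
  by (simp_all add: list_dist_def)

lemma list_dist_Cons_Cons: "list_dist ((i, r, t) # l) ((i, r', t) # l) \<le> 1"
  by (simp add: list_dist_def agree_append)

context line_system
begin

abbreviation mult_amalgam (infixl "\<bullet>" 70) where "x \<bullet> y \<equiv> x \<otimes>\<^bsub>amalgam\<^esub> y"

definition base :: "'s \<Rightarrow> 's \<times> ('i \<times> 'a \<times> 's) list" where
  "base s = (s, [])"

definition line :: "'i \<Rightarrow> 'a \<Rightarrow> 's \<times> ('i \<times> 'a \<times> 's) list" where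
  "line i b = actM i b (\<one>, [])"

lemma carrier_amalgam [simp]: "carrier amalgam = NF"
  by (simp add: amalgam_def)

lemma one_amalgam: "\<one>\<^bsub>amalgam\<^esub> = (\<one>, [])"
  by (simp add: amalgam_def)

lemmas K_closed [simp] = K.m_closed[simplified] K.one_closed[simplified] K.inv_closed[simplified]
  K.nat_pow_closed[simplified] K.int_pow_closed[simplified]
lemmas K_simps [simp] = K.l_one[simplified] K.r_one[simplified] K.l_inv[simplified] K.r_inv[simplified]
  K.inv_cancel_left[simplified] K.inv_cancel_right[simplified] K.inv_inv[simplified] 
lemmas K_assoc = K.m_assoc[simplified]
lemmas K_inv_mult = K.inv_mult_group[simplified]

lemma base_NF [simp]: "s \<in> carrier S \<Longrightarrow> base s \<in> NF"
  by (simp add: base_def NF_def)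

lemma line_NF [simp]: "\<lbrakk>i \<in> P; b \<in> carrier M\<rbrakk> \<Longrightarrow> line i b \<in> NF"
  by (simp add: line_def actM_closed one_NF)

lemma base_act: "x \<in> NF \<Longrightarrow> base s \<bullet> x = actS s x"
  by (simp add: base_def amalgam_def ev_def)

lemma line_act: "\<lbrakk>i \<in> P; b \<in> carrier M; x \<in> NF\<rbrakk> \<Longrightarrow> line i b \<bullet> x = actM i b x"
  by (simp add: line_def amalgam_def self.ev_actM one_NF) (simp add: ev_def actS_one)

lemma base_mult: "\<lbrakk>s \<in> carrier S; t \<in> carrier S\<rbrakk> \<Longrightarrow> base (s \<otimes> t) = base s \<bullet> base t"
  by (simp add: base_act) (simp add: base_def actS_def)

lemma base_one: "base \<one> = \<one>\<^bsub>amalgam\<^esub>"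
  by (simp add: base_def one_amalgam)

lemma base_inv: "s \<in> carrier S \<Longrightarrow> base (inv s) = inv\<^bsub>amalgam\<^esub> (base s)"
  using base_mult[of "inv s" s] by (intro K.inv_equality[symmetric]) (simp_all add: base_one)

lemma line_mult: "\<lbrakk>i \<in> P; a \<in> carrier M; b \<in> carrier M\<rbrakk> \<Longrightarrow> line i (a \<otimes>\<^bsub>M\<^esub> b) = line i a \<bullet> line i b"
  by (simp add: line_act) (simp add: line_def actM_mult one_NF)

lemma line_Z: "\<lbrakk>i \<in> P; z \<in> Z i\<rbrakk> \<Longrightarrow> line i z = base (e i z)"
  by (simp add: line_def actM_Z one_NF) (simp add: actS_def base_def e_closed)

lemma line_one: "i \<in> P \<Longrightarrow> line i \<one>\<^bsub>M\<^esub> = \<one>\<^bsub>amalgam\<^esub>"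
  by (simp add: line_Z base_one)

lemma line_inv: "\<lbrakk>i \<in> P; b \<in> carrier M\<rbrakk> \<Longrightarrow> line i (inv\<^bsub>M\<^esub> b) = inv\<^bsub>amalgam\<^esub> (line i b)"
  using line_mult[of i "inv\<^bsub>M\<^esub> b" b] by (intro K.inv_equality[symmetric]) (simp_all add: line_one)

lemma line_comm: "\<lbrakk>i \<in> P; a \<in> carrier M; b \<in> carrier M\<rbrakk> \<Longrightarrow> line i a \<bullet> line i b = line i b \<bullet> line i a"
  by (metis line_mult M.m_comm)

lemma line_pow: "\<lbrakk>i \<in> P; b \<in> carrier M\<rbrakk> \<Longrightarrow> line i (b [^]\<^bsub>M\<^esub> (n::nat)) = line i b [^]\<^bsub>amalgam\<^esub> n"
  by (induction n) (simp_all add: line_one line_mult)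

lemma line_join: "\<lbrakk>i \<in> P; b \<in> carrier M\<rbrakk> \<Longrightarrow> line i b = join i b (\<one>, [])"
  using actM_join[of i "\<one>\<^bsub>M\<^esub>" b "(\<one>, [])"] by (simp add: line_def join_one one_tails)

lemma line_act_join: "\<lbrakk>i \<in> P; b \<in> carrier M; x \<in> tails i\<rbrakk> \<Longrightarrow> line i b \<bullet> x = join i b x"
  using actM_join[of i "\<one>\<^bsub>M\<^esub>" b x] by (simp add: line_act join_one tails_NF)

lemma line_base_iff: "\<lbrakk>i \<in> P; b \<in> carrier M\<rbrakk> \<Longrightarrow> snd (line i b) = [] \<longleftrightarrow> b \<in> Z i"
  by (simp add: line_join join_def)

lemma line_kernel: "\<lbrakk>i \<in> P; b \<in> carrier M; line i b = \<one>\<^bsub>amalgam\<^esub>\<rbrakk> \<Longrightarrow> b = \<one>\<^bsub>M\<^esub>"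
proof -
  assume *: "i \<in> P" "b \<in> carrier M" "line i b = \<one>\<^bsub>amalgam\<^esub>"
  then have "b \<in> Z i" using line_base_iff[of i b] by (simp add: one_amalgam)
  moreover from this have "e i b = \<one>" using * line_Z[of i b] by (simp add: one_amalgam base_def)
  ultimately show "b = \<one>\<^bsub>M\<^esub>" using * e_kernel by blast
qed

fun prd :: "('i \<times> 'a \<times> 's) list \<Rightarrow> 's \<times> ('i \<times> 'a \<times> 's) list" where
  "prd [] = \<one>\<^bsub>amalgam\<^esub>"
| "prd ((i, r, t) # l) = line i r \<bullet> (base t \<bullet> prd l)"

definition valid :: "('i \<times> 'a \<times> 's) list \<Rightarrow> bool" where
  "valid = list_all (\<lambda>(i, r, t). i \<in> P \<and> r \<in> carrier M \<and> t \<in> carrier S)"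

lemma valid_simps [simp]: "valid []"
  "valid ((i, r, t) # l) \<longleftrightarrow> i \<in> P \<and> r \<in> carrier M \<and> t \<in> carrier S \<and> valid l"
  "valid (l @ m) \<longleftrightarrow> valid l \<and> valid m" "valid (rev l) \<longleftrightarrow> valid l"
  by (simp_all add: valid_def)

lemma nf_valid: "nf l \<Longrightarrow> valid l"
  by (induction l) auto

lemma prd_closed [simp]: "valid l \<Longrightarrow> prd l \<in> NF"
  by (induction l) auto

lemma prd_append: "\<lbrakk>valid l; valid m\<rbrakk> \<Longrightarrow> prd (l @ m) = prd l \<bullet> prd m"
  by (induction l) (auto simp: K_assoc)

lemma prd_nf: "nf l \<Longrightarrow> prd l = (\<one>, l)"
proof -
  assume nf: "nf l"
  then have "prd l = run actS actM l (\<one>, [])"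
  proof (induction l)
    case (Cons u l)
    then show ?case
      by (cases u) (simp add: base_act line_act nf_valid actS_closed one_NF self.run_closed)
  qed (simp add: one_amalgam)
  then show ?thesis using nf by (simp add: run_base)
qed

lemma NF_prd: "(g, l) \<in> NF \<Longrightarrow> (g, l) = base g \<bullet> prd l"
  by (auto simp: NF_def prd_nf base_act nf_valid) (auto simp: actS_def base_act NF_def)

text \<open>\<open>n\<close> bounds the number of line factors in some product equal to
  \<open>x\<close>. The length turns out to be the least such bound, hence independent of the chosen
  representatives.\<close>

inductive syllables :: "nat \<Rightarrow> 's \<times> ('i \<times> 'a \<times> 's) list \<Rightarrow> bool" where
  one: "syllables n \<one>\<^bsub>amalgam\<^esub>"
| base: "\<lbrakk>s \<in> carrier S; syllables n x\<rbrakk> \<Longrightarrow> syllables n (base s \<bullet> x)"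
| line: "\<lbrakk>i \<in> P; b \<in> carrier M; syllables n x\<rbrakk> \<Longrightarrow> syllables (Suc n) (line i b \<bullet> x)"

lemma syllables_NF: "syllables n x \<Longrightarrow> x \<in> NF"
  by (induction rule: syllables.induct) auto

lemma syllables_mono: "syllables n x \<Longrightarrow> n \<le> m \<Longrightarrow> syllables m x"
proof (induction arbitrary: m rule: syllables.induct)
  case (line i b n x)
  then obtain k where "m = Suc k" "n \<le> k" by (cases m) auto
  then show ?case using line by (auto intro: syllables.line)
qed (auto intro: syllables.intros)

lemma syllables_mult: "\<lbrakk>syllables n x; syllables m y\<rbrakk> \<Longrightarrow> syllables (n + m) (x \<bullet> y)"
proof (induction rule: syllables.induct)
  case (one n)
  then show ?case using syllables_mono[of m y "n + m"] syllables_NF by simp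
qed (use syllables_NF in \<open>auto simp: K_assoc intro: syllables.base syllables.line\<close>)

lemma syllables_base: "s \<in> carrier S \<Longrightarrow> syllables 0 (base s)"
  using syllables.base[OF _ syllables.one, of s 0] by simp

lemma syllables_line: "\<lbrakk>i \<in> P; b \<in> carrier M\<rbrakk> \<Longrightarrow> syllables 1 (line i b)"
  using syllables.line[OF _ _ syllables.one, of i b 0] by simp

lemma syllables_inv: "syllables n x \<Longrightarrow> syllables n (inv\<^bsub>amalgam\<^esub> x)"
proof (induction rule: syllables.induct)
  case (base s n x)
  then show ?case
    using syllables_mult[OF base(3) syllables_base[of "inv s"]] syllables_NF[OF base(2)]
    by (simp add: K_inv_mult base_inv)
next
  case (line i b n x)
  then show ?case
    using syllables_mult[OF line(4) syllables_line[of i "inv\<^bsub>M\<^esub> b"]] syllables_NF[OF line(3)]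
    by (simp add: K_inv_mult line_inv)
qed (simp add: syllables.one)

lemma syllables_prd: "valid l \<Longrightarrow> syllables (length l) (prd l)"
proof (induction l)
  case (Cons u l)
  then show ?case
    by (cases u) (simp add: syllables.line[OF _ _ syllables.base])
qed (simp add: syllables.one)

lemma list_dist_join:
  "i \<in> P \<Longrightarrow> a \<in> carrier M \<Longrightarrow> b \<in> carrier M \<Longrightarrow> list_dist (snd (join i a x)) (snd (join i b x)) \<le> 1"
  by (auto simp: join_def list_dist_Cons_Cons)

text \<open>A base factor leaves the list alone, and a factor from line \<open>i\<close> moves
  within one fibre of \<open>join i\<close>, whose lists have distance at most 1.\<close>

lemma list_dist_syllables: "\<lbrakk>syllables n x; y \<in> NF\<rbrakk> \<Longrightarrow> list_dist (snd (x \<bullet> y)) (snd y) \<le> int n"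
proof (induction rule: syllables.induct)
  case (base s n x)
  then show ?case using syllables_NF[OF base(2)] by (simp add: K_assoc base_act[of "x \<bullet> y"] actS_def)
next
  case (line i b n x)
  define w where "w = x \<bullet> y"
  have w: "w \<in> NF" using line syllables_NF by (simp add: w_def)
  obtain a v where v: "a \<in> carrier M" "v \<in> tails i" "w = join i a v" using NF_joinE[OF line(1) w] .
  have "line i b \<bullet> x \<bullet> y = join i (b \<otimes>\<^bsub>M\<^esub> a) v"
    using line syllables_NF[OF line(3)] w v line_act[OF line(1,2) w]
    by (simp add: K_assoc actM_join flip: w_def)
  then have "list_dist (snd (line i b \<bullet> x \<bullet> y)) (snd w) \<le> 1" using line v list_dist_join by simp
  then show ?case
    using list_dist_triangle[of "snd (line i b \<bullet> x \<bullet> y)" "snd y" "snd w"] line by (simp add: w_def)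
qed simp

text \<open>Common rightmost syllables cancel in the quotient. If the next ones agree in
  \<open>i\<close> and \<open>t\<close> but not in the exponent, they merge into a single line
  factor; this is the odd case of \<open>agree\<close>.\<close>

lemma syllables_list_dist:
  assumes "valid l" "valid m"
  shows "syllables (nat (list_dist l m)) (prd l \<bullet> inv\<^bsub>amalgam\<^esub> (prd m))"
proof -
  have "syllables (nat (int (length l) + int (length m) - agree l m))
      (prd (rev l) \<bullet> inv\<^bsub>amalgam\<^esub> (prd (rev m)))" if "valid l" "valid m" for l m
    using that
  proof (induction l m rule: agree.induct)
    case (1 i r t l j r' t' m)
    have v: "valid l" "valid m" "i \<in> P" "j \<in> P" "r \<in> carrier M" "r' \<in> carrier M"
      "t \<in> carrier S" "t' \<in> carrier S" using 1 by auto
    define u u' where "u = line i r \<bullet> base t" and "u' = line j r' \<bullet> base t'"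
    have u: "u \<in> NF" "u' \<in> NF" "syllables 1 u" "syllables 1 u'"
      using v syllables_mult[OF syllables_line syllables_base, of i r t]
        syllables_mult[OF syllables_line syllables_base, of j r' t'] by (auto simp: u_def u'_def)
    have p: "prd (rev ((i, r, t) # l)) = prd (rev l) \<bullet> u"
      "prd (rev ((j, r', t') # m)) = prd (rev m) \<bullet> u'"
      using v by (simp_all add: prd_append u_def u'_def)
    define U V where "U = prd (rev l)" and "V = prd (rev m)"
    have UV: "U \<in> NF" "V \<in> NF" "syllables (length l) U" "syllables (length m) V"
      using v syllables_prd[of "rev l"] syllables_prd[of "rev m"] by (auto simp: U_def V_def)
    have prod: "U \<bullet> u \<bullet> inv\<^bsub>amalgam\<^esub> (V \<bullet> u') = U \<bullet> (u \<bullet> inv\<^bsub>amalgam\<^esub> u') \<bullet> inv\<^bsub>amalgam\<^esub> V"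
      using UV u by (simp add: K_inv_mult K_assoc)
    consider "i = j" "t = t'" "r = r'" | "i = j" "t = t'" "r \<noteq> r'" | "\<not> (i = j \<and> t = t')" by blast
    then show ?case
    proof cases
      case 1
      then have "u = u'" by (simp add: u_def u'_def)
      then have "U \<bullet> u \<bullet> inv\<^bsub>amalgam\<^esub> (V \<bullet> u') = U \<bullet> inv\<^bsub>amalgam\<^esub> V" using prod UV u by simp
      then show ?thesis using "1.IH" 1 v unfolding p U_def[symmetric] V_def[symmetric] by (simp add: U_def V_def)
    next
      case 2
      then have "u \<bullet> inv\<^bsub>amalgam\<^esub> u' = line i (r \<otimes>\<^bsub>M\<^esub> inv\<^bsub>M\<^esub> r')"
        using v by (simp add: u_def u'_def K_inv_mult K_assoc line_mult line_inv)
      then have "syllables 1 (u \<bullet> inv\<^bsub>amalgam\<^esub> u')" using v syllables_line by simp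
      then have "syllables (length l + 1 + length m) (U \<bullet> u \<bullet> inv\<^bsub>amalgam\<^esub> (V \<bullet> u'))"
        unfolding prod using UV by (intro syllables_mult syllables_inv)
      then show ?thesis unfolding p U_def[symmetric] V_def[symmetric] using 2
        by (simp add: nat_add_distrib algebra_simps)
    next
      case 3
      have "syllables ((length l + 1) + (length m + 1)) (U \<bullet> u \<bullet> inv\<^bsub>amalgam\<^esub> (V \<bullet> u'))"
        using UV u by (intro syllables_mult syllables_inv)
      then show ?thesis unfolding p U_def[symmetric] V_def[symmetric] using 3
        by (auto simp: nat_add_distrib algebra_simps)
    qed
  next
    case ("2_1" m)
    then show ?case using syllables_inv[OF syllables_prd[of "rev m"]] by simp
  next
    case ("2_2" l)
    then show ?case using syllables_prd[of "rev l"] by simp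
  qed
  from this[of "rev l" "rev m"] show ?thesis using assms by (simp add: list_dist_def)
qed

definition len :: "'s \<times> ('i \<times> 'a \<times> 's) list \<Rightarrow> int" where
  "len x = int (length (snd x))"

lemma len_le: "syllables n x \<Longrightarrow> len x \<le> int n"
  using list_dist_syllables[of n x "\<one>\<^bsub>amalgam\<^esub>"] syllables_NF[of n x] one_NF
  by (simp add: len_def one_amalgam[THEN arg_cong[of _ _ snd]])

lemma syllables_len:
  assumes "x \<in> NF"
  shows "syllables (length (snd x)) x"
proof -
  obtain g l where x: "x = (g, l)" "g \<in> carrier S" "nf l" using assms by (auto simp: NF_def)
  have "(g, l) = base g \<bullet> prd l" using x assms by (intro NF_prd) simp
  then show ?thesis
    using syllables.base[OF x(2) syllables_prd[OF nf_valid[OF x(3)]]] unfolding x(1) snd_conv by simp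
qed

text \<open>A short word for the quotient bounds its length, and conversely a quotient of small
  length moves \<open>y\<close> only a small distance.\<close>

lemma len_dist:
  assumes "x \<in> NF" "y \<in> NF"
  shows "len (x \<bullet> inv\<^bsub>amalgam\<^esub> y) = list_dist (snd x) (snd y)"
proof (rule antisym)
  obtain g l where x: "x = (g, l)" "g \<in> carrier S" "nf l" using assms by (auto simp: NF_def)
  obtain h m where y: "y = (h, m)" "h \<in> carrier S" "nf m" using assms by (auto simp: NF_def)
  have v: "valid l" "valid m" using x y nf_valid by auto
  have "x \<bullet> inv\<^bsub>amalgam\<^esub> y = base g \<bullet> (prd l \<bullet> inv\<^bsub>amalgam\<^esub> (prd m)) \<bullet> base (inv h)"
    using x y v NF_prd[of g l] NF_prd[of h m] assms by (simp add: K_inv_mult K_assoc base_inv)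
  moreover have "syllables (0 + nat (list_dist l m) + 0) \<dots>"
    using x y v by (intro syllables_mult syllables_list_dist syllables_base) auto
  ultimately have "len (x \<bullet> inv\<^bsub>amalgam\<^esub> y) \<le> int (nat (list_dist l m))"
    using len_le[of "nat (list_dist l m)"] unfolding add_0_left add_0_right by simp
  moreover have "list_dist l m \<ge> 0"
    using agree_le[of "rev l" "rev m"] agree_le[of "rev m" "rev l"] agree_sym[of "rev l" "rev m"]
    by (simp add: list_dist_def)
  ultimately show "len (x \<bullet> inv\<^bsub>amalgam\<^esub> y) \<le> list_dist (snd x) (snd y)" using x y by simp
next
  define z where "z = x \<bullet> inv\<^bsub>amalgam\<^esub> y"
  have "z \<in> NF" "z \<bullet> y = x" using assms by (simp_all add: z_def)
  then show "list_dist (snd x) (snd y) \<le> len (x \<bullet> inv\<^bsub>amalgam\<^esub> y)"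
    using list_dist_syllables[OF syllables_len, of z y] assms by (simp add: len_def flip: z_def)
qed

sublocale L: lyndon_length amalgam len
proof
  show "len \<one>\<^bsub>amalgam\<^esub> = 0" by (simp add: len_def one_amalgam)
  show "len (inv\<^bsub>amalgam\<^esub> x) = len x" if "x \<in> carrier amalgam" for x
  proof -
    have "len (inv\<^bsub>amalgam\<^esub> x) = list_dist [] (snd x)"
      using len_dist[of "\<one>\<^bsub>amalgam\<^esub>" x] that by (simp add: one_amalgam[THEN arg_cong[of _ _ snd]])
    then show ?thesis by (simp add: list_dist_def len_def)
  qed
  show "min (len x + len y - len (x \<bullet> inv\<^bsub>amalgam\<^esub> y)) (len y + len z - len (y \<bullet> inv\<^bsub>amalgam\<^esub> z))
        \<le> len x + len z - len (x \<bullet> inv\<^bsub>amalgam\<^esub> z)"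
    if "x \<in> carrier amalgam" "y \<in> carrier amalgam" "z \<in> carrier amalgam" for x y z
    using agree_ultra[of "rev (snd x)" "rev (snd y)" "rev (snd z)"] that
    by (simp add: len_dist list_dist_def) (simp add: len_def)
qed

end

subsection \<open>Full lines and hyperbolic elements\<close>

context line_system
begin

text \<open>The situation in which a left factor from line \<open>i\<close> merges with the first
  syllable, as in the first case of \<open>split\<close>.\<close>

definition headed :: "'i \<Rightarrow> 's \<times> ('i \<times> 'a \<times> 's) list \<Rightarrow> bool" where
  "headed i x \<longleftrightarrow> fst x \<in> C i \<and> starts i (snd x)"

lemma C_carrier: "i \<in> P \<Longrightarrow> c \<in> C i \<Longrightarrow> c \<in> carrier S"
  using e_closed by auto

lemma C_mult_iff: "\<lbrakk>i \<in> P; c \<in> C i; s \<in> carrier S\<rbrakk> \<Longrightarrow> s \<otimes> c \<in> C i \<longleftrightarrow> s \<in> C i"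
proof
  assume *: "i \<in> P" "c \<in> C i" "s \<in> carrier S" "s \<otimes> c \<in> C i"
  have "s \<otimes> c \<otimes> inv c \<in> C i"
    using * C_subgroup[OF *(1)] by (meson subgroup.m_closed subgroup.m_inv_closed)
  then show "s \<in> C i" using * C_carrier by simp
qed (meson C_subgroup subgroup.m_closed)

lemma headed_step:
  assumes i: "i \<in> P" "b \<in> carrier M" "b \<notin> Z i" "s \<in> carrier S" and y: "y \<in> NF"
    and ok: "snd y = [] \<or> (\<exists>j\<in>P. headed j y \<and> \<not> (i = j \<and> s \<in> C i))"
  shows "headed i (line i b \<bullet> (base s \<bullet> y))" "len (line i b \<bullet> (base s \<bullet> y)) = len y + 1"
proof -
  obtain g l where gl: "y = (g, l)" "g \<in> carrier S" "nf l" using y by (auto simp: NF_def)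
  have x: "base s \<bullet> y = (s \<otimes> g, l)" using y gl by (simp add: base_act actS_def)
  have "\<not> (s \<otimes> g \<in> C i \<and> starts i l)"
    using ok gl i C_mult_iff[of i g s] by (auto simp: headed_def starts_def)
  then have "split i (s \<otimes> g, l) = (coord i (cS i (s \<otimes> g)), rS i (s \<otimes> g), l)" by (auto simp: split_def)
  moreover have "coord i (cS i (s \<otimes> g)) \<in> Z i" using i gl by (intro coord_in) (simp_all only: rS_simps S.m_closed)
  ultimately have "actM i b (s \<otimes> g, l) = (e i (cM i (b \<otimes>\<^bsub>M\<^esub> coord i (cS i (s \<otimes> g)))),
      (i, rM i (b \<otimes>\<^bsub>M\<^esub> coord i (cS i (s \<otimes> g))), rS i (s \<otimes> g)) # l)"
    "b \<otimes>\<^bsub>M\<^esub> coord i (cS i (s \<otimes> g)) \<in> carrier M"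
    using i by (simp_all add: actM_def join_def)
  moreover have "line i b \<bullet> (base s \<bullet> y) = actM i b (s \<otimes> g, l)"
    using i y by (simp add: line_act x[symmetric])
  ultimately show "headed i (line i b \<bullet> (base s \<bullet> y))" "len (line i b \<bullet> (base s \<bullet> y)) = len y + 1"
    using i gl by (simp_all add: headed_def len_def rM_simps)
qed

text \<open>Reduced words, weaker than \<open>nf\<close>: the entries need not be coset
  representatives. Hence the last entry may be changed and words may be concatenated, as cyclic
  reduction requires.\<close>

fun rword :: "('i \<times> 'a \<times> 's) list \<Rightarrow> bool" where
  "rword [] \<longleftrightarrow> True"
| "rword ((i, b, s) # w) \<longleftrightarrow> i \<in> P \<and> b \<in> carrier M \<and> b \<notin> Z i \<and> s \<in> carrier S
     \<and> \<not> (s \<in> C i \<and> starts i w) \<and> rword w"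

lemma rword_valid: "rword w \<Longrightarrow> valid w"
  by (induction w) auto

lemma nf_rword: "nf l \<Longrightarrow> rword l"
  by (induction l) (auto simp: S.coset_rep_def)

lemma rword_headed:
  "rword w \<Longrightarrow> len (prd w) = int (length w) \<and> (w \<noteq> [] \<longrightarrow> headed (fst (hd w)) (prd w))"
proof (induction w)
  case (Cons u w)
  obtain i b s where u: "u = (i, b, s)" by (cases u)
  have ok: "snd (prd w) = [] \<or> (\<exists>j\<in>P. headed j (prd w) \<and> \<not> (i = j \<and> s \<in> C i))"
  proof (cases w)
    case (Cons v w')
    then have "fst (hd w) \<in> P" using \<open>rword (u # w)\<close> by (cases v) (auto simp: u)
    then show ?thesis using Cons Cons.IH \<open>rword (u # w)\<close> by (auto simp: u starts_def)
  qed (simp add: one_amalgam)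
  have "i \<in> P" "b \<in> carrier M" "b \<notin> Z i" "s \<in> carrier S" "prd w \<in> NF"
    using Cons.prems rword_valid[of w] by (auto simp: u)
  from headed_step[OF this ok] show ?case using Cons u by simp
qed (simp add: len_def one_amalgam)

lemma rword_append_iff:
  "rword (u @ (i, b, s) # w) \<longleftrightarrow> rword (u @ [(i, b, \<one>)]) \<and> s \<in> carrier S
     \<and> \<not> (s \<in> C i \<and> starts i w) \<and> rword w"
proof (induction u)
  case (Cons v u)
  have "starts j (u @ (i, b, s) # w) \<longleftrightarrow> starts j (u @ [(i, b, \<one>)])" for j
    by (cases u) auto
  then show ?case using Cons by (cases v) auto
qed auto

definition on_line :: "'s \<times> ('i \<times> 'a \<times> 's) list \<Rightarrow> bool" where
  "on_line x \<longleftrightarrow> (\<exists>i\<in>P. \<exists>b\<in>carrier M. \<exists>g\<in>NF. x \<bullet> g = g \<bullet> line i b)"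

definition conj_hyperbolic :: "'s \<times> ('i \<times> 'a \<times> 's) list \<Rightarrow> bool" where
  "conj_hyperbolic x \<longleftrightarrow> (\<exists>y. \<exists>g\<in>NF. L.hyperbolic y \<and> x \<bullet> g = g \<bullet> y)"

lemmas K_intertwine_trans = K.intertwine_trans[simplified]
lemmas K_intertwine_sym = K.intertwine_sym[simplified]
lemmas K_intertwine_nat_pow = K.intertwine_nat_pow[simplified]

lemma L_hyperbolic_NF [simp]: "L.hyperbolic y \<Longrightarrow> y \<in> NF"
  using L.hyperbolic_closed by simp

lemma on_line_conj: "\<lbrakk>on_line y; x \<in> NF; y \<in> NF; g \<in> NF; x \<bullet> g = g \<bullet> y\<rbrakk> \<Longrightarrow> on_line x"
  unfolding on_line_def using K_intertwine_trans[of x g y] by (metis K_closed(1) line_NF)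

lemma conj_hyperbolic_conj: "\<lbrakk>conj_hyperbolic y; x \<in> NF; y \<in> NF; g \<in> NF; x \<bullet> g = g \<bullet> y\<rbrakk> \<Longrightarrow> conj_hyperbolic x"
  unfolding conj_hyperbolic_def using K_intertwine_trans[of x g y] by (metis K_closed(1) L_hyperbolic_NF)

text \<open>Cyclic reduction. If the last syllable does not merge with the first one, the square of
  the rotated word is reduced, hence twice as long. Otherwise a conjugation merges the two and
  removes a syllable, or the only syllable puts the element on a line.\<close>

theorem on_line_or_conj_hyperbolic:
  "\<lbrakk>x \<in> NF; x \<noteq> \<one>\<^bsub>amalgam\<^esub>\<rbrakk> \<Longrightarrow> on_line x \<or> conj_hyperbolic x"
proof (induction "length (snd x)" arbitrary: x rule: less_induct)
  case less
  obtain g l where x: "x = (g, l)" "g \<in> carrier S" "nf l" using less.prems by (auto simp: NF_def)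
  have xp: "x = base g \<bullet> prd l" using NF_prd[of g l] x less.prems by simp
  show ?case
  proof (cases l rule: rev_cases)
    case Nil
    then have xg: "x = base g" using xp x by simp
    then have "g \<noteq> \<one>" using less.prems base_one by metis
    then obtain i z h where z: "i \<in> P" "z \<in> Z i" "h \<in> carrier S" "g \<otimes> h = h \<otimes> e i z"
      using cover x(2) by blast
    then have "x \<bullet> base h = base h \<bullet> line i z"
      using x(2) by (simp add: xg line_Z e_closed flip: base_mult)
    then have "on_line x" using z unfolding on_line_def by (meson Z_mem base_NF)
    then show ?thesis ..
  next
    case (snoc l0 u)
    obtain i r t where u: "u = (i, r, t)" by (cases u)
    have v: "valid l0" "i \<in> P" "r \<in> carrier M" "t \<in> carrier S" "valid l"
      using nf_valid[OF x(3)] by (auto simp: snoc u)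
    have rw: "rword (l0 @ [(i, r, \<one>)])"
      using nf_rword[OF x(3)] rword_append_iff[of l0 i r t "[]"] by (simp add: snoc u)
    have xu: "x = base g \<bullet> (prd l0 \<bullet> (line i r \<bullet> base t))"
      using v x(2) by (simp add: xp snoc u prd_append K_assoc)
    show ?thesis
    proof (cases "starts i l \<and> t \<otimes> g \<in> C i")
      case False
      \<comment> \<open>Conjugation by \<open>base g\<close> moves the head of the normal form
        behind its last syllable.\<close>
      define w where "w = l0 @ [(i, r, t \<otimes> g)]"
      have w: "rword w" using rw x(2) v by (simp add: w_def rword_append_iff[of l0 i r "t \<otimes> g"])
      have "\<not> (t \<otimes> g \<in> C i \<and> starts i w)"
        using False by (cases l0) (auto simp: w_def snoc u)
      then have "rword (l0 @ (i, r, t \<otimes> g) # w)"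
        using rw w x(2) v by (simp add: rword_append_iff[of l0 i r "t \<otimes> g" w])
      then have ww: "rword (w @ w)" by (simp add: w_def)
      have wv: "prd w \<in> NF" "valid w" using rword_valid[OF w] by auto
      have "len (prd w) = int (length w)" "len (prd w \<bullet> prd w) = int (length (w @ w))"
        using rword_headed[OF w] rword_headed[OF ww] prd_append[OF wv(2,2)] by simp_all
      then have "L.hyperbolic (prd w)" using wv by (simp add: L.hyperbolic_def) (simp add: w_def)
      moreover have "prd w = prd l0 \<bullet> (line i r \<bullet> (base t \<bullet> base g))"
        using v x(2) by (simp add: w_def prd_append base_mult)
      then have "x \<bullet> base g = base g \<bullet> prd w"
        using v x(2) by (simp add: xu K_assoc)
      ultimately have "conj_hyperbolic x" using x(2) unfolding conj_hyperbolic_def by (meson base_NF)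
      then show ?thesis ..
    next
      case True
      then obtain z where z: "z \<in> Z i" "t \<otimes> g = e i z" by auto
      have bz: "base t \<bullet> base g = line i z" using z v x(2) by (simp add: line_Z flip: base_mult)
      show ?thesis
      proof (cases l0)
        case Nil
        have "x \<bullet> base g = base g \<bullet> line i (r \<otimes>\<^bsub>M\<^esub> z)"
          using v x(2) z by (simp add: xu Nil K_assoc bz line_mult)
        then have "on_line x" using v z x(2) unfolding on_line_def by (meson M.m_closed Z_mem base_NF)
        then show ?thesis ..
      next
        case (Cons u1 m)
        obtain r1 t1 where u1: "u1 = (i, r1, t1)" using True by (cases u1) (auto simp: snoc Cons)
        have m: "valid m" "r1 \<in> carrier M" "t1 \<in> carrier S" using v by (auto simp: Cons u1)
        define q where "q = line i r \<bullet> base t"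
        \<comment> \<open>Conjugation by the last syllable \<open>q\<close> brings it in front of
          the first one. Between their exponents stands only \<open>t \<otimes> g\<close>, an
          element of the line with coordinate \<open>z\<close>.\<close>
        define y where "y = line i (r \<otimes>\<^bsub>M\<^esub> z \<otimes>\<^bsub>M\<^esub> r1) \<bullet> (base t1 \<bullet> prd m)"
        have qy: "q \<in> NF" "y \<in> NF" using v z m by (auto simp: q_def y_def)
        have "q \<bullet> x = (line i r \<bullet> (base t \<bullet> base g)) \<bullet> (prd l0 \<bullet> q)"
          using v x(2) by (simp add: xu q_def K_assoc)
        also have "\<dots> = y \<bullet> q"
          using v m z qy by (simp add: bz Cons u1 y_def line_mult K_assoc)
        finally have eq: "y \<bullet> q = q \<bullet> x" by simp
        have "y \<noteq> \<one>\<^bsub>amalgam\<^esub>"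
        proof
          assume "y = \<one>\<^bsub>amalgam\<^esub>"
          then have "q \<bullet> x = q" using eq qy by simp
          then show False using less.prems qy K.l_cancel_one[of q x] by simp
        qed
        have "syllables (Suc (length m)) y"
          unfolding y_def using v m z by (intro syllables.line syllables.base syllables_prd) auto
        then have "length (snd y) \<le> Suc (length m)" using len_le[of "Suc (length m)" y] by (simp add: len_def)
        then have "length (snd y) < length (snd x)" by (simp add: x(1) snoc Cons)
        then have "on_line y \<or> conj_hyperbolic y" using less.hyps qy \<open>y \<noteq> \<one>\<^bsub>amalgam\<^esub>\<close> by blast
        moreover have "x \<bullet> inv\<^bsub>amalgam\<^esub> q = inv\<^bsub>amalgam\<^esub> q \<bullet> y"
          using K_intertwine_sym[OF eq] qy less.prems by simp
        ultimately show ?thesis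
          using on_line_conj[of y x] conj_hyperbolic_conj[of y x] qy less.prems by (meson K_closed(3))
      qed
    qed
  qed
qed

text \<open>A right factor from a line merges at most with the last syllable, so the index of the
  first one survives unless it was the only one and collapsed into the base.\<close>

lemma prd_line_headed:
  assumes "nf l" "l \<noteq> []" "j \<in> P" "b \<in> carrier M"
  shows "snd (prd l \<bullet> line j b) = [] \<or> headed (fst (hd l)) (prd l \<bullet> line j b)"
  using assms(1,2)
proof (induction l)
  case (Cons u l)
  obtain i r t where u: "u = (i, r, t)" by (cases u)
  have v: "i \<in> P" "r \<in> carrier M" "r \<notin> Z i" "t \<in> carrier S" "rS i t = t" "nf l" "valid l"
    "\<not> (t = \<one> \<and> starts i l)"
    using Cons.prems nf_valid[of "u # l"] by (auto simp: u)
  define y where "y = prd l \<bullet> line j b"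
  have y: "y \<in> NF" using v assms by (simp add: y_def)
  have eq: "prd (u # l) \<bullet> line j b = line i r \<bullet> (base t \<bullet> y)"
    using v assms by (simp add: u y_def K_assoc)
  \<comment> \<open>As a coset representative, \<open>t\<close> lies in \<open>C i\<close> only if
    it is \<open>\<one>\<close>, which a normal form forbids before a syllable of the same
    line.\<close>
  have tC: "t \<in> C i \<longleftrightarrow> t = \<one>" using v by (metis S.coset_rep_mem C_subgroup rS_simps(7))
  show ?case
  proof (cases l)
    case Nil
    show ?thesis
    proof (cases "b \<in> Z j")
      case True
      then have "snd y = []" using assms line_base_iff v by (simp add: y_def Nil)
      then show ?thesis using headed_step(1)[OF v(1-4) y] unfolding eq by (simp add: u)
    next
      case False
      have hy: "headed j y" using headed_step(1)[OF assms(3,4) False, of \<one> "\<one>\<^bsub>amalgam\<^esub>"] assms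
        by (simp add: y_def Nil base_one) (simp add: one_amalgam)
      show ?thesis
      proof (cases "i = j \<and> t \<in> C i")
        case True
        then have "line i r \<bullet> (base t \<bullet> y) = line i (r \<otimes>\<^bsub>M\<^esub> b)"
          using tC v assms by (simp add: y_def Nil base_one line_mult)
        moreover have "snd (line i c) = [] \<or> headed i (line i c)" if "c \<in> carrier M" for c
          using that v by (auto simp: line_join join_def headed_def rM_simps e_closed)
        ultimately show ?thesis using v assms unfolding eq by (simp add: u)
      next
        case False
        then show ?thesis using headed_step(1)[OF v(1-4) y] hy assms unfolding eq by (auto simp: u)
      qed
    qed
  next
    case (Cons u' l')
    then have "fst (hd l) \<in> P" using v by (cases u') auto
    moreover have "snd y = [] \<or> headed (fst (hd l)) y"
      using Cons.IH v Cons by (auto simp: y_def)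
    moreover have "\<not> (i = fst (hd l) \<and> t \<in> C i)" using v tC Cons by (auto simp: starts_def)
    ultimately show ?thesis using headed_step(1)[OF v(1-4) y] unfolding eq by (auto simp: u)
  qed
qed simp

text \<open>Induction on the syllables of \<open>g\<close>: a leading factor from line
  \<open>i\<close> commutes with \<open>line i a\<close> and can be stripped. For \<open>g\<close>
  in the base, either malnormality in \<open>S\<close> or a comparison of normal forms decides; all
  other \<open>g\<close> are contradictory.\<close>

theorem lines_malnormal:
  assumes ij: "i \<in> P" "j \<in> P" and a: "a \<in> carrier M" "a \<noteq> \<one>\<^bsub>M\<^esub>" and b: "b \<in> carrier M"
  shows "\<lbrakk>g \<in> NF; line i a \<bullet> g = g \<bullet> line j b\<rbrakk> \<Longrightarrow> i = j \<and> g \<in> line i ` carrier M"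
proof (induction "length (snd g)" arbitrary: g rule: less_induct)
  case less
  obtain h l where g: "g = (h, l)" "h \<in> carrier S" "nf l" using less.prems by (auto simp: NF_def)
  have gp: "g = base h \<bullet> prd l" using NF_prd[of h l] g less.prems by simp
  show ?case
  proof (cases "l = []")
    case True
    then have gh: "g = base h" using gp g by simp
    define z where "z = coord i (cS i h)"
    have z: "z \<in> Z i" "e i z \<otimes> rS i h = h"
      using ij g coord_in[OF ij(1), of "cS i h"] e_coord[OF ij(1), of "cS i h"]
      by (simp_all add: z_def rS_simps del: e_coord)
    have tl: "(rS i h, []) \<in> tails i" using ij g by (simp add: tails_def rS_simps)
    have "base h = join i z (rS i h, [])" using z by (simp add: join_def base_def)
    then have lhs: "line i a \<bullet> g = join i (a \<otimes>\<^bsub>M\<^esub> z) (rS i h, [])"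
      using line_act[OF ij(1) a(1) less.prems(1)] actM_join[OF ij(1) _ a(1) tl, of z] z ij gh by simp
    have rhs: "g \<bullet> line j b = actS h (join j b (\<one>, []))"
      by (simp only: gh base_act[OF line_NF[OF ij(2) b]]) (simp only: line_join[OF ij(2) b])
    show ?thesis
    proof (cases "a \<in> Z i")
      case True
      then have "snd (g \<bullet> line j b) = []" using lhs less.prems z ij by (simp add: join_def)
      then have bZ: "b \<in> Z j" unfolding rhs by (auto simp: actS_def join_def split: if_splits)
      have "base (e i a \<otimes> h) = base (h \<otimes> e j b)"
        using less.prems(2) True bZ ij g by (simp add: gh line_Z base_mult e_closed)
      then have "e i a \<otimes> h = h \<otimes> e j b" by (simp add: base_def)
      then have "i = j" "h \<in> C i" using malnormal[OF ij True bZ g(2) a(2)] by auto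
      then obtain x where "x \<in> Z i" "g = line i x" using gh ij line_Z[of i] by auto
      then show ?thesis using \<open>i = j\<close> ij by auto
    next
      case False
      then have "a \<otimes>\<^bsub>M\<^esub> z \<notin> Z i" using ij a z by simp
      then have "join j b (\<one>, []) = (fst (join j b (\<one>, [])), [(i, rM i (a \<otimes>\<^bsub>M\<^esub> z), rS i h)])"
        using lhs rhs less.prems(2) by (auto simp: join_def actS_def)
      \<comment> \<open>The syllable on the right-hand side ends in the representative
        \<open>\<one>\<close>, the one on the left-hand side in \<open>rS i h\<close>.\<close>
      then have "i = j" "rS i h = \<one>" by (auto simp: join_def split: if_splits)
      then have "h = e i z" using z ij by (simp add: e_closed)
      then have "g = line i z" using gh ij line_Z[of i z] z by simp
      then show ?thesis using \<open>i = j\<close> ij z by auto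
    qed
  next
    case False
    then obtain i1 r1 t1 m where l: "l = (i1, r1, t1) # m" by (metis list.exhaust prod_cases3)
    have v: "i1 \<in> P" "r1 \<in> carrier M" "t1 \<in> carrier S" "valid m" "nf m" using g nf_valid[OF g(3)] by (auto simp: l)
    show ?thesis
    proof (cases "headed i g")
      case True
      then obtain z where z: "z \<in> Z i" "h = e i z" "i1 = i" by (auto simp: headed_def g l)
      define y where "y = base t1 \<bullet> prd m"
      define c where "c = z \<otimes>\<^bsub>M\<^esub> r1"
      have c: "c \<in> carrier M" using z ij v by (simp add: c_def)
      have y: "y \<in> NF" using v by (simp add: y_def)
      have gy: "g = line i c \<bullet> y"
        using z ij v by (simp add: gp l y_def c_def line_mult K_assoc line_Z[of i z] e_closed)
      have "y = (t1, m)" using v by (simp add: y_def prd_nf base_act NF_def nf_valid actS_def)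
      then have "length (snd y) < length (snd g)" by (simp add: g l)
      moreover have "line i c \<bullet> (line i a \<bullet> y) = line i c \<bullet> (y \<bullet> line j b)"
        using less.prems(2) ij a b c y line_comm[of i a c] by (simp add: gy flip: K_assoc)
      then have "line i a \<bullet> y = y \<bullet> line j b"
        using ij a b c y K_simps(5)[of "line i c"] by (metis K_closed(1) line_NF)
      ultimately obtain d where "i = j" "d \<in> carrier M" "y = line i d" using less.hyps y by blast
      then show ?thesis using gy ij c by (auto simp: line_mult[symmetric] intro!: image_eqI)
    next
      case nh: False
      text \<open>
        Right multiplication by an element of a line keeps the first edge of the path of \<open>g\<close>,
        whereas left multiplication by \<open>line i a\<close> moves it unless \<open>g\<close> starts along the line \<open>i\<close>.
      \<close>
      define w where "w = prd l \<bullet> line j b"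
      have w: "w \<in> NF" using g ij b nf_valid by (simp add: w_def)
      have rhs: "g \<bullet> line j b = (h \<otimes> fst w, snd w)"
      proof -
        have "g \<bullet> line j b = base h \<bullet> w"
          unfolding gp w_def using nf_valid[OF g(3)] g(2) ij b by (intro K_assoc) auto
        then show ?thesis using base_act[OF w] by (simp add: actS_def)
      qed
      have hw: "snd w = [] \<or> headed i1 w"
        using prd_line_headed[OF g(3) False ij(2) b] by (simp add: w_def l)
      have False
      proof (cases "a \<in> Z i")
        case True
        then have lhs: "line i a \<bullet> g = (e i a \<otimes> h, l)"
          using ij less.prems by (simp add: line_Z base_act) (simp add: actS_def g)
        then have "headed i1 w" using hw rhs less.prems False by auto
        then obtain x where x: "x \<in> Z i1" "fst w = e i1 x" by (auto simp: headed_def)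
        then have "e i a \<otimes> h = h \<otimes> e i1 x" using lhs rhs less.prems by simp
        then have "i = i1" "h \<in> C i" using malnormal[OF ij(1) v(1) True x(1) g(2) a(2)] by auto
        then show False using nh by (simp add: headed_def g l)
      next
        case False
        have "prd l = (\<one>, l)" using prd_nf[OF g(3)] .
        then have "headed i1 (prd l)"
          using v by (simp add: headed_def l) (metis Z_one e_one image_eqI)
        then have "headed i (line i a \<bullet> (base h \<bullet> prd l))"
          using nh v ij a g nf_valid[OF g(3)] False
          by (intro headed_step(1)) (auto simp: headed_def g l)
        then have hl: "headed i (h \<otimes> fst w, snd w)" using less.prems(2) rhs by (simp flip: gp)
        then have "headed i1 w" using hw by (auto simp: headed_def)
        then have "i = i1" "fst w \<in> C i" using hl by (auto simp: headed_def starts_def)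
        then have "h \<in> C i" using hl C_mult_iff[OF ij(1), of "fst w" h] g by (simp add: headed_def)
        then show False using nh \<open>i = i1\<close> by (simp add: headed_def g l)
      qed
      then show ?thesis ..
    qed
  qed
qed

lemma line_pow_bounded:
  assumes "i \<in> P" "b \<in> carrier M"
  shows "len (line i b [^]\<^bsub>amalgam\<^esub> (n::nat)) \<le> 1"
  using len_le[OF syllables_line[of i "b [^]\<^bsub>M\<^esub> n"]] assms by (simp add: line_pow)

lemma on_line_not_hyperbolic:
  assumes x: "L.hyperbolic x" and i: "i \<in> P" "b \<in> carrier M" and g: "g \<in> NF"
    and eq: "x \<bullet> g = g \<bullet> line i b"
  shows False
  using L.conj_of_hyperbolic_unbounded[OF x, of g "line i b" 1] line_pow_bounded[OF i] i g eq
  by (auto simp: not_less[symmetric])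

end

locale torsion_free_line_system = line_system S M P Z e
  for S :: "('s, 'k) monoid_scheme" (structure) and M :: "('a, 'm) monoid_scheme"
    and P :: "'i set" and Z :: "'i \<Rightarrow> 'a set" and e :: "'i \<Rightarrow> 'a \<Rightarrow> 's" +
  assumes M_torsion_free: "\<lbrakk>a \<in> carrier M; a [^]\<^bsub>M\<^esub> (n::nat) = \<one>\<^bsub>M\<^esub>; 0 < n\<rbrakk> \<Longrightarrow> a = \<one>\<^bsub>M\<^esub>"
begin

sublocale L: lyndon_length_free_centralizers amalgam len
proof
  fix x and n :: nat
  assume x: "x \<in> carrier amalgam" "x [^]\<^bsub>amalgam\<^esub> n = \<one>\<^bsub>amalgam\<^esub>" "0 < n"
  show "x = \<one>\<^bsub>amalgam\<^esub>"
  proof (rule ccontr)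
    assume "x \<noteq> \<one>\<^bsub>amalgam\<^esub>"
    then consider "on_line x" | "conj_hyperbolic x" using on_line_or_conj_hyperbolic[of x] x by auto
    then show False
    proof cases
      case 1
      then obtain i b g where i: "i \<in> P" "b \<in> carrier M" "g \<in> NF" "x \<bullet> g = g \<bullet> line i b"
        by (auto simp: on_line_def)
      have "x [^]\<^bsub>amalgam\<^esub> n \<bullet> g = g \<bullet> line i (b [^]\<^bsub>M\<^esub> n)"
        using K_intertwine_nat_pow[OF i(4)] x(1) i by (simp add: line_pow)
      then have "g \<bullet> line i (b [^]\<^bsub>M\<^esub> n) = g" using x(2) K_simps(1)[OF i(3)] by metis
      then have "line i (b [^]\<^bsub>M\<^esub> n) = \<one>\<^bsub>amalgam\<^esub>" using K.l_cancel_one i by simp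
      then have "b = \<one>\<^bsub>M\<^esub>" using line_kernel M_torsion_free x i by blast
      then have "x \<bullet> g = g" using i by (simp add: line_one)
      then show False using K.r_cancel_one x i \<open>x \<noteq> \<one>\<^bsub>amalgam\<^esub>\<close> by simp
    next
      case 2
      then obtain y g where y: "L.hyperbolic y" "g \<in> NF" "x \<bullet> g = g \<bullet> y"
        by (auto simp: conj_hyperbolic_def)
      have "x [^]\<^bsub>amalgam\<^esub> n \<bullet> g = g \<bullet> y [^]\<^bsub>amalgam\<^esub> n"
        using K_intertwine_nat_pow[OF y(3)] x(1) y by simp
      then have "g \<bullet> y [^]\<^bsub>amalgam\<^esub> n = g" using x y by simp
      then have "y [^]\<^bsub>amalgam\<^esub> int n = \<one>\<^bsub>amalgam\<^esub>" using K.l_cancel_one y by (simp add: int_pow_int)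
      then show False using L.hyperbolic_pow_neq_one[OF y(1), of "int n"] x by simp
    qed
  qed
next
  fix x y
  assume x: "L.hyperbolic x" and y: "y \<in> carrier amalgam" "x \<bullet> y = y \<bullet> x" "\<not> L.hyperbolic y"
  show "y = \<one>\<^bsub>amalgam\<^esub>"
  proof (rule ccontr)
    assume "y \<noteq> \<one>\<^bsub>amalgam\<^esub>"
    then consider "on_line y" | "conj_hyperbolic y" using on_line_or_conj_hyperbolic[of y] y by auto
    then show False
    proof cases
      case 1
      then obtain i b g where i: "i \<in> P" "b \<in> carrier M" "g \<in> NF" "y \<bullet> g = g \<bullet> line i b"
        by (auto simp: on_line_def)
      have b: "b \<noteq> \<one>\<^bsub>M\<^esub>"
      proof
        assume "b = \<one>\<^bsub>M\<^esub>"
        then have "y \<bullet> g = g" using i by (simp add: line_one)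
        then show False using K.r_cancel_one y i \<open>y \<noteq> \<one>\<^bsub>amalgam\<^esub>\<close> by simp
      qed
      \<comment> \<open>This conjugate of \<open>x\<close> commutes with \<open>line i b\<close>, so
        malnormality puts it on line \<open>i\<close>, where powers are bounded.\<close>
      define x' where "x' = inv\<^bsub>amalgam\<^esub> g \<bullet> (x \<bullet> g)"
      have x': "x' \<in> NF" "x \<bullet> g = g \<bullet> x'" using i x by (auto simp: x'_def)
      have "line i b \<bullet> x' = x' \<bullet> line i b"
      proof -
        have 1: "line i b \<bullet> inv\<^bsub>amalgam\<^esub> g = inv\<^bsub>amalgam\<^esub> g \<bullet> y"
          using K_intertwine_sym[OF i(4)] i y by simp
        have 2: "y \<bullet> (x \<bullet> g) = (x \<bullet> g) \<bullet> line i b"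
          using K_intertwine_trans[OF y(2)[symmetric] i(4)] i x y by simp
        show ?thesis unfolding x'_def using K_intertwine_trans[OF 1 2] i x y by simp
      qed
      then obtain c where "c \<in> carrier M" "x' = line i c"
        using lines_malnormal[OF i(1,1,2) b i(2) x'(1)] by auto
      then show False using on_line_not_hyperbolic[OF x i(1) _ i(3)] x' by blast
    next
      case 2
      then obtain z g where z: "L.hyperbolic z" "g \<in> NF" "y \<bullet> g = g \<bullet> z"
        by (auto simp: conj_hyperbolic_def)
      \<comment> \<open>A conjugate of a hyperbolic element has unbounded powers, whereas those of
        the nonhyperbolic \<open>y\<close> are bounded.\<close>
      have "z \<bullet> inv\<^bsub>amalgam\<^esub> g = inv\<^bsub>amalgam\<^esub> g \<bullet> y" using K_intertwine_sym[OF z(3)] z y by simp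
      then obtain k :: nat where "len (y [^]\<^bsub>amalgam\<^esub> k) > len y"
        using L.conj_of_hyperbolic_unbounded[OF z(1), of "inv\<^bsub>amalgam\<^esub> g" y "len y"] z y by auto
      then show False using L.bounded_if_not_hyperbolic[OF y(1,3), of k] by simp
    qed
  qed
qed

end

section \<open>A free subgroup of the amalgam\<close>

context line_system
begin

text \<open>On lines with trivial \<open>Z i\<close>, letters of different lines never merge, and
  adjacent letters of one line in a reduced word have equal sign, so the exponent of
  \<open>u\<close> only accumulates. The sign is part of the claim in order to exclude
  cancellation.\<close>

lemma word_value_line:
  assumes u: "u \<in> carrier M" "\<And>n::int. u [^]\<^bsub>M\<^esub> n = \<one>\<^bsub>M\<^esub> \<Longrightarrow> n = 0"
    and w: "reduced w" "fst ` set w \<subseteq> {i \<in> P. Z i = {\<one>\<^bsub>M\<^esub>}}" "w \<noteq> []"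
  shows "\<exists>n>0. \<exists>x\<in>tails (fst (hd w)). word_value amalgam (\<lambda>i. line i u) w
      = join (fst (hd w)) (u [^]\<^bsub>M\<^esub> (if snd (hd w) then n else - n :: int)) x"
  using w
proof (induction w)
  case (Cons l w)
  define i where "i = fst l"
  define s :: int where "s = (if snd l then 1 else - 1)"
  have i: "i \<in> P" "Z i = {\<one>\<^bsub>M\<^esub>}" using Cons.prems by (auto simp: i_def)
  define y where "y = word_value amalgam (\<lambda>i. line i u) w"
  have "letter_value amalgam (\<lambda>i. line i u) l = line i (u [^]\<^bsub>M\<^esub> s)"
    using i u(1) by (auto simp: letter_value_def i_def s_def M.int_pow_neg line_inv)
  then have eq: "word_value amalgam (\<lambda>i. line i u) (l # w) = line i (u [^]\<^bsub>M\<^esub> s) \<bullet> y"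
    by (simp add: word_value_def y_def)
  have join1: ?case if "y \<in> tails i"
    using that i u(1) unfolding eq
    by (intro exI[of _ "1::int"]) (auto simp: line_act_join s_def simp flip: i_def)
  show ?case
  proof (cases w)
    case Nil
    then have "y = (\<one>, [])" by (simp add: y_def word_value_def one_amalgam)
    then show ?thesis using join1 one_tails i by simp
  next
    case (Cons m w')
    have m: "fst m \<in> P" "Z (fst m) = {\<one>\<^bsub>M\<^esub>}" "m \<noteq> inv_letter l"
      using Cons.prems Cons by (auto simp: successively_Cons)
    have "\<exists>n>0. \<exists>x\<in>tails (fst m). y = join (fst m) (u [^]\<^bsub>M\<^esub> (if snd m then n else - n :: int)) x"
    proof -
      have *: "reduced w" "fst ` set w \<subseteq> {i \<in> P. Z i = {\<one>\<^bsub>M\<^esub>}}" "w \<noteq> []" "hd w = m"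
        using Cons.prems Cons by (auto simp: successively_Cons)
      show ?thesis using Cons.IH[OF *(1-3)] unfolding y_def *(4) .
    qed
    then obtain n :: int and x where n: "n > 0" "x \<in> tails (fst m)"
      "y = join (fst m) (u [^]\<^bsub>M\<^esub> (if snd m then n else - n)) x" by blast
    define k where "k = (if snd m then n else - n)"
    have yk: "y = join (fst m) (u [^]\<^bsub>M\<^esub> k) x" "k \<noteq> 0" using n by (auto simp: k_def)
    show ?thesis
    proof (cases "fst m = i")
      case True
      then have "snd m = snd l" using m(3) by (cases m; cases l) (auto simp: i_def inv_letter_def)
      then have sk: "s + k = (if snd l then n + 1 else - (n + 1))" by (auto simp: s_def k_def)
      have "line i (u [^]\<^bsub>M\<^esub> s) \<bullet> y = join i (u [^]\<^bsub>M\<^esub> s \<otimes>\<^bsub>M\<^esub> u [^]\<^bsub>M\<^esub> k) x"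
        using i u(1) n(1,2) True yk by (simp add: line_act join_closed actM_join)
      also have "\<dots> = join i (u [^]\<^bsub>M\<^esub> (s + k)) x" using u(1) by (simp add: M.int_pow_mult)
      finally show ?thesis unfolding eq sk using n True
        by (intro exI[of _ "n + 1"]) (auto simp flip: i_def)
    next
      case False
      define a where "a = u [^]\<^bsub>M\<^esub> k"
      have a: "a \<in> carrier M" "a \<notin> Z (fst m)" using u m yk by (auto simp: a_def)
      have "cM (fst m) a \<in> Z (fst m)" using rM_simps(2)[OF m(1) a(1)] .
      then have "e (fst m) (cM (fst m) a) = \<one>" using m by simp
      then have y1: "y = (\<one>, (fst m, rM (fst m) a, fst x) # snd x)"
        using a yk by (simp add: join_def flip: a_def)
      have "y \<in> NF" using yk n m u(1) join_closed by simp
      moreover have "rS i \<one> = \<one>" using i by (simp add: S.coset_rep_def)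
      ultimately have "y \<in> tails i" using False by (auto simp: tails_def NF_def y1)
      then show ?thesis using join1 by simp
    qed
  qed
qed simp

theorem word_value_line_neq_one:
  assumes "u \<in> carrier M" "\<And>n::int. u [^]\<^bsub>M\<^esub> n = \<one>\<^bsub>M\<^esub> \<Longrightarrow> n = 0"
    and "reduced w" "fst ` set w \<subseteq> {i \<in> P. Z i = {\<one>\<^bsub>M\<^esub>}}" "w \<noteq> []"
  shows "word_value amalgam (\<lambda>i. line i u) w \<noteq> \<one>\<^bsub>amalgam\<^esub>"
proof -
  obtain n x where n: "n > 0" "word_value amalgam (\<lambda>i. line i u) w
      = join (fst (hd w)) (u [^]\<^bsub>M\<^esub> (if snd (hd w) then n else - n :: int)) x"
    using word_value_line[OF assms] by blast
  have "fst (hd w) \<in> {i \<in> P. Z i = {\<one>\<^bsub>M\<^esub>}}" using assms(4,5) by (meson hd_in_set image_subset_iff)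
  moreover have "u [^]\<^bsub>M\<^esub> (if snd (hd w) then n else - n :: int) \<noteq> \<one>\<^bsub>M\<^esub>" 
    using assms(2)[of "if snd (hd w) then n else - n"] n(1) by (cases "snd (hd w)") auto
  ultimately show ?thesis using n(2) by (simp add: join_def one_amalgam)
qed

end

context line_action
begin

lemma ev_mult:
  assumes "x \<in> NF" "y \<in> NF" "w \<in> Y"
  shows "ev F H (x \<bullet> y) w = ev F H x (ev F H y w)"
proof -
  have "ev F H (run actS actM l y) w = run F H l (ev F H y w)" if "nf l" for l
    using that
  proof (induction l)
    case (Cons u l)
    obtain i r t where u: "u = (i, r, t)" by (cases u)
    then show ?case using Cons assms by (simp add: ev_actM ev_actS actS_closed self.run_closed)
  qed simp
  moreover have "fst x \<in> carrier S" "nf (snd x)" using assms(1) by (auto simp: NF_def)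
  ultimately have "ev F H (ev actS actM x y) w = ev F H x (ev F H y w)" using assms(2,3)
    by (simp add: ev_def[of actS actM x] ev_actS self.run_closed) (simp add: ev_def)
  then show ?thesis by (simp add: amalgam_def)
qed

end

subsection \<open>New partial lines\<close>

definition (in group) commensurable :: "'a \<Rightarrow> 'a \<Rightarrow> bool" where
  "commensurable c d \<longleftrightarrow> (\<exists>g\<in>carrier G. \<exists>(m::int) (n::int). m \<noteq> 0 \<and> c [^] m \<otimes> g = g \<otimes> d [^] n)"

context group
begin

lemma malnormal_rootD:
  assumes "malnormal_root c"
  shows "c \<in> carrier G" "c [^] (n::int) = \<one> \<Longrightarrow> n = 0"
    "\<lbrakk>g \<in> carrier G; m \<noteq> 0; c [^] (m::int) \<otimes> g = g \<otimes> c [^] n\<rbrakk> \<Longrightarrow> g \<in> powers c"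
  using assms by (auto simp: malnormal_root_def)

lemma commensurable_exponent:
  assumes "malnormal_root c" "d \<in> carrier G" "g \<in> carrier G" "m \<noteq> 0"
    "c [^] (m::int) \<otimes> g = g \<otimes> d [^] (n::int)"
  shows "n \<noteq> 0"
proof
  assume "n = 0"
  then have "c [^] m \<otimes> g = g" using assms by simp
  then have "c [^] m = \<one>" using malnormal_rootD[OF assms(1)] assms(3) r_cancel_one by blast
  then show False using malnormal_rootD(2)[OF assms(1)] assms(4) by blast
qed

lemma commensurable_refl: "c \<in> carrier G \<Longrightarrow> commensurable c c"
  unfolding commensurable_def by (intro bexI[of _ \<one>] exI[of _ "1::int"]) auto

lemma commensurable_sym:
  assumes "malnormal_root c" "d \<in> carrier G" "commensurable c d"
  shows "commensurable d c"
proof -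
  obtain g and m n :: int where g: "g \<in> carrier G" "m \<noteq> 0" "c [^] m \<otimes> g = g \<otimes> d [^] n"
    using assms(3) by (auto simp: commensurable_def)
  have "n \<noteq> 0" using commensurable_exponent[OF assms(1,2) g] .
  moreover have "d [^] n \<otimes> inv g = inv g \<otimes> c [^] m"
    using intertwine_sym[OF g(3)] malnormal_rootD(1)[OF assms(1)] assms(2) g(1) by simp
  ultimately show ?thesis using g(1) unfolding commensurable_def by (intro bexI[of _ "inv g"]) auto
qed

lemma commensurable_trans:
  assumes "malnormal_root c" "malnormal_root d" "f \<in> carrier G" "commensurable c d" "commensurable d f"
  shows "commensurable c f"
proof -
  have cd: "c \<in> carrier G" "d \<in> carrier G" using malnormal_rootD(1) assms by auto
  obtain g and m n :: int where g: "g \<in> carrier G" "m \<noteq> 0" "c [^] m \<otimes> g = g \<otimes> d [^] n"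
    using assms(4) by (auto simp: commensurable_def)
  obtain h and p q :: int where h: "h \<in> carrier G" "p \<noteq> 0" "d [^] p \<otimes> h = h \<otimes> f [^] q"
    using assms(5) by (auto simp: commensurable_def)
  have "c [^] (m * p) \<otimes> g = g \<otimes> d [^] (n * p)"
    using intertwine_int_pow[OF g(3), of p] cd g(1) by (simp add: int_pow_pow)
  moreover have "d [^] (n * p) \<otimes> h = h \<otimes> f [^] (q * n)"
    using intertwine_int_pow[OF h(3), of n] cd h(1) assms(3) by (simp add: int_pow_pow mult.commute)
  ultimately have "c [^] (m * p) \<otimes> (g \<otimes> h) = (g \<otimes> h) \<otimes> f [^] (q * n)"
    using intertwine_trans[of "c [^] (m * p)" g "d [^] (n * p)" h "f [^] (q * n)"] cd g(1) h(1) assms(3) by simp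
  then show ?thesis using g h unfolding commensurable_def
    by (intro bexI[of _ "g \<otimes> h"] exI[of _ "m * p"] exI[of _ "q * n"]) auto
qed

text \<open>The conjugate \<open>inv g \<otimes> (c \<otimes> g)\<close> commutes with a nonzero
  power of \<open>d\<close>, so malnormality puts it into the powers of \<open>d\<close>. Hence the
  partial line of one root covers all roots commensurable to it.\<close>

lemma commensurable_root:
  assumes "malnormal_root c" "malnormal_root d" "commensurable c d"
  shows "\<exists>g\<in>carrier G. \<exists>p::int. c \<otimes> g = g \<otimes> d [^] p"
proof -
  have cd: "c \<in> carrier G" "d \<in> carrier G" using malnormal_rootD(1) assms by auto
  obtain g and m n :: int where g: "g \<in> carrier G" "m \<noteq> 0" "c [^] m \<otimes> g = g \<otimes> d [^] n"
    using assms(3) by (auto simp: commensurable_def)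
  have n: "n \<noteq> 0" using commensurable_exponent[OF assms(1) cd(2) g] .
  define c' where "c' = inv g \<otimes> (c \<otimes> g)"
  have c': "c' \<in> carrier G" "c \<otimes> g = g \<otimes> c'" using cd g by (simp_all add: c'_def)
  have 1: "d [^] n \<otimes> inv g = inv g \<otimes> c [^] m" using intertwine_sym[OF g(3)] cd g(1) by simp
  have 2: "c [^] m \<otimes> (c \<otimes> g) = (c \<otimes> g) \<otimes> d [^] n"
  proof -
    have "c [^] m \<otimes> c = c \<otimes> c [^] m" using intertwine_int_pow[of c c c m] cd by simp
    then show ?thesis using intertwine_trans[of "c [^] m" c "c [^] m" g "d [^] n"] g cd by simp
  qed
  have "d [^] n \<otimes> c' = c' \<otimes> d [^] n"
    unfolding c'_def using intertwine_trans[OF 1 2] cd g by simp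
  then have "c' \<in> powers d" using malnormal_rootD(3)[OF assms(2) c'(1) n] by blast
  then show ?thesis using c'(2) g(1) by (auto simp: powers_def)
qed

definition exponent_of :: "'a \<Rightarrow> 'a \<Rightarrow> int" where
  "exponent_of u z = (THE n. u [^] n = z)"

lemma exponent_of_pow:
  assumes "u \<in> carrier G" "\<And>n::int. u [^] n = \<one> \<Longrightarrow> n = 0"
  shows "exponent_of u (u [^] (n::int)) = n"
  unfolding exponent_of_def
proof (rule the_equality)
  fix m :: int assume "u [^] m = u [^] n"
  then have "u [^] (m - n) = \<one>" using assms(1) by (simp add: int_pow_diff)
  then show "m = n" using assms(2)[of "m - n"] by simp
qed simp

lemma powers_subgroup: "u \<in> carrier G \<Longrightarrow> subgroup (powers u) G"
proof (rule subgroupI)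
  assume u: "u \<in> carrier G"
  show "powers u \<subseteq> carrier G" using u by (auto simp: powers_def)
  show "powers u \<noteq> {}" by (auto simp: powers_def)
  show "inv x \<in> powers u" if "x \<in> powers u" for x
    using that u by (auto simp: powers_def int_pow_neg[symmetric])
  show "x \<otimes> y \<in> powers u" if "x \<in> powers u" "y \<in> powers u" for x y
    using that u by (auto simp: powers_def int_pow_mult[symmetric])
qed

end

context torsion_free_line_system
begin

text \<open>Hyperbolicity is asked of some power, since a root is obtained from a hyperbolic element
  that is one of its powers.\<close>

definition hyperbolic_root :: "'s \<times> ('i \<times> 'a \<times> 's) list \<Rightarrow> bool" where
  "hyperbolic_root c \<longleftrightarrow> K.malnormal_root c \<and> (\<exists>l::int. l \<noteq> 0 \<and> L.hyperbolic (c [^]\<^bsub>amalgam\<^esub> l))"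

lemma hyperbolic_root_pow_not_on_line:
  assumes c: "hyperbolic_root c" and n: "n \<noteq> 0" and ib: "i \<in> P" "b \<in> carrier M" and g: "g \<in> NF"
    and eq: "c [^]\<^bsub>amalgam\<^esub> (n::int) \<bullet> g = g \<bullet> line i b"
  shows False
proof -
  obtain l :: int where l: "l \<noteq> 0" "L.hyperbolic (c [^]\<^bsub>amalgam\<^esub> l)" using c by (auto simp: hyperbolic_root_def)
  have cc: "c \<in> NF" using c K.malnormal_rootD(1) by (auto simp: hyperbolic_root_def)
  define k where "k = nat \<bar>l\<bar>"
  have k: "k \<noteq> 0" "L.hyperbolic (c [^]\<^bsub>amalgam\<^esub> int k)"
  proof -
    show "k \<noteq> 0" using l by (simp add: k_def)
    have "int k = l \<or> int k = l * (- 1)" by (auto simp: k_def)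
    then show "L.hyperbolic (c [^]\<^bsub>amalgam\<^esub> int k)"
      using l L.hyperbolic_int_pow[OF l(2), of "- 1"] cc by (auto simp: K.int_pow_pow)
  qed
  have "L.hyperbolic (c [^]\<^bsub>amalgam\<^esub> (int k * n))"
    using L.hyperbolic_int_pow[OF k(2) n] cc by (simp add: K.int_pow_pow)
  moreover have "c [^]\<^bsub>amalgam\<^esub> (n * int k) \<bullet> g = g \<bullet> line i (b [^]\<^bsub>M\<^esub> k)"
  proof -
    have "(c [^]\<^bsub>amalgam\<^esub> n) [^]\<^bsub>amalgam\<^esub> int k = c [^]\<^bsub>amalgam\<^esub> (n * int k)"
      using cc by (intro K.int_pow_pow) simp
    moreover have "line i b [^]\<^bsub>amalgam\<^esub> int k = line i (b [^]\<^bsub>M\<^esub> k)"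
      using ib by (simp only: int_pow_int line_pow)
    moreover have "(c [^]\<^bsub>amalgam\<^esub> n) [^]\<^bsub>amalgam\<^esub> int k \<bullet> g = g \<bullet> line i b [^]\<^bsub>amalgam\<^esub> int k"
      using cc g ib by (intro K.intertwine_int_pow[OF eq]) auto
    ultimately show ?thesis by simp
  qed
  ultimately show False
    using on_line_not_hyperbolic[of "c [^]\<^bsub>amalgam\<^esub> (int k * n)" i "b [^]\<^bsub>M\<^esub> k" g] ib g
    by (simp add: mult.commute)
qed

text \<open>One root per commensurability class is taken, because two commensurable roots would give
  distinct lines with conjugate nontrivial elements.\<close>

lemma representatives:
  obtains B where "\<forall>c\<in>B. hyperbolic_root c"
    "\<forall>c. hyperbolic_root c \<longrightarrow> (\<exists>d\<in>B. K.commensurable c d)"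
    "\<forall>c\<in>B. \<forall>d\<in>B. K.commensurable c d \<longrightarrow> c = d"
proof -
  have hr: "K.malnormal_root c" "c \<in> carrier amalgam" if "hyperbolic_root c" for c
    using that K.malnormal_rootD(1) by (auto simp: hyperbolic_root_def)
  have refl: "K.commensurable c c" if "hyperbolic_root c" for c
    using hr[OF that] K.commensurable_refl by blast
  have sym: "K.commensurable d c" if "hyperbolic_root c" "hyperbolic_root d" "K.commensurable c d" for c d
    using hr[OF that(1)] hr[OF that(2)] that(3) K.commensurable_sym by blast
  have trans: "K.commensurable c f"
    if "hyperbolic_root c" "hyperbolic_root d" "hyperbolic_root f" "K.commensurable c d" "K.commensurable d f" for c d f
    using hr[OF that(1)] hr[OF that(2)] hr[OF that(3)] that(4,5) K.commensurable_trans by blast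
  define rep where "rep c = (SOME d. hyperbolic_root d \<and> K.commensurable c d)" for c
  have rep: "hyperbolic_root (rep c)" "K.commensurable c (rep c)" if "hyperbolic_root c" for c
    unfolding rep_def using someI[of "\<lambda>d. hyperbolic_root d \<and> K.commensurable c d" c] that refl by blast+
  have "rep c = rep d" if cd: "hyperbolic_root c" "hyperbolic_root d" "K.commensurable (rep c) (rep d)" for c d
  proof -
    have "K.commensurable c d"
      using cd rep[OF cd(1)] rep[OF cd(2)] sym[of d "rep d"] trans[of c "rep c" "rep d"] trans[of c "rep d" d] by blast
    then have "K.commensurable c f \<longleftrightarrow> K.commensurable d f" if "hyperbolic_root f" for f
      using cd that sym[of c d] trans[of c d f] trans[of d c f] by blast
    then have "(\<lambda>f. hyperbolic_root f \<and> K.commensurable c f) = (\<lambda>f. hyperbolic_root f \<and> K.commensurable d f)" by auto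
    then show ?thesis by (simp add: rep_def)
  qed
  then have inj: "\<forall>c\<in>rep ` Collect hyperbolic_root. \<forall>d\<in>rep ` Collect hyperbolic_root.
      K.commensurable c d \<longrightarrow> c = d" by blast
  show thesis
  proof (rule that[OF _ _ inj])
    show "\<forall>c\<in>rep ` Collect hyperbolic_root. hyperbolic_root c" using rep(1) by blast
    show "\<forall>c. hyperbolic_root c \<longrightarrow> (\<exists>d\<in>rep ` Collect hyperbolic_root. K.commensurable c d)"
      using rep(2) by blast
  qed
qed

text \<open>The old lines become full, and each chosen root \<open>c\<close> gives a cyclic partial
  line on which \<open>u\<close> stands for \<open>c\<close>. Old and new lines have no conjugate
  nontrivial elements, since powers are bounded on the former and unbounded on the latter.\<close>

theorem extended_line_system:
  assumes u: "u \<in> carrier M" "\<And>n::int. u [^]\<^bsub>M\<^esub> n = \<one>\<^bsub>M\<^esub> \<Longrightarrow> n = 0"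
  shows "\<exists>B \<subseteq> NF. line_system amalgam M (Inl ` P \<union> Inr ` B)
    (case_sum (\<lambda>i. carrier M) (\<lambda>c. M.powers u))
    (case_sum line (\<lambda>c z. c [^]\<^bsub>amalgam\<^esub> M.exponent_of u z))"
proof -
  obtain B where B: "\<forall>c\<in>B. hyperbolic_root c"
    "\<forall>c. hyperbolic_root c \<longrightarrow> (\<exists>d\<in>B. K.commensurable c d)"
    "\<forall>c\<in>B. \<forall>d\<in>B. K.commensurable c d \<longrightarrow> c = d"
    using representatives .
  note B = B[rule_format]
  have mr: "K.malnormal_root c" if "c \<in> B" for c using B(1)[OF that] by (simp add: hyperbolic_root_def)
  have BN: "c \<in> NF" if "c \<in> B" for c using K.malnormal_rootD(1)[OF mr[OF that]] by simp
  note exp_u = M.exponent_of_pow[OF u]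
  have u_eq: "u [^]\<^bsub>M\<^esub> n = \<one>\<^bsub>M\<^esub> \<longleftrightarrow> n = 0" for n :: int using u by auto
  have "line_system amalgam M (Inl ` P \<union> Inr ` B)
    (case_sum (\<lambda>i. carrier M) (\<lambda>c. M.powers u))
    (case_sum line (\<lambda>c z. c [^]\<^bsub>amalgam\<^esub> M.exponent_of u z))"
  proof (rule line_system.intro[OF K.group_axioms M.comm_group_axioms line_system_axioms.intro], goal_cases)
    case (1 i)
    then show ?case using M.powers_subgroup[OF u(1)] M.subgroup_self by (elim UnE imageE) simp_all
  next
    case (2 i z)
    then show ?case using BN by auto
  next
    case (3 i z w)
    then show ?case
      using BN exp_u u by (auto simp: line_mult M.powers_def K.int_pow_mult simp flip: M.int_pow_mult)
  next
    case (4 i z)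
    from 4(1) show ?case
    proof
      assume "i \<in> Inl ` P"
      then show ?thesis using 4 line_kernel by auto
    next
      assume "i \<in> Inr ` B"
      then obtain c where c: "c \<in> B" "i = Inr c" by blast
      then obtain n :: int where n: "z = u [^]\<^bsub>M\<^esub> n" using 4(2) by (auto simp: M.powers_def)
      then have "n = 0" using 4(3) c exp_u K.malnormal_rootD(2)[OF mr[OF c(1)], of n] by simp
      then show ?thesis using n by simp
    qed
  next
    case (5 i j z w g)
    then have g: "g \<in> NF" by simp
    from 5(1,2) consider (ll) i' j' where "i' \<in> P" "j' \<in> P" "i = Inl i'" "j = Inl j'"
      | (lr) i' c where "i' \<in> P" "c \<in> B" "i = Inl i'" "j = Inr c"
      | (rl) c j' where "c \<in> B" "j' \<in> P" "i = Inr c" "j = Inl j'"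
      | (rr) c d where "c \<in> B" "d \<in> B" "i = Inr c" "j = Inr d" by auto
    then show ?case
    proof cases
      case ll
      then show ?thesis using lines_malnormal[of i' j' z w g] 5 by auto
    next
      case lr
      obtain n :: int where n: "w = u [^]\<^bsub>M\<^esub> n" using 5(4) lr by (auto simp: M.powers_def)
      have eq: "line i' z \<bullet> g = g \<bullet> c [^]\<^bsub>amalgam\<^esub> n" using 5 lr exp_u n by simp
      have z: "z \<in> carrier M" using 5 lr by simp
      have "c [^]\<^bsub>amalgam\<^esub> n \<bullet> inv\<^bsub>amalgam\<^esub> g = inv\<^bsub>amalgam\<^esub> g \<bullet> line i' z"
        using K_intertwine_sym[OF eq] g z lr BN by simp
      moreover have "n \<noteq> 0"
      proof
        assume "n = 0"
        then have "line i' z = \<one>\<^bsub>amalgam\<^esub>" using eq K.r_cancel_one[of g] g z lr by simp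
        then show False using line_kernel lr z 5(6) by blast
      qed
      ultimately have False using hyperbolic_root_pow_not_on_line[OF B(1)[OF lr(2)] _ lr(1) z, of n "inv\<^bsub>amalgam\<^esub> g"] g by simp
      then show ?thesis ..
    next
      case rl
      obtain n :: int where n: "z = u [^]\<^bsub>M\<^esub> n" using 5(3) rl by (auto simp: M.powers_def)
      then have n0: "n \<noteq> 0" using 5(6) u_eq by auto
      have "c [^]\<^bsub>amalgam\<^esub> n \<bullet> g = g \<bullet> line j' w" "w \<in> carrier M" using 5 rl exp_u n by auto
      then have False using hyperbolic_root_pow_not_on_line[OF B(1)[OF rl(1)] n0 rl(2) _ g, of w] by blast
      then show ?thesis ..
    next
      case rr
      obtain n :: int where n: "z = u [^]\<^bsub>M\<^esub> n" using 5(3) rr by (auto simp: M.powers_def)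
      then have n0: "n \<noteq> 0" using 5(6) u_eq by auto
      obtain k :: int where k: "w = u [^]\<^bsub>M\<^esub> k" using 5(4) rr by (auto simp: M.powers_def)
      have eq: "c [^]\<^bsub>amalgam\<^esub> n \<bullet> g = g \<bullet> d [^]\<^bsub>amalgam\<^esub> k" using 5 rr exp_u n k by simp
      then have "K.commensurable c d" using n0 g by (auto simp: K.commensurable_def)
      then have cd: "c = d" using B(3) rr by blast
      then have "g \<in> K.powers c" using K.malnormal_rootD(3)[OF mr[OF rr(1)] _ n0, of g k] g eq by simp
      then obtain p :: int where "g = c [^]\<^bsub>amalgam\<^esub> p" by (auto simp: K.powers_def)
      then have "g = c [^]\<^bsub>amalgam\<^esub> M.exponent_of u (u [^]\<^bsub>M\<^esub> p)" using exp_u by simp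
      then show ?thesis using cd rr by auto
    qed
  next
    case (6 h)
    then consider "on_line h" | "conj_hyperbolic h" using on_line_or_conj_hyperbolic[of h] by auto
    then show ?case
    proof cases
      case 1
      then show ?thesis unfolding on_line_def by force
    next
      case 2
      then obtain y g where y: "L.hyperbolic y" "g \<in> NF" "h \<bullet> g = g \<bullet> y" by (auto simp: conj_hyperbolic_def)
      obtain c and l :: int where c: "K.malnormal_root c" "l \<noteq> 0" "y = c [^]\<^bsub>amalgam\<^esub> l"
        using L.hyperbolic_has_root[OF y(1)] by blast
      then have "hyperbolic_root c" using y by (auto simp: hyperbolic_root_def)
      then obtain d where d: "d \<in> B" "K.commensurable c d" using B(2) by blast
      obtain k and p :: int where k: "k \<in> NF" "c \<bullet> k = k \<bullet> d [^]\<^bsub>amalgam\<^esub> p"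
        using K.commensurable_root[OF c(1) mr[OF d(1)] d(2)] by auto
      have cc: "c \<in> NF" using K.malnormal_rootD(1)[OF c(1)] by simp
      have "y \<bullet> k = k \<bullet> d [^]\<^bsub>amalgam\<^esub> (p * l)"
        using K.intertwine_int_pow[OF k(2), of l] cc BN[OF d(1)] k(1) by (simp add: c(3) K.int_pow_pow)
      then have "h \<bullet> (g \<bullet> k) = (g \<bullet> k) \<bullet> d [^]\<^bsub>amalgam\<^esub> (p * l)"
        using K_intertwine_trans[OF y(3)] y 6 k BN[OF d(1)] by simp
      then have "h \<bullet> (g \<bullet> k) = (g \<bullet> k) \<bullet> d [^]\<^bsub>amalgam\<^esub> M.exponent_of u (u [^]\<^bsub>M\<^esub> (p * l))"
        using exp_u by simp
      moreover have "g \<bullet> k \<in> carrier amalgam" using y k by simp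
      moreover have "u [^]\<^bsub>M\<^esub> (p * l) \<in> M.powers u" by blast
      ultimately show ?thesis using d(1)
        by (intro bexI[of _ "Inr d"] bexI[of _ "u [^]\<^bsub>M\<^esub> (p * l)"] bexI[of _ "g \<bullet> k"]) auto
    qed
  qed
  then show ?thesis using BN by blast
qed

end

section \<open>The tower of amalgams\<close>

text \<open>All stages of the tower have to be of one type before their union can be formed.\<close>

definition transport :: "('k \<Rightarrow> 'u) \<Rightarrow> ('k, 'm) monoid_scheme \<Rightarrow> 'u monoid" where
  "transport f K = \<lparr>carrier = f ` carrier K,
     monoid.mult = \<lambda>u v. f (inv_into (carrier K) f u \<otimes>\<^bsub>K\<^esub> inv_into (carrier K) f v), one = f \<one>\<^bsub>K\<^esub>\<rparr>"

lemma (in group_hom) word_value_hom_image: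
  assumes "f \<in> X \<rightarrow> carrier G" "fst ` set w \<subseteq> X"
  shows "word_value H (\<lambda>x. h (f x)) w = h (word_value G f w)"
  using assms(2)
proof (induction w)
  case (Cons l w)
  have "f (fst l) \<in> carrier G" "word_value G f w \<in> carrier G" "letter_value G f l \<in> carrier G"
    using Cons.prems assms(1) G.word_value_closed[OF assms(1), of w] G.letter_value_closed[OF assms(1), of l] by auto
  then show ?case using Cons by (auto simp: word_value_def letter_value_def)
qed (simp add: word_value_def)

context
  fixes K :: "('k, 'm) monoid_scheme" and f :: "'k \<Rightarrow> 'u"
  assumes K: "group K" and f: "inj_on f (carrier K)"
begin

interpretation K: group K by (rule K)

lemma transport_simps [simp]:
  "carrier (transport f K) = f ` carrier K" "\<one>\<^bsub>transport f K\<^esub> = f \<one>\<^bsub>K\<^esub>"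
  "\<lbrakk>x \<in> carrier K; y \<in> carrier K\<rbrakk> \<Longrightarrow> f x \<otimes>\<^bsub>transport f K\<^esub> f y = f (x \<otimes>\<^bsub>K\<^esub> y)"
  using f by (auto simp: transport_def)

lemma transport_group: "group (transport f K)"
proof (rule groupI)
  fix x assume "x \<in> carrier (transport f K)"
  then obtain a where a: "a \<in> carrier K" "x = f a" by auto
  then have "f (inv\<^bsub>K\<^esub> a) \<otimes>\<^bsub>transport f K\<^esub> x = \<one>\<^bsub>transport f K\<^esub>" by simp
  then show "\<exists>y\<in>carrier (transport f K). y \<otimes>\<^bsub>transport f K\<^esub> x = \<one>\<^bsub>transport f K\<^esub>"
    using a by (intro bexI[of _ "f (inv\<^bsub>K\<^esub> a)"]) auto
qed (auto simp: K.m_assoc)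

lemma transport_hom: "group_hom K (transport f K) f"
  using transport_group by (auto simp: group_hom_def group_hom_axioms_def hom_def K)

end

lemma line_system_transport:
  assumes sys: "line_system K M P Z e" and f: "inj_on f (carrier K)" and g: "inj_on g P"
  shows "line_system (transport f K) M (g ` P) (\<lambda>i. Z (inv_into P g i)) (\<lambda>i z. f (e (inv_into P g i) z))"
proof -
  interpret line_system K M P Z e by (rule sys)
  note ts = transport_simps[OF S.group_axioms f]
  note gi = inv_into_f_f[OF g]
  have inj: "f x = f y \<longleftrightarrow> x = y" if "x \<in> carrier K" "y \<in> carrier K" for x y
    using f that by (auto dest: inj_onD)
  show ?thesis
  proof (rule line_system.intro[OF transport_group[OF S.group_axioms f] M.comm_group_axioms
        line_system_axioms.intro], goal_cases)
    case (5 i j z w h)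
    then obtain i' j' h' where i: "i' \<in> P" "i = g i'" "j' \<in> P" "j = g j'" "h' \<in> carrier K" "h = f h'"
      by (auto simp: ts)
    have zw: "z \<in> Z i'" "w \<in> Z j'" using 5 i by (simp_all add: gi)
    then have "f (e i' z \<otimes>\<^bsub>K\<^esub> h') = f (h' \<otimes>\<^bsub>K\<^esub> e j' w)" using 5(7) i by (simp add: gi ts e_closed)
    then have "e i' z \<otimes>\<^bsub>K\<^esub> h' = h' \<otimes>\<^bsub>K\<^esub> e j' w" using i zw by (simp add: inj e_closed)
    then have "i' = j'" "h' \<in> e i' ` Z i'" using malnormal[of i' j' z w h'] i zw 5 by auto
    then show ?case using i by (auto simp: gi)
  next
    case (6 h)
    then obtain h' where h: "h' \<in> carrier K" "h = f h'" "h' \<noteq> \<one>\<^bsub>K\<^esub>" by (auto simp: ts)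
    then obtain i z k where "i \<in> P" "z \<in> Z i" "k \<in> carrier K" "h' \<otimes>\<^bsub>K\<^esub> k = k \<otimes>\<^bsub>K\<^esub> e i z"
      using cover by blast
    then show ?case using h
      by (intro bexI[of _ "g i"] bexI[of _ z] bexI[of _ "f k"]) (auto simp: gi ts e_closed)
  qed (auto simp: gi ts e_closed e_mult Z_subgroup inj e_kernel)
qed

text \<open>
  Names for the elements and for the indices of the lines of all groups in the tower.
  \<open>Node n g l\<close> is the normal form \<open>(g, l)\<close> in the amalgam over the \<open>n\<close>-th group if \<open>l\<close> is
  nonempty, and the index of the line through \<open>g\<close> if \<open>l\<close> is empty.
\<close>

datatype ('x, 'a) name =
    Atom 'x
  | Trivial
  | Node nat "('x, 'a) name" "(('x, 'a) name \<times> 'a \<times> ('x, 'a) name) list"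

primrec level :: "('x, 'a) name \<Rightarrow> nat" where
  "level (Atom x) = 0"
| "level Trivial = 0"
| "level (Node n g l) = Suc n"

text \<open>The homomorphisms from all stages to \<open>G\<close>, defined at once on names and
  hence compatible with the inclusions. A line index \<open>Node n g []\<close> gets the value of
  \<open>g\<close>.\<close>

primrec name_value :: "('a, 'g, 'k) exp_group_scheme \<Rightarrow> ('g, 'a) name \<Rightarrow> 'g" where
  "name_value G (Atom x) = x"
| "name_value G Trivial = \<one>\<^bsub>G\<^esub>"
| "name_value G (Node n g l) = name_value G g \<otimes>\<^bsub>G\<^esub>
     foldr (\<lambda>(a, \<alpha>, b) y. a \<up>\<^bsub>G\<^esub> \<alpha> \<otimes>\<^bsub>G\<^esub> (b \<otimes>\<^bsub>G\<^esub> y))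
       (map (map_prod (name_value G) (map_prod id (name_value G))) l) \<one>\<^bsub>G\<^esub>"

text \<open>Elements of the base keep their names, so each stage is literally contained in the next;
  the number in \<open>Node\<close> keeps new names apart from old ones.\<close>

definition pack :: "nat \<Rightarrow> ('x, 'a) name \<times> (('x, 'a) name \<times> 'a \<times> ('x, 'a) name) list \<Rightarrow> ('x, 'a) name" where
  "pack n x = (if snd x = [] then fst x else Node n (fst x) (snd x))"

type_synonym ('x, 'a) stage_data =
  "('x, 'a) name monoid \<times> ('x, 'a) name set \<times>
    (('x, 'a) name \<Rightarrow> 'a set) \<times> (('x, 'a) name \<Rightarrow> 'a \<Rightarrow> ('x, 'a) name)"

locale exp_group_tower = exp_group R G
  for R :: "('a, 'm) ring_scheme" and G :: "('a, 'g, 'k) exp_group_scheme" +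
  fixes X :: "'g set"
  assumes X: "X \<subseteq> carrier G" and char_zero: "characteristic_zero R"
    and add_torsion_free: "torsion_free (add_monoid R)"
begin

abbreviation M where "M \<equiv> add_monoid R"
abbreviation \<phi> where "\<phi> \<equiv> name_value G"

lemma M_comm_group: "comm_group M"
  by (rule R.a_comm_group)

lemma M_group: "group M"
  using M_comm_group by (simp add: comm_group_def)

lemma M_torsion_free: "\<lbrakk>a \<in> carrier M; a [^]\<^bsub>M\<^esub> (n::nat) = \<one>\<^bsub>M\<^esub>; 0 < n\<rbrakk> \<Longrightarrow> a = \<one>\<^bsub>M\<^esub>"
  using add_torsion_free unfolding torsion_free_def by blast

lemma one_infinite_order:
  assumes "\<one>\<^bsub>R\<^esub> [^]\<^bsub>M\<^esub> (n::int) = \<one>\<^bsub>M\<^esub>"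
  shows "n = 0"
proof -
  have *: "\<one>\<^bsub>R\<^esub> [^]\<^bsub>M\<^esub> (k::nat) = \<one>\<^bsub>M\<^esub> \<Longrightarrow> k = 0" for k
    using char_zero by (auto simp: characteristic_zero_def add_pow_def)
  show ?thesis
  proof (cases n rule: int_cases2)
    case (nonneg k)
    then show ?thesis using * assms by (simp add: int_pow_int)
  next
    case (nonpos k)
    have "\<one>\<^bsub>R\<^esub> [^]\<^bsub>M\<^esub> int k = \<one>\<^bsub>M\<^esub>"
      using assms nonpos group.int_pow_neg[OF M_group, of "\<one>\<^bsub>R\<^esub>" n] by (simp del: group.inv_eq_1_iff)
    then show ?thesis using * nonpos by (simp add: int_pow_int)
  qed
qed

lemma expo_pow:
  assumes g: "g \<in> carrier G"
  shows "g \<up>\<^bsub>G\<^esub> (\<one>\<^bsub>R\<^esub> [^]\<^bsub>M\<^esub> (n::int)) = g [^]\<^bsub>G\<^esub> n"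
proof -
  have nat: "g \<up>\<^bsub>G\<^esub> (\<one>\<^bsub>R\<^esub> [^]\<^bsub>M\<^esub> (k::nat)) = g [^]\<^bsub>G\<^esub> k" for k
  proof (induction k)
    case (Suc k)
    have "\<one>\<^bsub>R\<^esub> [^]\<^bsub>M\<^esub> k \<in> carrier R" using monoid.nat_pow_closed[OF group.is_monoid[OF M_group], of "\<one>\<^bsub>R\<^esub>" k] by simp
    then show ?case using Suc g expo_add[of g "\<one>\<^bsub>R\<^esub> [^]\<^bsub>M\<^esub> k" "\<one>\<^bsub>R\<^esub>"] by (simp add: expo_ring_one)
  qed (use g in \<open>simp add: expo_ring_zero\<close>)
  show ?thesis
  proof (cases n rule: int_cases2)
    case (nonpos k)
    define a where "a = \<one>\<^bsub>R\<^esub> [^]\<^bsub>M\<^esub> k"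
    have a: "a \<in> carrier R" using monoid.nat_pow_closed[OF group.is_monoid[OF M_group], of "\<one>\<^bsub>R\<^esub>" k] by (simp add: a_def)
    have "\<one>\<^bsub>R\<^esub> [^]\<^bsub>M\<^esub> n = \<ominus>\<^bsub>R\<^esub> a"
      using group.int_pow_neg_int[OF M_group, of "\<one>\<^bsub>R\<^esub>" k] nonpos by (simp add: a_def a_inv_def)
    moreover have "g \<up>\<^bsub>G\<^esub> (\<ominus>\<^bsub>R\<^esub> a) \<otimes>\<^bsub>G\<^esub> g \<up>\<^bsub>G\<^esub> a = \<one>\<^bsub>G\<^esub>"
      using expo_add[of g "\<ominus>\<^bsub>R\<^esub> a" a] a g by (simp add: R.l_neg expo_ring_zero)
    then have "g \<up>\<^bsub>G\<^esub> (\<ominus>\<^bsub>R\<^esub> a) = inv\<^bsub>G\<^esub> (g \<up>\<^bsub>G\<^esub> a)"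
      using a g by (intro G.inv_equality[symmetric]) (simp_all add: expo_closed)
    ultimately show ?thesis using nat[of k] nonpos g by (simp add: a_def G.int_pow_neg_int)
  qed (simp add: int_pow_int nat)
qed

text \<open>The bounds on levels guarantee fresh names for the next stage. The last condition makes
  the coordinate on a line an exponent of the value of its index.\<close>

definition stage :: "nat \<Rightarrow> ('g, 'a) stage_data \<Rightarrow> bool" where
  "stage n = (\<lambda>(S, P, Z, e). line_system S M P Z e \<and>
     (\<forall>u\<in>carrier S. level u \<le> n) \<and> (\<forall>i\<in>P. level i \<le> n) \<and>
     \<phi> \<in> hom S G \<and> (\<forall>i\<in>P. \<phi> i \<in> carrier G) \<and> (\<forall>i\<in>P. \<forall>z\<in>Z i. \<phi> (e i z) = \<phi> i \<up>\<^bsub>G\<^esub> z))"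

text \<open>The clause on words is aimed at the first step, in which the partial lines of the atoms
  are trivial: there it says that the elements with coordinate 1 on these lines are free.\<close>

definition extends :: "('g, 'a) stage_data \<Rightarrow> ('g, 'a) stage_data \<Rightarrow> bool" where
  "extends = (\<lambda>(S, P, Z, e) (S', P', Z', e'). carrier S \<subseteq> carrier S' \<and>
     (\<forall>x\<in>carrier S. \<forall>y\<in>carrier S. x \<otimes>\<^bsub>S'\<^esub> y = x \<otimes>\<^bsub>S\<^esub> y) \<and> P \<subseteq> P' \<and>
     (\<forall>i\<in>P. Z' i = carrier R \<and> (\<forall>z\<in>Z i. e' i z = e i z)) \<and>
     (\<forall>w. reduced w \<longrightarrow> fst ` set w \<subseteq> {i \<in> P. Z i = {\<zero>\<^bsub>R\<^esub>}} \<longrightarrow> w \<noteq> [] \<longrightarrow>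
        word_value S' (\<lambda>i. e' i \<one>\<^bsub>R\<^esub>) w \<noteq> \<one>\<^bsub>S'\<^esub>))"

theorem stage_Suc:
  assumes st: "stage n T"
  shows "\<exists>T'. stage (Suc n) T' \<and> extends T T'"
proof -
  obtain S P Z e where T: "T = (S, P, Z, e)" by (cases T)
  have sys: "line_system S M P Z e" and lS: "\<And>u. u \<in> carrier S \<Longrightarrow> level u \<le> n"
    and lP: "\<And>i. i \<in> P \<Longrightarrow> level i \<le> n" and hom: "\<phi> \<in> hom S G"
    and \<phi>P: "\<And>i. i \<in> P \<Longrightarrow> \<phi> i \<in> carrier G"
    and \<phi>e: "\<And>i z. \<lbrakk>i \<in> P; z \<in> Z i\<rbrakk> \<Longrightarrow> \<phi> (e i z) = \<phi> i \<up>\<^bsub>G\<^esub> z"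
    using st by (auto simp: stage_def T)
  interpret torsion_free_line_system S M P Z e
    using sys M_torsion_free by (auto simp: torsion_free_line_system_def torsion_free_line_system_axioms_def)
  have \<phi>S: "\<phi> s \<in> carrier G" if "s \<in> carrier S" for s using hom that by (auto simp: hom_def)
  have \<phi>mult: "\<phi> (s \<otimes>\<^bsub>S\<^esub> t) = \<phi> s \<otimes>\<^bsub>G\<^esub> \<phi> t" if "s \<in> carrier S" "t \<in> carrier S" for s t
    using hom that by (auto simp: hom_def)
  have \<phi>one: "\<phi> \<one>\<^bsub>S\<^esub> = \<one>\<^bsub>G\<^esub>"
    using hom S.group_axioms G.group_axioms by (simp add: group_hom.hom_one group_hom_axioms_def group_hom_def)
  define F where "F = (\<lambda>s y. \<phi> s \<otimes>\<^bsub>G\<^esub> y)"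
  define H where "H = (\<lambda>i b y. \<phi> i \<up>\<^bsub>G\<^esub> b \<otimes>\<^bsub>G\<^esub> y)"
  \<comment> \<open>Left multiplications by values in \<open>G\<close>. They agree on
    \<open>Z i\<close> because \<open>\<phi>\<close> turns coordinates into exponents, so they
    extend to the amalgam.\<close>
  interpret G: line_action S M P Z e "carrier G" F H
  proof
    fix i z y assume *: "i \<in> P" "z \<in> Z i" "y \<in> carrier G"
    then show "H i z y = F (e i z) y" by (simp add: F_def H_def \<phi>e)
  next
    fix i a b y assume *: "i \<in> P" "a \<in> carrier M" "b \<in> carrier M" "y \<in> carrier G"
    then show "H i (a \<otimes>\<^bsub>M\<^esub> b) y = H i a (H i b y)"
      by (simp add: H_def expo_add \<phi>P expo_closed G.m_assoc)
  qed (simp_all add: F_def H_def \<phi>S \<phi>P \<phi>mult \<phi>one expo_closed G.m_assoc)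
  define \<psi> where "\<psi> x = ev F H x \<one>\<^bsub>G\<^esub>" for x
  have \<psi>_closed: "\<psi> x \<in> carrier G" if "x \<in> NF" for x using that by (simp add: \<psi>_def G.ev_closed)
  have ev_\<psi>: "ev F H x y = \<psi> x \<otimes>\<^bsub>G\<^esub> y" if "x \<in> NF" "y \<in> carrier G" for x y
  proof -
    have "run F H l y = run F H l \<one>\<^bsub>G\<^esub> \<otimes>\<^bsub>G\<^esub> y \<and> run F H l \<one>\<^bsub>G\<^esub> \<in> carrier G" if "nf l" for l
      using that
    proof (induction l)
      case (Cons u l)
      obtain i r t where u: "u = (i, r, t)" by (cases u)
      have "run F H l y = run F H l \<one>\<^bsub>G\<^esub> \<otimes>\<^bsub>G\<^esub> y" "run F H l \<one>\<^bsub>G\<^esub> \<in> carrier G" "i \<in> P" "r \<in> carrier R" "t \<in> carrier S"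
        using Cons u by auto
      then show ?case using \<open>y \<in> carrier G\<close>
        by (simp add: u F_def H_def \<phi>S \<phi>P expo_closed G.m_assoc)
    qed (use \<open>y \<in> carrier G\<close> in simp)
    then show ?thesis using that by (auto simp: \<psi>_def ev_def NF_def F_def \<phi>S G.m_assoc)
  qed
  have \<psi>_mult: "\<psi> (x \<otimes>\<^bsub>amalgam\<^esub> y) = \<psi> x \<otimes>\<^bsub>G\<^esub> \<psi> y" if "x \<in> NF" "y \<in> NF" for x y
    using G.ev_mult[of x y "\<one>\<^bsub>G\<^esub>"] ev_\<psi>[of x "\<psi> y"] that \<psi>_closed by (simp add: \<psi>_def)
  have \<psi>_hom: "group_hom amalgam G \<psi>"
    using \<psi>_closed \<psi>_mult by (auto simp: group_hom_def group_hom_axioms_def hom_def K.group_axioms G.group_axioms)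
  have \<psi>_line: "\<psi> (line i b) = \<phi> i \<up>\<^bsub>G\<^esub> b" if "i \<in> P" "b \<in> carrier R" for i b
    using that G.ev_actM[of i b "(\<one>\<^bsub>S\<^esub>, [])" "\<one>\<^bsub>G\<^esub>"]
    by (simp add: \<psi>_def line_def one_NF) (simp add: ev_def F_def H_def \<phi>one \<phi>P expo_closed)
  have \<phi>_pack: "\<phi> (pack n x) = \<psi> x" if "x \<in> NF" for x
  proof -
    have "foldr (\<lambda>(a, \<alpha>, b) y. a \<up>\<^bsub>G\<^esub> \<alpha> \<otimes>\<^bsub>G\<^esub> (b \<otimes>\<^bsub>G\<^esub> y)) (map (map_prod \<phi> (map_prod id \<phi>)) l) \<one>\<^bsub>G\<^esub>
        = run F H l \<one>\<^bsub>G\<^esub>" for l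
    proof (induction l)
      case (Cons u l)
      then show ?case by (cases u) (simp add: F_def H_def)
    qed simp
    then show ?thesis using that by (auto simp: pack_def \<psi>_def ev_def F_def NF_def \<phi>S)
  qed
  have pack_inj: "inj_on (pack n) NF"
  proof (rule inj_onI)
    fix x y assume *: "x \<in> NF" "y \<in> NF" "pack n x = pack n y"
    have "level (fst x) \<le> n" "level (fst y) \<le> n" using * lS by (auto simp: NF_def)
    then show "x = y" using * by (cases x; cases y) (auto simp: pack_def split: if_splits)
  qed
  have lpack: "level (pack n x) \<le> Suc n" if "x \<in> NF" for x
    using that lS by (auto simp: pack_def NF_def le_SucI)
  have pack_base: "pack n (base s) = s" for s by (simp add: pack_def base_def)
  have u: "\<one>\<^bsub>R\<^esub> \<in> carrier M" by simp
  obtain B where B: "B \<subseteq> NF" "line_system amalgam M (Inl ` P \<union> Inr ` B)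
    (case_sum (\<lambda>i. carrier M) (\<lambda>c. group.powers M \<one>\<^bsub>R\<^esub>))
    (case_sum line (\<lambda>c z. c [^]\<^bsub>amalgam\<^esub> group.exponent_of M \<one>\<^bsub>R\<^esub> z))"
    using extended_line_system[OF u one_infinite_order] by blast
  define Q where "Q = Inl ` P \<union> Inr ` B"
  define Z1 where "Z1 = case_sum (\<lambda>i::('g, 'a) name. carrier M)
    (\<lambda>c::('g, 'a) name \<times> (('g, 'a) name \<times> 'a \<times> ('g, 'a) name) list. group.powers M \<one>\<^bsub>R\<^esub>)"
  define e1 where "e1 = case_sum line (\<lambda>c z. c [^]\<^bsub>amalgam\<^esub> group.exponent_of M \<one>\<^bsub>R\<^esub> z)"
  \<comment> \<open>Old lines keep their index. The line of a root is indexed by the name of the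
    root inside a \<open>Node\<close> of level \<open>Suc n\<close>, which exceeds the level of
    every old index.\<close>
  define ix where "ix = case_sum (\<lambda>i::('g, 'a) name. i) (\<lambda>c. Node n (pack n c) [])"
  have ix_inj: "inj_on ix Q"
  proof (rule inj_onI)
    fix p q assume "p \<in> Q" "q \<in> Q" "ix p = ix q"
    then show "p = q" using lP B(1) inj_onD[OF pack_inj] by (fastforce simp: Q_def ix_def)
  qed
  define S' where "S' = transport (pack n) amalgam"
  define P' where "P' = ix ` Q"
  define Z' where "Z' = (\<lambda>i. Z1 (inv_into Q ix i))"
  define e' where "e' = (\<lambda>i z. pack n (e1 (inv_into Q ix i) z))"
  have sys': "line_system S' M P' Z' e'"
    unfolding S'_def P'_def Z'_def e'_def using B(2) pack_inj ix_inj
    by (intro line_system_transport) (simp_all add: Q_def Z1_def e1_def)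
  have pin: "inj_on (pack n) (carrier amalgam)" using pack_inj by simp
  note ts = transport_simps[OF K.group_axioms pin, folded S'_def, simplified]
  have inv_ix: "inv_into Q ix (ix q) = q" if "q \<in> Q" for q using ix_inj that by simp
  have inv_P: "inv_into Q ix i = Inl i" if "i \<in> P" for i
    using inv_ix[of "Inl i"] that by (simp add: Q_def ix_def)
  have PZ: "Z' i = carrier R" and Pe: "e' i z = pack n (line i z)" if "i \<in> P" for i z
    using inv_P[OF that] by (simp_all add: Z'_def e'_def Z1_def e1_def)
  have "stage (Suc n) (S', P', Z', e')"
    unfolding stage_def prod.case
  proof (intro conjI ballI)
    show "line_system S' M P' Z' e'" by (rule sys')
    show "level v \<le> Suc n" if "v \<in> carrier S'" for v using that lpack by (auto simp: ts)
    show "level i \<le> Suc n" if "i \<in> P'" for i using that lP by (auto simp: P'_def Q_def ix_def le_SucI)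
    show "\<phi> \<in> hom S' G" using \<psi>_mult \<psi>_closed by (auto simp: hom_def ts \<phi>_pack)
    fix i assume "i \<in> P'"
    then obtain q where q: "q \<in> Q" "i = ix q" by (auto simp: P'_def)
    then show "\<phi> i \<in> carrier G"
      using \<phi>P B(1) \<psi>_closed by (auto simp: Q_def ix_def \<phi>_pack subset_iff)
    fix z assume z: "z \<in> Z' i"
    show "\<phi> (e' i z) = \<phi> i \<up>\<^bsub>G\<^esub> z"
    proof (cases q)
      case (Inl j)
      then have "j \<in> P" "i = j" using q by (auto simp: Q_def ix_def)
      then show ?thesis using z by (simp add: PZ Pe \<phi>_pack \<psi>_line)
    next
      case (Inr c)
      then have c: "c \<in> NF" using q B(1) by (auto simp: Q_def)
      have i: "inv_into Q ix i = Inr c" using q inv_ix Inr by simp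
      \<comment> \<open>The coordinates on a new line are multiples of 1, for which exponents in the
        ring are ordinary powers.\<close>
      obtain k :: int where k: "z = \<one>\<^bsub>R\<^esub> [^]\<^bsub>M\<^esub> k" using z by (auto simp: Z'_def Z1_def i group.powers_def[OF M_group])
      have "e' i z = pack n (c [^]\<^bsub>amalgam\<^esub> k)"
        using group.exponent_of_pow[OF M_group u one_infinite_order, of k] by (simp add: e'_def e1_def i k)
      then have "\<phi> (e' i z) = \<psi> c [^]\<^bsub>G\<^esub> k"
        using group_hom.hom_int_pow[OF \<psi>_hom, of c k] c by (simp add: \<phi>_pack)
      moreover have "\<phi> i = \<psi> c" using c \<psi>_closed[OF c] by (simp add: q Inr ix_def \<phi>_pack)
      ultimately show ?thesis using expo_pow \<psi>_closed[OF c] k by simp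
    qed
  qed
  moreover have "extends T (S', P', Z', e')"
    unfolding extends_def T prod.case
  proof (intro conjI ballI allI impI)
    show "carrier S \<subseteq> carrier S'"
    proof
      fix s assume "s \<in> carrier S"
      then show "s \<in> carrier S'" using pack_base[of s] by (metis base_NF image_eqI ts(1))
    qed
    show "x \<otimes>\<^bsub>S'\<^esub> y = x \<otimes>\<^bsub>S\<^esub> y" if "x \<in> carrier S" "y \<in> carrier S" for x y
      using ts(3)[of "base x" "base y"] that by (simp add: pack_base flip: base_mult)
    show "P \<subseteq> P'"
    proof
      fix i assume "i \<in> P"
      then show "i \<in> P'" unfolding P'_def by (intro image_eqI[of _ _ "Inl i"]) (auto simp: ix_def Q_def)
    qed
    show "Z' i = carrier R" if "i \<in> P" for i using PZ that by simp
    show "e' i z = e i z" if "i \<in> P" "z \<in> Z i" for i z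
      using that by (simp add: Pe line_Z pack_base)
    fix w :: "(('g, 'a) name \<times> bool) list"
    assume w: "reduced w" "fst ` set w \<subseteq> {i \<in> P. Z i = {\<zero>\<^bsub>R\<^esub>}}" "w \<noteq> []"
    then have wP: "fst ` set w \<subseteq> P" by auto
    have "word_value amalgam (\<lambda>i. line i \<one>\<^bsub>R\<^esub>) w \<noteq> \<one>\<^bsub>amalgam\<^esub>"
      using w by (intro word_value_line_neq_one one_infinite_order) auto
    moreover have "word_value amalgam (\<lambda>i. line i \<one>\<^bsub>R\<^esub>) w \<in> carrier amalgam"
      by (rule K.word_value_closed[OF _ wP]) auto
    ultimately have "pack n (word_value amalgam (\<lambda>i. line i \<one>\<^bsub>R\<^esub>) w) \<noteq> \<one>\<^bsub>S'\<^esub>"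
      using inj_onD[OF pin] by (metis K.one_closed ts(2))
    moreover have "word_value S' (\<lambda>i. pack n (line i \<one>\<^bsub>R\<^esub>)) w = pack n (word_value amalgam (\<lambda>i. line i \<one>\<^bsub>R\<^esub>) w)"
      unfolding S'_def
      by (rule group_hom.word_value_hom_image[OF transport_hom[OF K.group_axioms pin] _ wP]) auto
    moreover have "word_value S' (\<lambda>i. e' i \<one>\<^bsub>R\<^esub>) w = word_value S' (\<lambda>i. pack n (line i \<one>\<^bsub>R\<^esub>)) w"
      using wP by (induction w) (auto simp: word_value_def letter_value_def Pe)
    ultimately show "word_value S' (\<lambda>i. e' i \<one>\<^bsub>R\<^esub>) w \<noteq> \<one>\<^bsub>S'\<^esub>" by simp
  qed
  ultimately show ?thesis by blast
qed

end

section \<open>Unions of ascending chains of groups\<close>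

definition union_group :: "(nat \<Rightarrow> 'u monoid) \<Rightarrow> 'u monoid" where
  "union_group S = \<lparr>carrier = (\<Union>n. carrier (S n)),
     monoid.mult = \<lambda>x y. x \<otimes>\<^bsub>S (LEAST n. x \<in> carrier (S n) \<and> y \<in> carrier (S n))\<^esub> y, one = \<one>\<^bsub>S 0\<^esub>\<rparr>"

locale group_chain =
  fixes S :: "nat \<Rightarrow> 'u monoid"
  assumes S: "\<And>n. group (S n)" and sub: "\<And>n. carrier (S n) \<subseteq> carrier (S (Suc n))"
    and mult: "\<And>n x y. \<lbrakk>x \<in> carrier (S n); y \<in> carrier (S n)\<rbrakk> \<Longrightarrow> x \<otimes>\<^bsub>S (Suc n)\<^esub> y = x \<otimes>\<^bsub>S n\<^esub> y"
begin

lemma chain_mono: "n \<le> m \<Longrightarrow> carrier (S n) \<subseteq> carrier (S m)"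
  by (rule lift_Suc_mono_le[of "\<lambda>n. carrier (S n)"]) (rule sub)

lemma chain_mult:
  assumes "x \<in> carrier (S n)" "y \<in> carrier (S n)" "n \<le> m"
  shows "x \<otimes>\<^bsub>S m\<^esub> y = x \<otimes>\<^bsub>S n\<^esub> y"
  using assms(3)
proof (induction m rule: dec_induct)
  case (step m)
  then show ?case using mult[of x m y] chain_mono[of n m] assms by auto
qed simp

lemma union_mult:
  assumes "x \<in> carrier (S n)" "y \<in> carrier (S n)"
  shows "x \<otimes>\<^bsub>union_group S\<^esub> y = x \<otimes>\<^bsub>S n\<^esub> y"
proof -
  define k where "k = (LEAST n. x \<in> carrier (S n) \<and> y \<in> carrier (S n))"
  have "x \<in> carrier (S k) \<and> y \<in> carrier (S k)" unfolding k_def using assms by (intro LeastI) auto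
  moreover have "k \<le> n" unfolding k_def using assms by (intro Least_le) auto
  ultimately have "x \<otimes>\<^bsub>S n\<^esub> y = x \<otimes>\<^bsub>S k\<^esub> y" by (intro chain_mult) auto
  then show ?thesis by (simp add: union_group_def k_def)
qed

lemma chain_one: "\<one>\<^bsub>S n\<^esub> = \<one>\<^bsub>S 0\<^esub>"
proof -
  interpret S0: group "S 0" by (rule S)
  interpret Sn: group "S n" by (rule S)
  have "\<one>\<^bsub>S 0\<^esub> \<in> carrier (S n)" using chain_mono[of 0 n] by auto
  moreover have "\<one>\<^bsub>S 0\<^esub> \<otimes>\<^bsub>S n\<^esub> \<one>\<^bsub>S 0\<^esub> = \<one>\<^bsub>S 0\<^esub>" using chain_mult[of "\<one>\<^bsub>S 0\<^esub>" 0 "\<one>\<^bsub>S 0\<^esub>" n] by simp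
  ultimately show ?thesis using Sn.l_cancel_one[of "\<one>\<^bsub>S 0\<^esub>" "\<one>\<^bsub>S 0\<^esub>"] by simp
qed

lemma union_one: "\<one>\<^bsub>union_group S\<^esub> = \<one>\<^bsub>S n\<^esub>"
  using chain_one[of n] by (simp add: union_group_def)

lemma union_carrier: "x \<in> carrier (union_group S) \<longleftrightarrow> (\<exists>n. x \<in> carrier (S n))"
  by (simp add: union_group_def)

lemma union_common:
  assumes "x \<in> carrier (union_group S)" "y \<in> carrier (union_group S)"
  obtains n where "k \<le> n" "x \<in> carrier (S n)" "y \<in> carrier (S n)"
proof -
  obtain i j where ij: "x \<in> carrier (S i)" "y \<in> carrier (S j)" using assms by (auto simp: union_carrier)
  then show ?thesis
    using that[of "k + i + j"] chain_mono[of i "k + i + j"] chain_mono[of j "k + i + j"] by auto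
qed

lemma union_closed:
  "\<lbrakk>x \<in> carrier (union_group S); y \<in> carrier (union_group S)\<rbrakk> \<Longrightarrow> x \<otimes>\<^bsub>union_group S\<^esub> y \<in> carrier (union_group S)"
  by (rule union_common[of x y 0])
    (auto simp: union_mult union_carrier intro: monoid.m_closed[OF group.is_monoid[OF S]])

lemma union_is_group: "group (union_group S)"
proof (rule groupI)
  fix x y z
  assume *: "x \<in> carrier (union_group S)" "y \<in> carrier (union_group S)" "z \<in> carrier (union_group S)"
  obtain k where k: "z \<in> carrier (S k)" using * by (auto simp: union_carrier)
  obtain n where n: "k \<le> n" "x \<in> carrier (S n)" "y \<in> carrier (S n)" using union_common[OF *(1,2)] .
  interpret Sn: group "S n" by (rule S)
  have "z \<in> carrier (S n)" using k chain_mono[OF n(1)] by auto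
  then show "x \<otimes>\<^bsub>union_group S\<^esub> y \<otimes>\<^bsub>union_group S\<^esub> z = x \<otimes>\<^bsub>union_group S\<^esub> (y \<otimes>\<^bsub>union_group S\<^esub> z)"
    using n by (simp add: union_mult[where n = n] Sn.m_assoc)
next
  fix x assume "x \<in> carrier (union_group S)"
  then obtain n where n: "x \<in> carrier (S n)" by (auto simp: union_carrier)
  interpret Sn: group "S n" by (rule S)
  show "\<one>\<^bsub>union_group S\<^esub> \<otimes>\<^bsub>union_group S\<^esub> x = x"
    using n by (simp add: union_one[of n] union_mult[where n = n])
  show "\<exists>y\<in>carrier (union_group S). y \<otimes>\<^bsub>union_group S\<^esub> x = \<one>\<^bsub>union_group S\<^esub>"
    using n union_mult[of "inv\<^bsub>S n\<^esub> x" n x] union_one[of n]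
    by (intro bexI[of _ "inv\<^bsub>S n\<^esub> x"]) (auto simp: union_carrier)
next
  show "\<one>\<^bsub>union_group S\<^esub> \<in> carrier (union_group S)"
    using monoid.one_closed[OF group.is_monoid[OF S[of 0]]] union_one[of 0] by (auto simp: union_carrier)
qed (rule union_closed)

lemma union_incl_hom: "group_hom (S n) (union_group S) (\<lambda>x. x)"
  using S union_is_group union_mult by (auto simp: group_hom_def group_hom_axioms_def hom_def union_carrier)

end

context exp_group_tower
begin

theorem full_line_system_exists:
  obtains H :: "('g, 'a) name monoid" and P a
  where "line_system H M P (\<lambda>_. carrier R) a" "\<phi> \<in> hom H G"
    "\<forall>i\<in>P. \<phi> i \<in> carrier G" "\<forall>i\<in>P. \<forall>\<alpha>\<in>carrier R. \<phi> (a i \<alpha>) = \<phi> i \<up>\<^bsub>G\<^esub> \<alpha>"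
    "Atom ` X \<subseteq> P"
    "\<forall>w. reduced w \<longrightarrow> fst ` set w \<subseteq> Atom ` X \<longrightarrow> w \<noteq> [] \<longrightarrow>
      word_value H (\<lambda>i. a i \<one>\<^bsub>R\<^esub>) w \<noteq> \<one>\<^bsub>H\<^esub>"
proof -
  define T0 where "T0 = (\<lparr>carrier = {Trivial}, monoid.mult = \<lambda>_ _. Trivial, one = Trivial\<rparr> :: ('g, 'a) name monoid,
    Atom ` X :: ('g, 'a) name set, \<lambda>_ :: ('g, 'a) name. {\<zero>\<^bsub>R\<^esub>}, \<lambda>(_ :: ('g, 'a) name) (_ :: 'a). Trivial :: ('g, 'a) name)"
  have g0: "group \<lparr>carrier = {Trivial}, monoid.mult = \<lambda>_ _. Trivial, one = Trivial\<rparr>"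
    by (rule groupI) auto
  have z: "subgroup {\<zero>\<^bsub>R\<^esub>} M" by (rule subgroup.intro) (auto simp: m_inv_def)
  have "stage 0 T0"
    unfolding stage_def T0_def prod.case using X z
    by (auto simp: line_system_def line_system_axioms_def g0 M_comm_group hom_def expo_ring_zero)
  then obtain T where T: "\<And>n. stage n (T n)" "T 0 = T0" "\<And>n. extends (T n) (T (Suc n))"
  proof -
    assume st0: "stage 0 T0"
    have "\<exists>T. \<forall>n. (stage n (T n) \<and> (n = 0 \<longrightarrow> T n = T0)) \<and> extends (T n) (T (Suc n))"
    proof (rule dependent_nat_choice)
      show "\<exists>T. stage 0 T \<and> (0 = 0 \<longrightarrow> T = T0)" using st0 by blast
      fix T n assume "stage n T \<and> (n = 0 \<longrightarrow> T = T0)"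
      then show "\<exists>T'. (stage (Suc n) T' \<and> (Suc n = 0 \<longrightarrow> T' = T0)) \<and> extends T T'"
        using stage_Suc[of n T] by simp
    qed
    then obtain T where "\<And>n. (stage n (T n) \<and> (n = 0 \<longrightarrow> T n = T0)) \<and> extends (T n) (T (Suc n))" by blast
    then show thesis using that[of T] by simp
  qed
  define S P Z e where "S n = fst (T n)" and "P n = fst (snd (T n))" and "Z n = fst (snd (snd (T n)))"
    and "e n = snd (snd (snd (T n)))" for n
  have Tn: "T n = (S n, P n, Z n, e n)" for n by (simp add: S_def P_def Z_def e_def)
  note st = T(1)[unfolded Tn stage_def prod.case]
  note ex = T(3)[unfolded Tn extends_def prod.case]
  have sys: "line_system (S n) M (P n) (Z n) (e n)" for n using st by blast
  have grp: "group (S n)" for n using sys by (simp add: line_system_def)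
  have sub: "carrier (S n) \<subseteq> carrier (S (Suc n))" for n using ex by blast
  have mul: "x \<otimes>\<^bsub>S (Suc n)\<^esub> y = x \<otimes>\<^bsub>S n\<^esub> y" if "x \<in> carrier (S n)" "y \<in> carrier (S n)" for n x y
    using ex that by blast
  define H where "H = union_group S"
  interpret chain: group_chain S by (intro group_chain.intro grp sub mul)
  note H_mult = chain.union_mult[folded H_def]
  note H_one = chain.union_one[folded H_def]
  note H_carrier = chain.union_carrier[folded H_def]
  note H_common = chain.union_common[folded H_def]
  note S_mono = chain.chain_mono
  have Hg: "group H" unfolding H_def by (rule chain.union_is_group)
  have P_mono: "P n \<subseteq> P m" if "n \<le> m" for n m
    using that by (rule lift_Suc_mono_le[of P, rotated]) (use ex in blast)
  \<comment> \<open>An index enters with a partial line, which is full one stage later and does not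
    change afterwards; hence \<open>Suc\<close>.\<close>
  define a where "a i = e (Suc (LEAST n. i \<in> P n)) i" for i
  have full: "Z (Suc m) i = carrier R \<and> (\<forall>\<alpha>\<in>carrier R. e (Suc m) i \<alpha> = a i \<alpha>)" if "i \<in> P n" "n \<le> m" for i n m
  proof -
    define k where "k = (LEAST n. i \<in> P n)"
    have k: "i \<in> P k" "k \<le> n" using that unfolding k_def by (auto intro: LeastI Least_le)
    have "k \<le> m" using k that by simp
    then show ?thesis
    proof (induction m rule: dec_induct)
      case base
      then show ?case using ex[of k] k(1) by (simp add: a_def flip: k_def)
    next
      case (step m)
      have "i \<in> P (Suc m)" using k P_mono[of k "Suc m"] step by auto
      then show ?case using ex[of "Suc m"] step by auto
    qed
  qed
  have at: "a i \<alpha> \<in> carrier (S (Suc m))" "\<phi> (a i \<alpha>) = \<phi> i \<up>\<^bsub>G\<^esub> \<alpha>"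
    if "i \<in> P n" "n \<le> m" "\<alpha> \<in> carrier R" for i n m \<alpha>
  proof -
    have i: "i \<in> P (Suc m)" using that P_mono[of n "Suc m"] by auto
    then show "a i \<alpha> \<in> carrier (S (Suc m))" "\<phi> (a i \<alpha>) = \<phi> i \<up>\<^bsub>G\<^esub> \<alpha>"
      using full[OF that(1,2)] that(3) st[of "Suc m"] line_system.e_closed[OF sys i, of \<alpha>] by auto
  qed
  have aH: "a i \<alpha> \<in> carrier H" if "i \<in> P n" "\<alpha> \<in> carrier R" for i n \<alpha>
    using at(1)[of i n n] that by (auto simp: H_carrier)
  have P0: "P 0 = Atom ` X" "Z 0 = (\<lambda>_. {\<zero>\<^bsub>R\<^esub>})" using T(2) by (simp_all add: P_def Z_def T0_def)
  have "line_system H M (\<Union>n. P n) (\<lambda>_. carrier R) a"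
  proof (rule line_system.intro[OF Hg M_comm_group line_system_axioms.intro], goal_cases)
    case (1 i)
    then show ?case using group.subgroup_self[OF M_group] by simp
  next
    case (2 i z)
    then show ?case using aH by auto
  next
    case (3 i z w)
    then obtain n where n: "i \<in> P n" by auto
    then have i: "i \<in> P (Suc n)" using P_mono[of n "Suc n"] by auto
    have "a i (z \<oplus>\<^bsub>R\<^esub> w) = a i z \<otimes>\<^bsub>S (Suc n)\<^esub> a i w"
      using line_system.e_mult[OF sys i, of z w] full[OF n order_refl] 3 by simp
    then show ?case using 3 at(1)[OF n order_refl] H_mult[of "a i z" "Suc n" "a i w"] by simp
  next
    case (4 i z)
    then obtain n where n: "i \<in> P n" by auto
    then have i: "i \<in> P (Suc n)" using P_mono[of n "Suc n"] by auto
    show ?case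
      using line_system.e_kernel[OF sys i, of z] full[OF n order_refl] 4 H_one[of "Suc n"] by simp
  next
    case (5 i j z w g)
    then obtain n m where nm: "i \<in> P n" "j \<in> P m" by auto
    \<comment> \<open>The stage \<open>Suc l\<close> contains \<open>g\<close>, and both lines are
      already full there.\<close>
    obtain l where k: "n + m \<le> l" "g \<in> carrier (S l)" using H_common[OF 5(5,5)] .
    have l: "i \<in> P (Suc l)" "j \<in> P (Suc l)" "n \<le> l" "m \<le> l" "g \<in> carrier (S (Suc l))"
      using k nm P_mono[of n "Suc l"] P_mono[of m "Suc l"] S_mono[of l "Suc l"] by auto
    note fi = full[OF nm(1) l(3)] full[OF nm(2) l(4)]
    have "a i z \<otimes>\<^bsub>S (Suc l)\<^esub> g = g \<otimes>\<^bsub>S (Suc l)\<^esub> a j w"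
      using 5 at(1)[OF nm(1) l(3)] at(1)[OF nm(2) l(4)] l(5)
        H_mult[of "a i z" "Suc l" g] H_mult[of g "Suc l" "a j w"] by simp
    then have "e (Suc l) i z \<otimes>\<^bsub>S (Suc l)\<^esub> g = g \<otimes>\<^bsub>S (Suc l)\<^esub> e (Suc l) j w" using fi 5 by simp
    moreover have "z \<in> Z (Suc l) i" "w \<in> Z (Suc l) j" "z \<noteq> \<one>\<^bsub>M\<^esub>" using fi 5 by simp_all
    ultimately have "i = j \<and> g \<in> e (Suc l) i ` Z (Suc l) i"
      using line_system.malnormal[OF sys l(1,2) _ _ l(5), of z w] by blast
    then show ?case using fi by auto
  next
    case (6 h)
    then obtain n where n: "h \<in> carrier (S n)" by (auto simp: H_carrier)
    have "h \<noteq> \<one>\<^bsub>S n\<^esub>" using 6 H_one[of n] by simp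
    then obtain i z g where i: "i \<in> P n" "z \<in> Z n i" "g \<in> carrier (S n)" "h \<otimes>\<^bsub>S n\<^esub> g = g \<otimes>\<^bsub>S n\<^esub> e n i z"
      using line_system.cover[OF sys n] by blast
    have zR: "z \<in> carrier R" using line_system.Z_mem[OF sys i(1,2)] by simp
    have eS: "e n i z \<in> carrier (S n)" using line_system.e_closed[OF sys i(1,2)] .
    have "a i z = e n i z" using ex[of n] full[OF i(1) order_refl] i zR by auto
    then have "h \<otimes>\<^bsub>H\<^esub> g = g \<otimes>\<^bsub>H\<^esub> a i z"
      using i n eS H_mult[of h n g] H_mult[of g n "a i z"] by simp
    moreover have "i \<in> (\<Union>n. P n)" "g \<in> carrier H" using i by (auto simp: H_carrier)
    ultimately show ?case using zR by blast
  qed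
  moreover have "\<phi> \<in> hom H G"
  proof (rule homI)
    fix x assume "x \<in> carrier H"
    then obtain n where "x \<in> carrier (S n)" by (auto simp: H_carrier)
    then show "\<phi> x \<in> carrier G" using st[of n] by (auto simp: hom_def)
  next
    fix x y assume "x \<in> carrier H" "y \<in> carrier H"
    then obtain n where "x \<in> carrier (S n)" "y \<in> carrier (S n)" using H_common by blast
    then show "\<phi> (x \<otimes>\<^bsub>H\<^esub> y) = \<phi> x \<otimes>\<^bsub>G\<^esub> \<phi> y" using st[of n] H_mult[of x n y] by (auto simp: hom_def)
  qed
  moreover have "\<forall>i\<in>(\<Union>n. P n). \<phi> i \<in> carrier G" using st by blast
  moreover have "\<forall>i\<in>(\<Union>n. P n). \<forall>\<alpha>\<in>carrier R. \<phi> (a i \<alpha>) = \<phi> i \<up>\<^bsub>G\<^esub> \<alpha>"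
    using at(2) by blast
  moreover from P0 have "Atom ` X \<subseteq> (\<Union>n. P n)" by blast
  moreover have "word_value H (\<lambda>i. a i \<one>\<^bsub>R\<^esub>) w \<noteq> \<one>\<^bsub>H\<^esub>"
    if w: "reduced w" "fst ` set w \<subseteq> Atom ` X" "w \<noteq> []" for w
  proof -
    have eq: "a i \<one>\<^bsub>R\<^esub> = e 1 i \<one>\<^bsub>R\<^esub>" if "i \<in> Atom ` X" for i
      using full[of i 0 0] that P0 by simp
    have "word_value H (\<lambda>i. a i \<one>\<^bsub>R\<^esub>) w = word_value (S 1) (\<lambda>i. a i \<one>\<^bsub>R\<^esub>) w"
      unfolding H_def
      by (rule group_hom.word_value_hom_image[OF chain.union_incl_hom, of _ "P 0"])
        (use at(1)[of _ 0 0 "\<one>\<^bsub>R\<^esub>"] w P0 in auto)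
    also have "\<dots> = word_value (S 1) (\<lambda>i. e 1 i \<one>\<^bsub>R\<^esub>) w"
      using w(2) eq by (induction w) (auto simp: word_value_def letter_value_def)
    also have "\<dots> \<noteq> \<one>\<^bsub>S 1\<^esub>" using ex[of 0] w P0 by auto
    finally show ?thesis using H_one[of 1] by simp
  qed
  ultimately show thesis by (intro that[of H "\<Union>n. P n" a]) blast+
qed

end

section \<open>Groups covered by full lines\<close>

text \<open>
  If all lines are full, then every nontrivial element lies on a unique line, which is its
  centralizer, and the action of the ring on itself by right multiplication can be copied to
  all lines.
\<close>

locale full_line_system = R: ring R + line_system H "add_monoid R" P "\<lambda>_. carrier R" a
  for R :: "('a, 'm) ring_scheme" and H :: "'h monoid" (structure)
    and P :: "'i set" and a :: "'i \<Rightarrow> 'a \<Rightarrow> 'h"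
begin

lemma a_closed [simp]: "\<lbrakk>i \<in> P; \<alpha> \<in> carrier R\<rbrakk> \<Longrightarrow> a i \<alpha> \<in> carrier H"
  using e_closed by simp

lemma a_add: "\<lbrakk>i \<in> P; \<alpha> \<in> carrier R; \<beta> \<in> carrier R\<rbrakk> \<Longrightarrow> a i (\<alpha> \<oplus>\<^bsub>R\<^esub> \<beta>) = a i \<alpha> \<otimes> a i \<beta>"
  using e_mult[of i \<alpha> \<beta>] by simp

lemma a_zero [simp]: "i \<in> P \<Longrightarrow> a i \<zero>\<^bsub>R\<^esub> = \<one>"
  using e_one[of i] by simp

lemma a_eq_one_iff: "\<lbrakk>i \<in> P; \<alpha> \<in> carrier R\<rbrakk> \<Longrightarrow> a i \<alpha> = \<one> \<longleftrightarrow> \<alpha> = \<zero>\<^bsub>R\<^esub>"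
  using e_kernel[of i \<alpha>] by auto

lemma a_comm: "\<lbrakk>i \<in> P; \<alpha> \<in> carrier R; \<beta> \<in> carrier R\<rbrakk> \<Longrightarrow> a i \<alpha> \<otimes> a i \<beta> = a i \<beta> \<otimes> a i \<alpha>"
  by (metis a_add R.a_comm)

lemma a_malnormal:
  "\<lbrakk>i \<in> P; j \<in> P; \<alpha> \<in> carrier R; \<beta> \<in> carrier R; g \<in> carrier H; \<alpha> \<noteq> \<zero>\<^bsub>R\<^esub>; a i \<alpha> \<otimes> g = g \<otimes> a j \<beta>\<rbrakk>
    \<Longrightarrow> i = j \<and> (\<exists>\<gamma>\<in>carrier R. g = a i \<gamma>)"
  using malnormal[of i j \<alpha> \<beta> g] by auto

lemma on_lineE:
  assumes "h \<in> carrier H" "h \<noteq> \<one>"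
  obtains i \<alpha> g where "i \<in> P" "\<alpha> \<in> carrier R" "g \<in> carrier H" "\<alpha> \<noteq> \<zero>\<^bsub>R\<^esub>" "h = g \<otimes> a i \<alpha> \<otimes> inv g"
proof -
  obtain i \<alpha> g where *: "i \<in> P" "\<alpha> \<in> carrier R" "g \<in> carrier H" "h \<otimes> g = g \<otimes> a i \<alpha>"
    using cover[OF assms] by blast
  then have h: "h = g \<otimes> a i \<alpha> \<otimes> inv g" using S.eq_mult_inv_iff assms by simp
  moreover have "\<alpha> \<noteq> \<zero>\<^bsub>R\<^esub>" using h * assms by auto
  ultimately show ?thesis using that * by blast
qed

text \<open>Conjugation by \<open>g\<close> reduces the relation to malnormality, applied to
  \<open>inv g \<otimes> h\<close>. So the line through a nontrivial element is unique, and two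
  parametrizations of it differ by a factor from the line.\<close>

lemma line_param_unique:
  assumes ij: "i \<in> P" "j \<in> P" "\<alpha> \<in> carrier R" "\<beta> \<in> carrier R" "g \<in> carrier H" "h \<in> carrier H" "\<alpha> \<noteq> \<zero>\<^bsub>R\<^esub>"
    and eq: "(g \<otimes> a i \<alpha> \<otimes> inv g) \<otimes> h = h \<otimes> a j \<beta>"
  shows "i = j" "\<exists>\<gamma>\<in>carrier R. h = g \<otimes> a i \<gamma>"
proof -
  define k where "k = inv g \<otimes> h"
  have k: "k \<in> carrier H" "h = g \<otimes> k" using ij by (simp_all add: k_def)
  have "inv g \<otimes> ((g \<otimes> a i \<alpha> \<otimes> inv g) \<otimes> (g \<otimes> k)) = inv g \<otimes> ((g \<otimes> k) \<otimes> a j \<beta>)" using eq k(2) by simp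
  then have "a i \<alpha> \<otimes> k = k \<otimes> a j \<beta>" using ij k(1) by (simp add: S.m_assoc)
  then show "i = j" "\<exists>\<gamma>\<in>carrier R. h = g \<otimes> a i \<gamma>" using a_malnormal[of i j \<alpha> \<beta> k] ij k by auto
qed

lemma on_same_line:
  assumes "i \<in> P" "\<alpha> \<in> carrier R" "g \<in> carrier H" "h \<in> carrier H" "\<alpha> \<noteq> \<zero>\<^bsub>R\<^esub>"
    and eq: "(g \<otimes> a i \<alpha> \<otimes> inv g) \<otimes> h = h \<otimes> (g \<otimes> a i \<alpha> \<otimes> inv g)"
  shows "\<exists>\<beta>\<in>carrier R. h = g \<otimes> a i \<beta> \<otimes> inv g"
proof -
  have "(g \<otimes> a i \<alpha> \<otimes> inv g) \<otimes> (h \<otimes> g) = (h \<otimes> g) \<otimes> a i \<alpha>"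
  proof -
    have "(g \<otimes> a i \<alpha> \<otimes> inv g) \<otimes> (h \<otimes> g) = ((g \<otimes> a i \<alpha> \<otimes> inv g) \<otimes> h) \<otimes> g" using assms(1-4) by (simp add: S.m_assoc)
    also have "\<dots> = (h \<otimes> g) \<otimes> a i \<alpha>" unfolding eq using assms(1-4) by (simp add: S.m_assoc)
    finally show ?thesis .
  qed
  then obtain \<gamma> where \<gamma>: "\<gamma> \<in> carrier R" "h \<otimes> g = g \<otimes> a i \<gamma>"
    using line_param_unique(2)[of i i \<alpha> \<alpha> g "h \<otimes> g"] assms by auto
  then have "h = g \<otimes> a i \<gamma> \<otimes> inv g" using assms by (simp add: S.eq_mult_inv_iff)
  then show ?thesis using \<gamma>(1) by blast
qed

definition line_expo :: "'h \<Rightarrow> 'a \<Rightarrow> 'h" where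
  "line_expo h \<beta> = (if h = \<one> then \<one> else
     SOME k. \<exists>i\<in>P. \<exists>\<alpha>\<in>carrier R. \<exists>g\<in>carrier H. h = g \<otimes> a i \<alpha> \<otimes> inv g \<and> k = g \<otimes> a i (\<alpha> \<otimes>\<^bsub>R\<^esub> \<beta>) \<otimes> inv g)"

text \<open>Two presentations of an element as a conjugate of a line element differ by a factor from
  the line. This factor commutes with the line, hence changes neither the coordinate nor the
  resulting power.\<close>

lemma line_expo_eq:
  assumes i: "i \<in> P" "\<alpha> \<in> carrier R" "\<beta> \<in> carrier R" "g \<in> carrier H"
  shows "line_expo (g \<otimes> a i \<alpha> \<otimes> inv g) \<beta> = g \<otimes> a i (\<alpha> \<otimes>\<^bsub>R\<^esub> \<beta>) \<otimes> inv g"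
proof (cases "\<alpha> = \<zero>\<^bsub>R\<^esub>")
  case True
  then show ?thesis using i by (simp add: line_expo_def)
next
  case False
  let ?h = "g \<otimes> a i \<alpha> \<otimes> inv g"
  have h1: "?h \<noteq> \<one>"
  proof
    assume "?h = \<one>"
    then have "a i \<alpha> = \<one>" using S.eq_mult_inv_iff[of \<one> "a i \<alpha>" g] i by simp
    then show False using False i by (simp add: a_eq_one_iff)
  qed
  have uniq: "k = g \<otimes> a i (\<alpha> \<otimes>\<^bsub>R\<^esub> \<beta>) \<otimes> inv g"
    if j: "j \<in> P" "\<alpha>' \<in> carrier R" "g' \<in> carrier H" "?h = g' \<otimes> a j \<alpha>' \<otimes> inv g'"
      "k = g' \<otimes> a j (\<alpha>' \<otimes>\<^bsub>R\<^esub> \<beta>) \<otimes> inv g'" for k j \<alpha>' g'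
  proof -
    have eq: "?h \<otimes> g' = g' \<otimes> a j \<alpha>'" using j i S.eq_mult_inv_iff[of ?h "a j \<alpha>'" g'] by simp
    obtain \<gamma> where \<gamma>: "i = j" "\<gamma> \<in> carrier R" "g' = g \<otimes> a i \<gamma>"
      using line_param_unique[OF i(1) j(1) i(2) j(2) i(4) j(3) False eq] by blast
    have conj: "g' \<otimes> a i \<delta> \<otimes> inv g' = g \<otimes> a i \<delta> \<otimes> inv g" if "\<delta> \<in> carrier R" for \<delta>
    proof -
      have "a i \<gamma> \<otimes> a i \<delta> \<otimes> inv (a i \<gamma>) = a i \<delta>" using i that \<gamma> a_comm[of i \<gamma> \<delta>] by simp
      then have "g \<otimes> (a i \<gamma> \<otimes> a i \<delta> \<otimes> inv (a i \<gamma>)) \<otimes> inv g = g \<otimes> a i \<delta> \<otimes> inv g" by simp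
      then show ?thesis using i \<gamma> that by (simp add: S.inv_mult_group S.m_assoc)
    qed
    have "g \<otimes> a i \<alpha> \<otimes> inv g = g \<otimes> a i \<alpha>' \<otimes> inv g" using j(4) conj[OF j(2)] \<gamma>(1) by simp
    then have "a i \<alpha> = a i \<alpha>'" using i j by (simp add: S.m_assoc)
    then have "\<alpha> = \<alpha>'" using e_inj[of i \<alpha> \<alpha>'] i j by simp
    then show ?thesis using j(5) conj[of "\<alpha>' \<otimes>\<^bsub>R\<^esub> \<beta>"] i j \<gamma>(1) by simp
  qed
  have "line_expo ?h \<beta> = (SOME k. \<exists>j\<in>P. \<exists>\<alpha>'\<in>carrier R. \<exists>g'\<in>carrier H.
      ?h = g' \<otimes> a j \<alpha>' \<otimes> inv g' \<and> k = g' \<otimes> a j (\<alpha>' \<otimes>\<^bsub>R\<^esub> \<beta>) \<otimes> inv g')"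
    using h1 by (simp add: line_expo_def)
  also have "\<dots> = g \<otimes> a i (\<alpha> \<otimes>\<^bsub>R\<^esub> \<beta>) \<otimes> inv g"
    by (rule some_equality) (use i uniq in blast)+
  finally show ?thesis .
qed

definition line_exp_group :: "('a, 'h) exp_group" where
  "line_exp_group = \<lparr>carrier = carrier H, monoid.mult = monoid.mult H, one = \<one>, expo = line_expo\<rparr>"

lemma exp_group_simps [simp]: "carrier line_exp_group = carrier H"
  "x \<otimes>\<^bsub>line_exp_group\<^esub> y = x \<otimes> y" "\<one>\<^bsub>line_exp_group\<^esub> = \<one>" "x \<up>\<^bsub>line_exp_group\<^esub> \<alpha> = line_expo x \<alpha>"
  by (simp_all add: line_exp_group_def)

lemma exp_group_inv [simp]: "inv\<^bsub>line_exp_group\<^esub> x = inv x"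
  by (simp add: m_inv_def)

lemma line_expo_one [simp]: "line_expo \<one> \<alpha> = \<one>"
  by (simp add: line_expo_def)

lemma line_cases:
  assumes "h \<in> carrier H" "h = \<one> \<Longrightarrow> Q"
    "\<And>i \<alpha> g. \<lbrakk>i \<in> P; \<alpha> \<in> carrier R; g \<in> carrier H; \<alpha> \<noteq> \<zero>\<^bsub>R\<^esub>; h = g \<otimes> a i \<alpha> \<otimes> inv g\<rbrakk> \<Longrightarrow> Q"
  shows Q
  using assms on_lineE by metis

theorem line_exp_group: "exp_group R line_exp_group"
proof -
  have "group line_exp_group"
    by (rule groupI) (auto simp: S.m_assoc intro: bexI[of _ "inv _"])
  moreover have "exp_group_axioms R line_exp_group"
  proof (rule exp_group_axioms.intro, goal_cases)
    case (1 g \<alpha>)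
    then show ?case by (auto elim!: line_cases[of g] simp: line_expo_eq)
  next
    case (2 g)
    then show ?case by (auto elim!: line_cases[of g] simp: line_expo_eq)
  next
    case (3 g)
    then show ?case by (auto elim!: line_cases[of g] simp: line_expo_eq)
  next
    case (5 g \<alpha> \<beta>)
    then have g: "g \<in> carrier H" by simp
    show ?case
    proof (rule line_cases[OF g])
      fix i \<gamma> k assume k: "i \<in> P" "\<gamma> \<in> carrier R" "k \<in> carrier H" "g = k \<otimes> a i \<gamma> \<otimes> inv k"
      have "line_expo g (\<alpha> \<oplus>\<^bsub>R\<^esub> \<beta>) = k \<otimes> (a i (\<gamma> \<otimes>\<^bsub>R\<^esub> \<alpha>) \<otimes> a i (\<gamma> \<otimes>\<^bsub>R\<^esub> \<beta>)) \<otimes> inv k"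
        using k 5 by (simp add: line_expo_eq R.r_distr flip: a_add)
      also have "\<dots> = line_expo g \<alpha> \<otimes> line_expo g \<beta>"
        using k 5 by (simp add: line_expo_eq) (simp add: S.m_assoc)
      finally show ?thesis by simp
    qed simp
  next
    case (6 g \<alpha> \<beta>)
    then show ?case by (auto elim!: line_cases[of g] simp: line_expo_eq R.m_assoc)
  next
    case (7 g h \<alpha>)
    then have h: "h \<in> carrier H" by simp
    show ?case
    proof (rule line_cases[of g])
      fix i \<gamma> k assume k: "i \<in> P" "\<gamma> \<in> carrier R" "k \<in> carrier H" "g = k \<otimes> a i \<gamma> \<otimes> inv k"
      have conj: "inv h \<otimes> (k \<otimes> a i \<delta> \<otimes> inv k) \<otimes> h = (inv h \<otimes> k) \<otimes> a i \<delta> \<otimes> inv (inv h \<otimes> k)"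
        if "\<delta> \<in> carrier R" for \<delta>
        using k h that by (simp add: S.inv_mult_group S.m_assoc)
      show ?thesis
        using k h 7 conj[of \<gamma>] conj[of "\<gamma> \<otimes>\<^bsub>R\<^esub> \<alpha>"] line_expo_eq[of i \<gamma> \<alpha> "inv h \<otimes> k"] by (simp add: line_expo_eq)
    qed (use 7 h in auto)
  next
    case (8 g h \<alpha>)
    then have gh: "g \<in> carrier H" "h \<in> carrier H" by simp_all
    have "inv (h \<otimes> g) \<otimes> (g \<otimes> h) = \<one>" using 8(4) gh by (simp add: S.inv_mult_group S.m_assoc)
    then have comm: "g \<otimes> h = h \<otimes> g"
      using gh S.inv_solve_left[of \<one> "h \<otimes> g" "g \<otimes> h"] by (metis S.inv_solve_left S.m_closed S.one_closed S.r_one)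
    show ?case
    proof (rule line_cases[OF gh(1)])
      fix i \<gamma> k assume k: "i \<in> P" "\<gamma> \<in> carrier R" "k \<in> carrier H" "\<gamma> \<noteq> \<zero>\<^bsub>R\<^esub>" "g = k \<otimes> a i \<gamma> \<otimes> inv k"
      \<comment> \<open>Commuting elements lie on a common line, where the axiom becomes
        distributivity in the ring.\<close>
      then obtain \<delta> where d: "\<delta> \<in> carrier R" "h = k \<otimes> a i \<delta> \<otimes> inv k"
        using on_same_line[of i \<gamma> k h] comm gh by auto
      have "g \<otimes> h = k \<otimes> a i (\<gamma> \<oplus>\<^bsub>R\<^esub> \<delta>) \<otimes> inv k" using k d by (simp add: a_add S.m_assoc)
      then have "line_expo (g \<otimes> h) \<alpha> = k \<otimes> a i ((\<gamma> \<oplus>\<^bsub>R\<^esub> \<delta>) \<otimes>\<^bsub>R\<^esub> \<alpha>) \<otimes> inv k"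
        using line_expo_eq[of i "\<gamma> \<oplus>\<^bsub>R\<^esub> \<delta>" \<alpha> k] k d 8 by simp
      also have "\<dots> = line_expo g \<alpha> \<otimes> line_expo h \<alpha>"
        using k d(1) 8(3) unfolding d(2) by (simp add: line_expo_eq) (simp add: R.l_distr a_add S.m_assoc)
      finally show ?thesis by simp
    next
      assume "g = \<one>"
      then show ?thesis using gh 8 by (auto elim!: line_cases[of h] simp: line_expo_eq)
    qed
  qed simp
  ultimately show ?thesis by (simp add: exp_group_def R.ring_axioms)
qed

text \<open>By commutation \<open>y\<close> lies on the line of \<open>x\<close>. So
  \<open>g\<close> conjugates one nontrivial element of this line to another one, and malnormality
  puts \<open>g\<close> on the line as well.\<close>

lemma commute_conj_imp_commute:
  assumes x: "x \<in> carrier H" "y \<in> carrier H" "g \<in> carrier H" "x \<noteq> \<one>" "y \<noteq> \<one>"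
    and xy: "x \<otimes> y = y \<otimes> x" and yg: "y \<otimes> g = g \<otimes> x"
  shows "x \<otimes> g = g \<otimes> x"
proof -
  obtain i \<alpha> k where k: "i \<in> P" "\<alpha> \<in> carrier R" "k \<in> carrier H" "\<alpha> \<noteq> \<zero>\<^bsub>R\<^esub>" "x = k \<otimes> a i \<alpha> \<otimes> inv k"
    using on_lineE[OF x(1,4)] .
  obtain \<beta> where b: "\<beta> \<in> carrier R" "y = k \<otimes> a i \<beta> \<otimes> inv k"
    using on_same_line[OF k(1-3) x(2) k(4)] xy k(5) by auto
  have b0: "\<beta> \<noteq> \<zero>\<^bsub>R\<^esub>" using b x k by auto
  have "(k \<otimes> a i \<beta> \<otimes> inv k) \<otimes> (g \<otimes> k) = (g \<otimes> k) \<otimes> a i \<alpha>"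
  proof -
    have "(k \<otimes> a i \<beta> \<otimes> inv k) \<otimes> (g \<otimes> k) = (y \<otimes> g) \<otimes> k" using b k x by (simp add: S.m_assoc)
    also have "\<dots> = (g \<otimes> k) \<otimes> a i \<alpha>" unfolding yg using k x(3) by (simp add: k(5) S.m_assoc)
    finally show ?thesis .
  qed
  then obtain \<gamma> where c: "\<gamma> \<in> carrier R" "g \<otimes> k = k \<otimes> a i \<gamma>"
    using line_param_unique(2)[of i i \<beta> \<alpha> k "g \<otimes> k"] b b0 k x by auto
  then have g: "g = k \<otimes> a i \<gamma> \<otimes> inv k" using k x by (simp add: S.eq_mult_inv_iff)
  have "x \<otimes> g = k \<otimes> (a i \<alpha> \<otimes> a i \<gamma>) \<otimes> inv k" "g \<otimes> x = k \<otimes> (a i \<gamma> \<otimes> a i \<alpha>) \<otimes> inv k"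
    unfolding g k(5) using k c by (simp_all add: S.m_assoc)
  then show ?thesis using a_comm[of i \<alpha> \<gamma>] k c by simp
qed

lemma commute_trans:
  assumes x: "x \<in> carrier H" "y \<in> carrier H" "z \<in> carrier H" "y \<noteq> \<one>"
    and xy: "x \<otimes> y = y \<otimes> x" and yz: "y \<otimes> z = z \<otimes> y"
  shows "x \<otimes> z = z \<otimes> x"
proof -
  obtain i \<alpha> k where k: "i \<in> P" "\<alpha> \<in> carrier R" "k \<in> carrier H" "\<alpha> \<noteq> \<zero>\<^bsub>R\<^esub>" "y = k \<otimes> a i \<alpha> \<otimes> inv k"
    using on_lineE[OF x(2,4)] .
  obtain \<beta> where b: "\<beta> \<in> carrier R" "x = k \<otimes> a i \<beta> \<otimes> inv k"
    using on_same_line[OF k(1-3) x(1) k(4)] xy k(5) by auto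
  obtain \<gamma> where c: "\<gamma> \<in> carrier R" "z = k \<otimes> a i \<gamma> \<otimes> inv k"
    using on_same_line[OF k(1-3) x(3) k(4)] yz k(5) by auto
  have "x \<otimes> z = k \<otimes> (a i \<beta> \<otimes> a i \<gamma>) \<otimes> inv k" "z \<otimes> x = k \<otimes> (a i \<gamma> \<otimes> a i \<beta>) \<otimes> inv k"
    unfolding b(2) c(2) using k b(1) c(1) by (simp_all add: S.m_assoc)
  then show ?thesis using a_comm[of i \<beta> \<gamma>] k b c by simp
qed

lemma torsion_free_lines:
  assumes tf: "torsion_free (add_monoid R)" and h: "h \<in> carrier H" "h [^] (n::nat) = \<one>" "0 < n"
  shows "h = \<one>"
proof (rule ccontr)
  assume "h \<noteq> \<one>"
  then obtain i \<alpha> k where k: "i \<in> P" "\<alpha> \<in> carrier R" "k \<in> carrier H" "\<alpha> \<noteq> \<zero>\<^bsub>R\<^esub>" "h = k \<otimes> a i \<alpha> \<otimes> inv k"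
    using on_lineE h(1) by metis
  have M: "group (add_monoid R)" using R.a_comm_group by (simp add: comm_group_def)
  have pow: "a i \<alpha> [^] (m::nat) = a i (\<alpha> [^]\<^bsub>add_monoid R\<^esub> m) \<and> \<alpha> [^]\<^bsub>add_monoid R\<^esub> m \<in> carrier R" for m
    using k monoid.nat_pow_closed[OF group.is_monoid[OF M], of \<alpha>] by (induction m) (simp_all add: a_add)
  have "h \<otimes> k = k \<otimes> a i \<alpha>" using k h S.eq_mult_inv_iff by simp
  then have "h [^] n \<otimes> k = k \<otimes> a i \<alpha> [^] n" using S.intertwine_nat_pow[of h k "a i \<alpha>" n] h(1) k(1-3) by simp
  then have "a i \<alpha> [^] n = \<one>" using k(1-3) by (simp add: h(2))
  then have "\<alpha> [^]\<^bsub>add_monoid R\<^esub> n = \<zero>\<^bsub>R\<^esub>" using pow[of n] a_eq_one_iff k by simp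
  then show False using tf h(3) k unfolding torsion_free_def by auto
qed

end

section \<open>Commutative transitivity and conjugate separation\<close>

text \<open>Commutative transitivity and an elementwise form of conjugate separation. All three
  assumptions are universal implications between equations, so they pass to every group that
  embeds.\<close>

locale csa_group = group +
  assumes csa_torsion_free: "\<lbrakk>x \<in> carrier G; x [^] (n::nat) = \<one>; 0 < n\<rbrakk> \<Longrightarrow> x = \<one>"
    and comm_trans: "\<lbrakk>x \<in> carrier G; y \<in> carrier G; z \<in> carrier G; y \<noteq> \<one>;
      x \<otimes> y = y \<otimes> x; y \<otimes> z = z \<otimes> y\<rbrakk> \<Longrightarrow> x \<otimes> z = z \<otimes> x"
    and comm_conj: "\<lbrakk>x \<in> carrier G; y \<in> carrier G; g \<in> carrier G; x \<noteq> \<one>; y \<noteq> \<one>;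
      x \<otimes> y = y \<otimes> x; y \<otimes> g = g \<otimes> x\<rbrakk> \<Longrightarrow> x \<otimes> g = g \<otimes> x"

lemma csa_group_of_embedding:
  assumes H: "csa_group H" and hom: "group_hom G H h" and inj: "inj_on h (carrier G)"
  shows "csa_group G"
proof -
  interpret H: csa_group H by (rule H)
  interpret h: group_hom G H h by (rule hom)
  have one: "h x \<noteq> \<one>\<^bsub>H\<^esub>" if "x \<in> carrier G" "x \<noteq> \<one>\<^bsub>G\<^esub>" for x
    using inj_onD[OF inj, of x "\<one>\<^bsub>G\<^esub>"] that by auto
  have transfer: "h x \<otimes>\<^bsub>H\<^esub> h y = h z \<otimes>\<^bsub>H\<^esub> h w \<longleftrightarrow> x \<otimes>\<^bsub>G\<^esub> y = z \<otimes>\<^bsub>G\<^esub> w"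
    if "x \<in> carrier G" "y \<in> carrier G" "z \<in> carrier G" "w \<in> carrier G" for x y z w
    using inj_onD[OF inj, of "x \<otimes>\<^bsub>G\<^esub> y" "z \<otimes>\<^bsub>G\<^esub> w"] that by (auto simp flip: h.hom_mult)
  show ?thesis
  proof
    fix x and n :: nat
    assume "x \<in> carrier G" "x [^]\<^bsub>G\<^esub> n = \<one>\<^bsub>G\<^esub>" "0 < n"
    then show "x = \<one>\<^bsub>G\<^esub>"
      using H.csa_torsion_free[of "h x" n] h.hom_nat_pow[of x n] one[of x] by auto
  next
    fix x y z
    assume *: "x \<in> carrier G" "y \<in> carrier G" "z \<in> carrier G" "y \<noteq> \<one>\<^bsub>G\<^esub>"
      "x \<otimes>\<^bsub>G\<^esub> y = y \<otimes>\<^bsub>G\<^esub> x" "y \<otimes>\<^bsub>G\<^esub> z = z \<otimes>\<^bsub>G\<^esub> y"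
    then show "x \<otimes>\<^bsub>G\<^esub> z = z \<otimes>\<^bsub>G\<^esub> x"
      using H.comm_trans[of "h x" "h y" "h z"] one[of y] by (simp add: transfer)
  next
    fix x y g
    assume *: "x \<in> carrier G" "y \<in> carrier G" "g \<in> carrier G" "x \<noteq> \<one>\<^bsub>G\<^esub>" "y \<noteq> \<one>\<^bsub>G\<^esub>"
      "x \<otimes>\<^bsub>G\<^esub> y = y \<otimes>\<^bsub>G\<^esub> x" "y \<otimes>\<^bsub>G\<^esub> g = g \<otimes>\<^bsub>G\<^esub> x"
    then show "x \<otimes>\<^bsub>G\<^esub> g = g \<otimes>\<^bsub>G\<^esub> x"
      using H.comm_conj[of "h x" "h y" "h g"] one[of x] one[of y] by (simp add: transfer)
  qed
qed

lemma (in full_line_system) csa_group: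
  assumes "torsion_free (add_monoid R)"
  shows "csa_group H"
  by unfold_locales (use torsion_free_lines[OF assms] commute_trans commute_conj_imp_commute in blast)+

context csa_group
begin

lemma csa_subgroup:
  assumes "subgroup H G"
  shows "csa_group (G\<lparr>carrier := H\<rparr>)"
proof (rule csa_group_of_embedding)
  show "csa_group G" by (rule csa_group_axioms)
  show "group_hom (G\<lparr>carrier := H\<rparr>) G (\<lambda>x. x)"
    using subgroup.subset[OF assms] subgroup_imp_group[OF assms]
    by (auto simp: group_hom_def group_hom_axioms_def hom_def is_group)
qed simp

definition centralizer_of :: "'a \<Rightarrow> 'a set" where
  "centralizer_of m = {y \<in> carrier G. m \<otimes> y = y \<otimes> m}"

lemma centralizer_abelian:
  assumes m: "m \<in> carrier G" "m \<noteq> \<one>"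
  shows "abelian_subgroup (centralizer_of m) G"
proof -
  have sub: "subgroup (centralizer_of m) G"
  proof (rule subgroupI)
    fix y assume y: "y \<in> centralizer_of m"
    then show "inv y \<in> centralizer_of m"
      using intertwine_sym[of m y m] m by (auto simp: centralizer_of_def)
  next
    fix y z assume "y \<in> centralizer_of m" "z \<in> centralizer_of m"
    then show "y \<otimes> z \<in> centralizer_of m"
      using intertwine_trans[of m y m z m] m by (auto simp: centralizer_of_def)
  qed (use m in \<open>auto simp: centralizer_of_def\<close>)
  moreover have "y \<otimes> z = z \<otimes> y" if "y \<in> centralizer_of m" "z \<in> centralizer_of m" for y z
    using comm_trans[of y m z] that m by (auto simp: centralizer_of_def)
  ultimately show ?thesis
    unfolding abelian_subgroup_def
    by (auto intro!: group.group_comm_groupI[OF subgroup_imp_group[OF sub]])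
qed

lemma abelian_subgroup_commute:
  "\<lbrakk>abelian_subgroup M G; x \<in> M; y \<in> M\<rbrakk> \<Longrightarrow> x \<otimes> y = y \<otimes> x"
  using comm_monoid.m_comm[of "G\<lparr>carrier := M\<rparr>" x y] by (auto simp: abelian_subgroup_def comm_group_def)

text \<open>A nontrivial \<open>m\<close> in the intersection commutes with \<open>x\<close> by
  \<open>comm_conj\<close>. Its centralizer is abelian and contains \<open>M\<close>, so it equals
  \<open>M\<close> by maximality, and \<open>x\<close> would lie in \<open>M\<close>.\<close>

theorem maximal_abelian_conjugately_separated:
  assumes M: "maximal_abelian_subgroup M G"
  shows "conjugately_separated M G"
  unfolding conjugately_separated_def
proof (intro ballI equalityI subsetI)
  have ab: "abelian_subgroup M G" and sub: "subgroup M G"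
    using M by (auto simp: maximal_abelian_subgroup_def abelian_subgroup_def)
  fix x m assume x: "x \<in> carrier G - M" and "m \<in> M \<inter> (\<lambda>h. inv x \<otimes> h \<otimes> x) ` M"
  then obtain h where h: "m \<in> M" "h \<in> M" "m = inv x \<otimes> h \<otimes> x" by auto
  have c: "m \<in> carrier G" "h \<in> carrier G" using h subgroup.mem_carrier[OF sub] by auto
  have hx: "h \<otimes> x = x \<otimes> m" using x c by (simp add: h(3) m_assoc)
  show "m \<in> {\<one>}"
  proof (rule ccontr)
    assume m1: "m \<notin> {\<one>}"
    have "h \<noteq> \<one>" using hx m1 x c by auto
    then have "m \<otimes> x = x \<otimes> m"
      using comm_conj[of m h x] abelian_subgroup_commute[OF ab h(1,2)] hx m1 c x by auto
    then have "x \<in> centralizer_of m" using x by (simp add: centralizer_of_def)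
    moreover have "M \<subseteq> centralizer_of m"
      using abelian_subgroup_commute[OF ab h(1)] subgroup.mem_carrier[OF sub] by (auto simp: centralizer_of_def)
    then have "centralizer_of m = M"
      using M centralizer_abelian c(1) m1 unfolding maximal_abelian_subgroup_def by blast
    ultimately show False using x by simp
  qed
next
  fix x m assume x: "x \<in> carrier G - M" and m: "m \<in> {\<one>}"
  have "\<one> \<in> M"
    using M by (auto simp: maximal_abelian_subgroup_def abelian_subgroup_def subgroup.one_closed)
  then show "m \<in> M \<inter> (\<lambda>h. inv x \<otimes> h \<otimes> x) ` M"
    using x m by (auto intro!: image_eqI[of _ _ \<one>])
qed

text \<open>Commutativity climbs up the derived series. A nontrivial \<open>z\<close> in an abelian
  term commutes with its conjugate by any \<open>x\<close> of the preceding term, hence with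
  \<open>x\<close> by \<open>comm_conj\<close>; transitivity through \<open>z\<close> makes the
  preceding term abelian.\<close>

theorem solvable_imp_comm:
  assumes "solvable G"
  shows "comm_group G"
proof -
  define D where "D n = (derived G ^^ n) (carrier G)" for n
  have D_sub: "subgroup (D n) G" for n
    unfolding D_def by (rule exp_of_derived_is_subgroup[OF subgroup_self])
  have D_carrier: "D n \<subseteq> carrier G" for n using subgroup.subset[OF D_sub] .
  have D_Suc: "D (Suc n) = derived G (D n)" for n by (simp add: D_def)
  have commutator: "x \<otimes> y \<otimes> inv x \<otimes> inv y \<in> D (Suc n)" if "x \<in> D n" "y \<in> D n" for x y n
    unfolding D_Suc derived_def using that by (intro generate.incl) blast
  have D_decr: "D (Suc n) \<subseteq> D n" for n
    unfolding D_Suc by (rule derived_incl[OF order_refl D_sub])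
  have step: "\<forall>x\<in>D n. \<forall>y\<in>D n. x \<otimes> y = y \<otimes> x" if ab: "\<forall>x\<in>D (Suc n). \<forall>y\<in>D (Suc n). x \<otimes> y = y \<otimes> x" for n
  proof (cases "D (Suc n) \<subseteq> {\<one>}")
    case True
    show ?thesis
    proof (intro ballI)
      fix x y assume xy: "x \<in> D n" "y \<in> D n"
      then have c: "x \<in> carrier G" "y \<in> carrier G" using D_carrier by auto
      have "x \<otimes> y \<otimes> inv x \<otimes> inv y = \<one>" using commutator[OF xy] True by auto
      then show "x \<otimes> y = y \<otimes> x" using c by (simp add: inv_solve_right')
    qed
  next
    case False
    then obtain z where z: "z \<in> D (Suc n)" "z \<noteq> \<one>" by auto
    have zc: "z \<in> carrier G" "z \<in> D n" using z D_carrier D_decr by auto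
    have comm: "z \<otimes> x = x \<otimes> z" if x: "x \<in> D n" for x
    proof -
      have xc: "x \<in> carrier G" using x D_carrier by auto
      define y where "y = x \<otimes> z \<otimes> inv x"
      \<comment> \<open>The conjugate differs from \<open>z\<close> by a commutator, so it stays in
        the next derived subgroup.\<close>
      have "y = (x \<otimes> z \<otimes> inv x \<otimes> inv z) \<otimes> z" using xc zc by (simp add: y_def)
      then have yD: "y \<in> D (Suc n)"
        using subgroup.m_closed[OF D_sub commutator[OF x zc(2)] z(1)] by simp
      have yc: "y \<in> carrier G" "y \<otimes> x = x \<otimes> z" using xc zc by (simp_all add: y_def)
      have "y \<noteq> \<one>" using yc xc zc z(2) by auto
      then show ?thesis using comm_conj[of z y x] zc(1) yc xc z ab yD by blast
    qed
    show ?thesis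
    proof (intro ballI)
      fix x y assume xy: "x \<in> D n" "y \<in> D n"
      then show "x \<otimes> y = y \<otimes> x" using comm_trans[of x z y] comm[of x] comm[of y] zc z D_carrier by (metis subsetD)
    qed
  qed
  obtain n where n: "D n = {\<one>}" using assms solvable_iff_trivial_derived_seq by (auto simp: D_def)
  have "\<forall>x\<in>D (n - k). \<forall>y\<in>D (n - k). x \<otimes> y = y \<otimes> x" for k
  proof (induction k)
    case (Suc k)
    show ?case
    proof (cases "k < n")
      case True
      then have "Suc (n - Suc k) = n - k" by simp
      then show ?thesis using step[of "n - Suc k"] Suc by simp
    qed (use Suc in simp)
  qed (simp add: n)
  from this[of n] show ?thesis by (intro group_comm_groupI) (auto simp: D_def)
qed

text \<open>For nontrivial \<open>b\<close>, torsion-freeness makes \<open>b [^] r\<close>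
  nontrivial, and with it its conjugate \<open>b [^] s\<close>. The two powers commute, so
  \<open>a\<close> commutes with \<open>b [^] s\<close> by \<open>comm_conj\<close>, and with
  \<open>b\<close> by transitivity.\<close>

lemma baumslag_solitar_relation_imp_commute:
  assumes ab: "a \<in> carrier G" "b \<in> carrier G" and r: "r \<noteq> 0"
    and rel: "b [^] (r::int) \<otimes> a = a \<otimes> b [^] (s::int)"
  shows "a \<otimes> b = b \<otimes> a"
proof (cases "b = \<one>")
  case False
  have inf: "b [^] k \<noteq> \<one>" if "k \<noteq> 0" for k :: int
  proof
    assume k: "b [^] k = \<one>"
    have "b [^] nat \<bar>k\<bar> = b [^] k \<or> b [^] nat \<bar>k\<bar> = inv (b [^] k)"
      using ab int_pow_int[of G b "nat \<bar>k\<bar>"] int_pow_neg[of b k] by (cases "k \<ge> 0") auto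
    then have "b [^] nat \<bar>k\<bar> = \<one>" using k by auto
    then show False using csa_torsion_free[OF ab(2), of "nat \<bar>k\<bar>"] that False by simp
  qed
  have br: "b [^] r \<noteq> \<one>" using inf r by simp
  have bs: "b [^] s \<noteq> \<one>"
  proof
    assume "b [^] s = \<one>"
    then have "b [^] r \<otimes> a = a" using rel ab by simp
    then show False using br ab by simp
  qed
  have pw: "b [^] k \<otimes> b [^] l = b [^] l \<otimes> b [^] k" for k l :: int
    using ab by (metis add.commute int_pow_mult)
  have "b [^] s \<otimes> a = a \<otimes> b [^] s"
    using comm_conj[of "b [^] s" "b [^] r" a] rel br bs pw ab by simp
  moreover have "b [^] s \<otimes> b = b \<otimes> b [^] s" using pw[of s 1] ab by simp
  ultimately show ?thesis using comm_trans[of a "b [^] s" b] bs ab by simp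
qed (use ab in simp)

lemma comm_group_of_commute_with:
  assumes "z \<in> carrier G" "z \<noteq> \<one>" "\<And>x. x \<in> carrier G \<Longrightarrow> z \<otimes> x = x \<otimes> z"
  shows "comm_group G"
proof (rule group_comm_groupI)
  fix x y assume "x \<in> carrier G" "y \<in> carrier G"
  then show "x \<otimes> y = y \<otimes> x" using comm_trans[of x z y] assms by simp
qed

theorem center_trivial:
  assumes "\<not> comm_group G"
  shows "center G = {\<one>}"
proof -
  have "z = \<one>" if "z \<in> center G" for z
    using comm_group_of_commute_with[of z] that assms unfolding center_def by blast
  then show ?thesis by (auto simp: center_def)
qed

text \<open>Elements of different factors commute. Hence a nontrivial \<open>h\<close> of one factor
  commutes with its own factor by transitivity through a nontrivial \<open>k\<close> of the other,
  and a nontrivial central element makes the group abelian.\<close>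

theorem indecomposable:
  assumes "\<not> comm_group G"
  shows "directly_indecomposable G"
  unfolding directly_indecomposable_def
proof
  assume "\<exists>H K. internal_direct_product G H K \<and> H \<noteq> {\<one>} \<and> K \<noteq> {\<one>}"
  then obtain H K where *: "H \<lhd> G" "K \<lhd> G" "H \<inter> K = {\<one>}" "H <#> K = carrier G" "H \<noteq> {\<one>}" "K \<noteq> {\<one>}"
    by (auto simp: internal_direct_product_def)
  have sub: "subgroup H G" "subgroup K G" using * by (auto simp: normal_imp_subgroup)
  have carr: "H \<subseteq> carrier G" "K \<subseteq> carrier G" using sub by (auto simp: subgroup.subset)
  have comm: "h \<otimes> k = k \<otimes> h" if hk: "h \<in> H" "k \<in> K" for h k
  proof -
    have c: "h \<in> carrier G" "k \<in> carrier G" using hk carr by auto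
    have "h \<otimes> k \<otimes> inv h \<in> K" "k \<otimes> inv h \<otimes> inv k \<in> H"
      using * sub hk c by (auto simp: normal_inv_iff subgroup.m_inv_closed)
    then have "h \<otimes> k \<otimes> inv h \<otimes> inv k \<in> K" "h \<otimes> (k \<otimes> inv h \<otimes> inv k) \<in> H"
      using sub hk by (auto intro: subgroup.m_closed subgroup.m_inv_closed)
    then have "h \<otimes> k \<otimes> inv h \<otimes> inv k = \<one>" using *(3) c by (auto simp: m_assoc)
    then show ?thesis using c by (simp add: inv_solve_right')
  qed
  obtain h k where h: "h \<in> H" "h \<noteq> \<one>" and k: "k \<in> K" "k \<noteq> \<one>"
    using *(5,6) subgroup.one_closed[OF sub(1)] subgroup.one_closed[OF sub(2)] by blast
  have "h \<otimes> x = x \<otimes> h" if xG: "x \<in> carrier G" for x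
  proof -
    have "x \<in> H <#> K" using *(4) xG by simp
    then obtain h' k' where x: "h' \<in> H" "k' \<in> K" "x = h' \<otimes> k'" unfolding set_mult_def by blast
    have c: "h \<in> carrier G" "h' \<in> carrier G" "k' \<in> carrier G" "k \<in> carrier G" using x h k carr by auto
    have "h \<otimes> h' = h' \<otimes> h" 
      using comm_trans[OF c(1,4,2) k(2) comm[OF h(1) k(1)] comm[OF x(1) k(1), symmetric]] .
    then show ?thesis using intertwine_trans[of h h' h k' h] comm[OF h(1) x(2)] c x by simp
  qed
  then show False using comm_group_of_commute_with[of h] assms h carr by blast
qed

end

section \<open>Baumslag--Solitar groups\<close>

lemma free_group_simps:
  "carrier (free_group X) = {w. reduced w \<and> fst ` set w \<subseteq> X}"
  "u \<otimes>\<^bsub>free_group X\<^esub> v = reduce (u @ v)" "\<one>\<^bsub>free_group X\<^esub> = []"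
  by (simp_all add: free_group_def)

lemma free_group_hom_commute:
  assumes hom: "group_hom (free_group X) G h" and y: "y \<in> carrier G"
    and gen: "\<And>x. x \<in> X \<Longrightarrow> h (free_gen x) \<otimes>\<^bsub>G\<^esub> y = y \<otimes>\<^bsub>G\<^esub> h (free_gen x)"
    and w: "w \<in> carrier (free_group X)"
  shows "h w \<otimes>\<^bsub>G\<^esub> y = y \<otimes>\<^bsub>G\<^esub> h w"
  using w
proof (induction w)
  interpret h: group_hom "free_group X" G h by (rule hom)
  case Nil
  then show ?case using y h.hom_one by (simp add: free_group_simps)
next
  interpret h: group_hom "free_group X" G h by (rule hom)
  case (Cons l w)
  have w: "w \<in> carrier (free_group X)" "[l] \<in> carrier (free_group X)" "fst l \<in> X"
    using Cons.prems by (auto simp: free_group_simps successively_Cons)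
  have g: "free_gen (fst l) \<in> carrier (free_group X)" using w by (simp add: free_group_simps free_gen_def)
  have "h [l] \<otimes>\<^bsub>G\<^esub> y = y \<otimes>\<^bsub>G\<^esub> h [l]"
  proof (cases "snd l")
    case True
    then have "[l] = free_gen (fst l)" by (cases l) (simp add: free_gen_def)
    then show ?thesis using gen w by simp
  next
    case False
    have "[l] \<otimes>\<^bsub>free_group X\<^esub> free_gen (fst l) = \<one>\<^bsub>free_group X\<^esub>"
      using False by (cases l) (simp add: free_group_simps free_gen_def reduce_def inv_letter_def)
    then have "[l] = inv\<^bsub>free_group X\<^esub> (free_gen (fst l))"
      using w g by (simp add: h.G.inv_equality)
    then show ?thesis using h.H.intertwine_inv[OF gen[OF w(3)]] g y by simp
  qed
  moreover have "l # w = [l] \<otimes>\<^bsub>free_group X\<^esub> w"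
    using Cons.prems by (simp add: free_group_simps reduce_reduced)
  then have "h (l # w) = h [l] \<otimes>\<^bsub>G\<^esub> h w" using w h.hom_mult by metis
  ultimately show ?case
    using Cons.IH[OF w(1)] h.hom_closed[OF w(1)] h.hom_closed[OF w(2)] y
    by (metis h.H.m_assoc)
qed

lemma (in group) normal_closure_normal:
  assumes "S \<subseteq> carrier G"
  shows "normal_closure G S \<lhd> G"
  unfolding normal_closure_def
proof (rule normal_generateI)
  show "{inv g \<otimes> s \<otimes> g | g s. g \<in> carrier G \<and> s \<in> S} \<subseteq> carrier G" using assms by auto
  fix h g assume "h \<in> {inv g \<otimes> s \<otimes> g | g s. g \<in> carrier G \<and> s \<in> S}" and g: "g \<in> carrier G"
  then obtain k s where k: "k \<in> carrier G" "s \<in> S" "h = inv k \<otimes> s \<otimes> k" by auto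
  have "g \<otimes> h \<otimes> inv g = inv (k \<otimes> inv g) \<otimes> s \<otimes> (k \<otimes> inv g)"
    using k g assms by (auto simp: inv_mult_group m_assoc subset_iff)
  then show "g \<otimes> h \<otimes> inv g \<in> {inv g \<otimes> s \<otimes> g | g s. g \<in> carrier G \<and> s \<in> S}"
    using k g by blast
qed

lemma (in group) subset_normal_closure:
  assumes "S \<subseteq> carrier G" "s \<in> S"
  shows "s \<in> normal_closure G S"
proof -
  have "s = inv \<one> \<otimes> s \<otimes> \<one>" using assms by auto
  then show ?thesis unfolding normal_closure_def using assms by (intro generate.incl) blast
qed

theorem (in csa_group) baumslag_solitar_imp_comm:
  assumes r: "r \<noteq> 0" and iso: "G \<cong> baumslag_solitar r s"
  shows "comm_group G"
proof -
  let ?F = "free_group (UNIV :: bs_gen set)"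
  interpret F: group ?F by (rule group_free_group)
  define a b where "a = free_gen BS_a" and "b = free_gen BS_b"
  have ab: "a \<in> carrier ?F" "b \<in> carrier ?F" by (simp_all add: a_def b_def free_group_simps free_gen_def)
  define R where "R = inv\<^bsub>?F\<^esub> a \<otimes>\<^bsub>?F\<^esub> b [^]\<^bsub>?F\<^esub> r \<otimes>\<^bsub>?F\<^esub> a \<otimes>\<^bsub>?F\<^esub> b [^]\<^bsub>?F\<^esub> (- s)"
  have R: "R \<in> carrier ?F" using ab by (simp add: R_def)
  define N where "N = normal_closure ?F {R}"
  have Q: "baumslag_solitar r s = ?F Mod N"
    by (simp add: baumslag_solitar_def presented_group_def N_def R_def a_def b_def Let_def)
  interpret N: normal N ?F unfolding N_def using F.normal_closure_normal R by simp
  interpret Q: group "?F Mod N" by (rule N.factorgroup_is_group)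
  obtain f where "f \<in> iso G (?F Mod N)" using iso by (auto simp: Q is_iso_def)
  then have h: "inv_into (carrier G) f \<in> iso (?F Mod N) G" by (rule iso_set_sym)
  \<comment> \<open>The projection followed by the inverse isomorphism presents the group as a
    quotient of the free group, generated by two elements that satisfy the relation.\<close>
  define \<theta> where "\<theta> = inv_into (carrier G) f \<circ> (\<lambda>w. N #>\<^bsub>?F\<^esub> w)"
  have "\<theta> \<in> hom ?F G"
    unfolding \<theta>_def using N.r_coset_hom_Mod h by (intro Group.hom_compose) (auto simp: Group.iso_def)
  then interpret \<theta>: group_hom ?F G \<theta> by unfold_locales
  have surj: "\<exists>w\<in>carrier ?F. x = \<theta> w" if "x \<in> carrier G" for x
  proof -
    have "x \<in> inv_into (carrier G) f ` carrier (?F Mod N)" using h that by (auto simp: iso_def bij_betw_def)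
    then show ?thesis by (auto simp: \<theta>_def FactGroup_def RCOSETS_def)
  qed
  have "N #>\<^bsub>?F\<^esub> R = N"
    using F.subset_normal_closure[of "{R}" R] R by (intro F.coset_join2[OF R N.subgroup_axioms]) (auto simp: N_def)
  then have "\<theta> R = inv_into (carrier G) f \<one>\<^bsub>?F Mod N\<^esub>" by (simp add: \<theta>_def)
  also have "\<dots> = \<one>" using h by (intro hom_one[OF _ Q.group_axioms is_group]) (simp add: Group.iso_def)
  finally have "inv (\<theta> a) \<otimes> \<theta> b [^] r \<otimes> \<theta> a \<otimes> \<theta> b [^] (- s) = \<one>"
    using ab by (simp add: R_def \<theta>.hom_int_pow)
  then have "inv (\<theta> a) \<otimes> \<theta> b [^] r \<otimes> \<theta> a = \<theta> b [^] s"
    using ab by (simp add: int_pow_neg inv_solve_right')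
  then have "\<theta> a \<otimes> (inv (\<theta> a) \<otimes> \<theta> b [^] r \<otimes> \<theta> a) = \<theta> a \<otimes> \<theta> b [^] s" by simp
  then have rel: "\<theta> b [^] r \<otimes> \<theta> a = \<theta> a \<otimes> \<theta> b [^] s" using ab by (simp add: m_assoc)
  have comm: "\<theta> a \<otimes> \<theta> b = \<theta> b \<otimes> \<theta> a"
    using baumslag_solitar_relation_imp_commute[OF _ _ r rel] ab by simp
  have gen: "\<theta> (free_gen x) \<otimes> y = y \<otimes> \<theta> (free_gen x)"
    if "\<theta> a \<otimes> y = y \<otimes> \<theta> a" "\<theta> b \<otimes> y = y \<otimes> \<theta> b" for x y
    using that by (cases x) (auto simp: a_def b_def)
  note fc = free_group_hom_commute[OF \<theta>.group_hom_axioms]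
  \<comment> \<open>Two passes over words: first every value commutes with the two generators, then
    with every other value.\<close>
  have 1: "\<theta> w \<otimes> \<theta> a = \<theta> a \<otimes> \<theta> w" "\<theta> w \<otimes> \<theta> b = \<theta> b \<otimes> \<theta> w" if "w \<in> carrier ?F" for w
    using fc[of "\<theta> a" w] fc[of "\<theta> b" w] gen comm ab that by auto
  have 2: "\<theta> v \<otimes> \<theta> w = \<theta> w \<otimes> \<theta> v" if "v \<in> carrier ?F" "w \<in> carrier ?F" for v w
    using fc[of "\<theta> w" v] gen[of "\<theta> w"] 1[OF that(2)] that by auto
  show ?thesis
  proof (rule group_comm_groupI)
    fix x y assume "x \<in> carrier G" "y \<in> carrier G"
    then show "x \<otimes> y = y \<otimes> x" using surj 2 by metis
  qed
qed

section \<open>Free groups with exponents\<close>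

text \<open>The retraction \<open>name_value\<close> gives injectivity of the map to the tower. The
  claim on words holds because each generator is sent to coordinate 1 on the line of its
  atom.\<close>

lemma free_exp_group_embedding:
  fixes A :: "('a, 'm) ring_scheme" and G :: "('a, 'g, 'k) exp_group_scheme" and X :: "'g set"
  assumes "characteristic_zero A" and tf: "torsion_free (add_monoid A)" and free: "free_exp_group A G X"
  shows "\<exists>(H :: ('g, 'a) name monoid) \<psi>. csa_group H \<and> group_hom G H \<psi> \<and> inj_on \<psi> (carrier G) \<and>
    (\<forall>w \<in> carrier (free_group X). w \<noteq> [] \<longrightarrow> word_value H \<psi> w \<noteq> \<one>\<^bsub>H\<^esub>)"
proof -
  have G: "exp_group A G" "X \<subseteq> carrier G" "exp_generate A G X = carrier G"
    using free by (auto simp: free_exp_group_def)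
  interpret exp_group_tower A G X
    using G assms by (auto simp: exp_group_tower_def exp_group_tower_axioms_def)
  obtain H :: "('g, 'a) name monoid" and P a where H: "line_system H M P (\<lambda>_. carrier A) a" "\<phi> \<in> hom H G"
    and \<phi>P: "\<forall>i\<in>P. \<phi> i \<in> carrier G"
    and \<phi>a: "\<forall>i\<in>P. \<forall>\<alpha>\<in>carrier A. \<phi> (a i \<alpha>) = \<phi> i \<up>\<^bsub>G\<^esub> \<alpha>"
    and XP: "Atom ` X \<subseteq> P"
    and words: "\<forall>w. reduced w \<longrightarrow> fst ` set w \<subseteq> Atom ` X \<longrightarrow> w \<noteq> [] \<longrightarrow>
      word_value H (\<lambda>i. a i \<one>\<^bsub>A\<^esub>) w \<noteq> \<one>\<^bsub>H\<^esub>"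
    using full_line_system_exists .
  note \<phi>P = \<phi>P[rule_format] and \<phi>a = \<phi>a[rule_format] and words = words[rule_format]
  interpret L: full_line_system A H P a
    using H(1) R.ring_axioms by (simp add: full_line_system_def)
  interpret \<phi>: group_hom H G \<phi>
    using H(2) G.group_axioms L.S.group_axioms by (simp add: group_hom_def group_hom_axioms_def)
  have XPi: "Atom x \<in> P" if "x \<in> X" for x using XP that by auto
  \<comment> \<open>\<open>\<phi>\<close> respects exponents on the lines themselves, and both sides
    are compatible with conjugation.\<close>
  have \<phi>_expo: "\<phi> (L.line_expo h \<beta>) = \<phi> h \<up>\<^bsub>G\<^esub> \<beta>" if h: "h \<in> carrier H" and \<beta>: "\<beta> \<in> carrier A" for h \<beta>
  proof (rule L.line_cases[OF h])
    assume "h = \<one>\<^bsub>H\<^esub>"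
    then show ?thesis using \<beta> by (simp add: one_expo)
  next
    fix i \<alpha> g assume *: "i \<in> P" "\<alpha> \<in> carrier A" "g \<in> carrier H" "h = g \<otimes>\<^bsub>H\<^esub> a i \<alpha> \<otimes>\<^bsub>H\<^esub> inv\<^bsub>H\<^esub> g"
    have "\<phi> h \<up>\<^bsub>G\<^esub> \<beta> = \<phi> g \<otimes>\<^bsub>G\<^esub> (\<phi> i \<up>\<^bsub>G\<^esub> \<alpha>) \<up>\<^bsub>G\<^esub> \<beta> \<otimes>\<^bsub>G\<^esub> inv\<^bsub>G\<^esub> (\<phi> g)"
      using expo_conj[of "\<phi> i \<up>\<^bsub>G\<^esub> \<alpha>" "inv\<^bsub>G\<^esub> (\<phi> g)" \<beta>] * \<beta> \<phi>P by (simp add: \<phi>a expo_closed)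
    then show ?thesis using * \<beta> \<phi>P by (simp add: L.line_expo_eq \<phi>a expo_mult)
  qed
  have "(\<lambda>x. a (Atom x) \<one>\<^bsub>A\<^esub>) \<in> X \<rightarrow> carrier L.line_exp_group" using XPi by auto
  then obtain \<psi> where \<psi>: "\<psi> \<in> exp_hom A G L.line_exp_group" "\<And>x. x \<in> X \<Longrightarrow> \<psi> x = a (Atom x) \<one>\<^bsub>A\<^esub>"
    using free_exp_group_universal[OF free L.line_exp_group] by blast
  interpret \<psi>: group_hom G H \<psi>
    using \<psi>(1) G.group_axioms L.S.group_axioms by (simp add: exp_hom_def hom_def group_hom_def group_hom_axioms_def)
  \<comment> \<open>\<open>\<phi>\<close> after \<open>\<psi>\<close> respects exponents and fixes
    \<open>X\<close>, hence fixes all that \<open>X\<close> generates.\<close>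
  have "g \<in> carrier G \<and> \<phi> (\<psi> g) = g" if "g \<in> exp_generate A G X" for g
    using that
  proof induction
    case (incl x)
    then show ?case using G(2) XPi by (auto simp: \<psi>(2) \<phi>a expo_ring_one)
  next
    case (expo g \<alpha>)
    then have "\<psi> (g \<up>\<^bsub>G\<^esub> \<alpha>) = L.line_expo (\<psi> g) \<alpha>" using \<psi>(1) by (auto simp: exp_hom_def)
    then show ?case using expo by (simp add: \<phi>_expo expo_closed)
  qed auto
  then have "\<phi> (\<psi> g) = g" if "g \<in> carrier G" for g using that G(3) by blast
  then have inj: "inj_on \<psi> (carrier G)" by (rule inj_on_inverseI)
  have "word_value H \<psi> w \<noteq> \<one>\<^bsub>H\<^esub>" if w: "w \<in> carrier (free_group X)" "w \<noteq> []" for w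
  proof -
    define v :: "(('g, 'a) name \<times> bool) list" where "v = map (map_prod Atom id) w"
    have "inv_letter (map_prod Atom id l :: ('g, 'a) name \<times> bool) = map_prod Atom id (inv_letter l)" for l :: "'g \<times> bool"
      by (cases l) simp
    moreover have "inj (map_prod Atom id :: 'g \<times> bool \<Rightarrow> ('g, 'a) name \<times> bool)"
      by (intro prod.inj_map injI) auto
    ultimately have "reduced v" using w
      by (simp add: v_def successively_map free_group_simps inj_eq)
    moreover have "fst ` set v \<subseteq> Atom ` X" using w by (force simp: v_def free_group_simps)
    ultimately have "word_value H (\<lambda>i. a i \<one>\<^bsub>A\<^esub>) v \<noteq> \<one>\<^bsub>H\<^esub>" using words w by (simp add: v_def)
    moreover have "word_value H (\<lambda>i. a i \<one>\<^bsub>A\<^esub>) v = word_value H \<psi> w"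
    proof -
      have "fst ` set w \<subseteq> X" using w by (auto simp: free_group_simps)
      then show ?thesis unfolding v_def
        by (induction w) (auto simp: word_value_def letter_value_def \<psi>(2))
    qed
    ultimately show ?thesis by simp
  qed
  then show ?thesis using L.csa_group[OF tf] \<psi>.group_hom_axioms inj by blast
qed

theorem theorem10:
  fixes A :: "('a, 'm) ring_scheme" and G :: "('a, 'g, 'k) exp_group_scheme" and X :: "'g set"
  assumes "ring A"
    and "characteristic_zero A"
    and "torsion_free (add_monoid A)"
    and "free_exp_group A G X"
    and "\<not> comm_group G"
  shows "inj_on (canonical_map G) (carrier (free_group X)) \<and>
    (torsion_free G \<and> (\<forall>M. maximal_abelian_subgroup M G \<longrightarrow> conjugately_separated M G)) \<and>
    \<not> (\<exists>H. subgroup H G \<and> solvable (G\<lparr>carrier := H\<rparr>) \<and> \<not> comm_group (G\<lparr>carrier := H\<rparr>)) \<and>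
    \<not> (\<exists>H r s. 0 < r \<and> subgroup H G \<and> G\<lparr>carrier := H\<rparr> \<cong> baumslag_solitar r s \<and>
           \<not> comm_group (G\<lparr>carrier := H\<rparr>)) \<and>
    (center G = {\<one>\<^bsub>G\<^esub>} \<and> directly_indecomposable G)"
proof -
  obtain H :: "('g, 'a) name monoid" and \<psi> where H: "csa_group H" "group_hom G H \<psi>" "inj_on \<psi> (carrier G)"
    and words: "\<And>w. \<lbrakk>w \<in> carrier (free_group X); w \<noteq> []\<rbrakk> \<Longrightarrow> word_value H \<psi> w \<noteq> \<one>\<^bsub>H\<^esub>"
    using free_exp_group_embedding[OF assms(2-4)] by blast
  interpret csa_group G by (rule csa_group_of_embedding[OF H])
  have X: "X \<subseteq> carrier G" using assms(4) by (simp add: free_exp_group_def)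
  have "inj_on (canonical_map G) (carrier (free_group X))"
    unfolding inj_on_one_iff'[OF canonical_map_hom[OF X] group_free_group is_group]
  proof (intro allI impI)
    fix w assume w: "w \<in> carrier (free_group X)" "canonical_map G w = \<one>\<^bsub>G\<^esub>"
    \<comment> \<open>The canonical map followed by \<open>\<psi>\<close> evaluates words in the
      tower, where nonempty reduced words are nontrivial.\<close>
    have "word_value H (\<lambda>x. \<psi> x) w = \<psi> (word_value G (\<lambda>x. x) w)"
      using w X by (intro group_hom.word_value_hom_image[OF H(2), of _ X]) (auto simp: free_group_simps)
    then have "word_value H \<psi> w = \<one>\<^bsub>H\<^esub>"
      using w group_hom.hom_one[OF H(2)] by (simp add: canonical_map_def)
    then show "w = \<one>\<^bsub>free_group X\<^esub>" using words w by (auto simp: free_group_simps)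
  qed
  moreover have "torsion_free G" using csa_torsion_free by (auto simp: torsion_free_def)
  moreover have "comm_group (G\<lparr>carrier := K\<rparr>)" if "subgroup K G" "solvable (G\<lparr>carrier := K\<rparr>)" for K
    using csa_group.solvable_imp_comm[OF csa_subgroup] that by blast
  moreover have "comm_group (G\<lparr>carrier := K\<rparr>)"
    if "0 < r" "subgroup K G" "G\<lparr>carrier := K\<rparr> \<cong> baumslag_solitar r s" for K r s
    using csa_group.baumslag_solitar_imp_comm[OF csa_subgroup[OF that(2)] _ that(3)] that(1) by simp
  ultimately show ?thesis
    using maximal_abelian_conjugately_separated center_trivial[OF assms(5)] indecomposable[OF assms(5)]
    by blast
qed

end
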